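(* Let $k\geq 5$, $r\geq 1$ and $\ell_1,\ldots,\ell_r\geq 3$ be integers. Put $t=\sum_{i=1}^r \left\lfloor \frac{\ell_i+1}{2}\right\rfloor-1$, and let $J=\binom{n-t-2}{k-2}$ if all of $\ell_1,\ldots,\ell_r$ are even and $J=0$ otherwise. Then for all sufficiently large $n$, \[ ex_k\big(n;\mathbb{C}_{\ell_1}^{(k)},\ldots,\mathbb{C}_{\ell_r}^{(k)}\big)=\binom{n}{k}-\binom{n-t}{k}+J. \]
   Context: A $k$-uniform hypergraph is a pair $(V,E)$ where $E$ is a set of $k$-element subsets of $V$; $H$ contains $G$ if there is an injective homomorphism from $G$ into $H$. A $k$-uniform linear cycle of length $\ell$, $\mathbb{C}_\ell^{(k)}$, is a cyclic list of $k$-sets $A_1,\ldots,A_\ell$ such that consecutive sets (including $A_\ell,A_1$) intersect in exactly one element and nonconsecutive sets are disjoint. $ex_k(n;H)$ is the maximum number of edges in a $k$-uniform hypergraph on $n$ vertices not containing $H$, and $ex_k(n;F_1,\ldots,F_r)=ex_k(n;F_1\cup\cdots\cup F_r)$, where $F_1\cup\cdots\cup F_r$ denotes the vertex-disjoint union.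
   Formalization: For length 3, a linear cycle is additionally required to have no element common to all three sets; without this, three k-sets through one common vertex would also count as a cycle, and for these the formula is false. *)

theory Defs
  imports Complex_Main
begin

type_synonym 'a hypergraph = "'a set \<times> 'a set set"

definition k_uniform :: "nat \<Rightarrow> 'a hypergraph \<Rightarrow> bool" where
  "k_uniform k H \<longleftrightarrow> (\<forall>e\<in>snd H. e \<subseteq> fst H \<and> card e = k)"

definition hom :: "('a \<Rightarrow> 'b) \<Rightarrow> 'a hypergraph \<Rightarrow> 'b hypergraph \<Rightarrow> bool" where
  "hom f G H \<longleftrightarrow> f ` fst G \<subseteq> fst H \<and> (\<forall>e\<in>snd G. f ` e \<in> snd H)"

definition contains :: "'b hypergraph \<Rightarrow> 'a hypergraph \<Rightarrow> bool" where
  "contains H G \<longleftrightarrow> (\<exists>f. hom f G H \<and> inj_on f (fst G))"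

definition disjoint_union :: "'i set \<Rightarrow> ('i \<Rightarrow> 'a hypergraph) \<Rightarrow> ('i \<times> 'a) hypergraph" where
  "disjoint_union I F =
     (SIGMA i:I. fst (F i), {Pair i ` e | i e. i \<in> I \<and> e \<in> snd (F i)})"

(* For length at least 4 the last condition follows from the disjointness of nonconsecutive sets.
   For length 3 all pairs are consecutive, and it excludes three sets through one common vertex,
   which do not form a cycle. *)
definition cyclic_list :: "nat \<Rightarrow> 'a set list \<Rightarrow> bool" where
  "cyclic_list k As \<longleftrightarrow>
     (let l = length As in
       (\<forall>i<l. card (As ! i) = k) \<and>
       (\<forall>i<l. card (As ! i \<inter> As ! (Suc i mod l)) = 1) \<and>
       (\<forall>i<l. \<forall>j<l. i \<noteq> j \<and> j \<noteq> Suc i mod l \<and> i \<noteq> Suc j mod l \<longrightarrow> As ! i \<inter> As ! j = {}) \<and>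
       \<Inter> (set As) = {})"

definition linear_cycle :: "nat \<Rightarrow> nat \<Rightarrow> 'a hypergraph \<Rightarrow> bool" where
  "linear_cycle k l C \<longleftrightarrow>
     (\<exists>As. length As = l \<and> cyclic_list k As \<and> C = (\<Union> (set As), set As))"

(* Vertex sets are taken inside nat, which up to isomorphism covers all finite hypergraphs. *)
definition free_sizes :: "nat \<Rightarrow> nat \<Rightarrow> 'a hypergraph \<Rightarrow> nat set" where
  "free_sizes k n G =
     {card E | (V :: nat set) E. finite V \<and> card V = n \<and> k_uniform k (V, E) \<and> \<not> contains (V, E) G}"

definition ex :: "nat \<Rightarrow> nat \<Rightarrow> 'a hypergraph \<Rightarrow> nat" where
  "ex k n G = Max (free_sizes k n G)"

lemma finite_free_sizes: "finite (free_sizes k n G)"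
proof (rule finite_subset)
  show "free_sizes k n G \<subseteq> {..2 ^ n}"
  proof
    fix m assume "m \<in> free_sizes k n G"
    then obtain V :: "nat set" and E where
      *: "m = card E" "finite V" "card V = n" "k_uniform k (V, E)"
      by (auto simp: free_sizes_def)
    then have "E \<subseteq> Pow V" by (auto simp: k_uniform_def)
    then have "card E \<le> card (Pow V)" using * by (intro card_mono) auto
    then show "m \<in> {..2 ^ n}" using * by (simp add: card_Pow)
  qed
qed simp

lemma free_sizes_nonempty:
  assumes "snd G \<noteq> {}"
  shows "free_sizes k n G \<noteq> {}"
proof -
  have "card ({} :: nat set set) \<in> free_sizes k n G"
    unfolding free_sizes_def using assms
    by (intro CollectI exI[of _ "{..<n}"] exI[of _ "{}"])
       (auto simp: k_uniform_def contains_def hom_def)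
  then show ?thesis by blast
qed

lemma linear_cycle_exists:
  assumes "k \<ge> 2" "l \<ge> 3"
  shows "\<exists>C :: (nat \<times> nat) hypergraph. linear_cycle k l C"
proof -
  define A where "A i = insert (Suc i mod l, 0) ({i} \<times> {..<k-1})" for i :: nat
  have ne: "Suc i mod l \<noteq> i" "Suc (Suc i mod l) mod l \<noteq> i" if "i < l" for i
    using that assms by (auto simp: mod_Suc)
  have inj: "i = j" if "Suc i mod l = Suc j mod l" "i < l" "j < l" for i j
    using that by (auto simp: mod_Suc split: if_splits)
  have lt: "Suc i mod l < l" for i using assms by simp
  have card: "card (A i) = k" if "i < l" for i
    using ne(1)[OF that] assms by (simp add: A_def card_insert_if)
  have cons: "A i \<inter> A (Suc i mod l) = {(Suc i mod l, 0)}" if "i < l" for i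
    using ne[OF that] ne(1)[OF lt[of i]] assms by (auto simp: A_def)
  have disj: "A i \<inter> A j = {}"
    if "i < l" "j < l" "i \<noteq> j" "j \<noteq> Suc i mod l" "i \<noteq> Suc j mod l" for i j
    using that inj[of i j] by (auto simp: A_def)
  have "A 0 \<inter> A 1 \<inter> A 2 = {}"
    using assms by (cases "l = 3") (auto simp: A_def mod_Suc)
  moreover have "0 \<in> {0..<l}" "1 \<in> {0..<l}" "2 \<in> {0..<l}"
    using assms by auto
  ultimately have int: "\<Inter> (A ` {0..<l}) = {}"
    by blast
  have "cyclic_list k (map A [0..<l])"
    unfolding cyclic_list_def Let_def
    using card cons disj int lt by auto
  then show ?thesis
    unfolding linear_cycle_def by (intro exI[of _ "map A [0..<l]"] exI) auto
qed

end

theory Submission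
  imports Defs "HOL-Library.FuncSet"
begin

text \<open>Call a set rich if it extends to an edge avoiding any $N$ prescribed vertices. A skeleton of rich sets
  extends greedily to disjoint linear cycles, so it suffices to find rich sets of two or three elements that
  form cycles. For the lower bound take
  all edges meeting a $t$-set and, if all lengths are even, the edges through a fixed further pair.

  For the upper bound, Fueredi's homogeneous families show that a dense cycle-free family has a vertex of high
  degree; removing such vertices leaves a bounded set of centres missed by few edges. Almost every $(k-1)$-set is
  joined to exactly $t$ centres, and two such sets differing in one element are almost always joined to the same
  ones. Hence one $t$-set $T$ meets all but $o(n^{k-1})$ edges.

  If a family at least as large as the construction has an edge (or, for even lengths, two edges with one common
  element) outside $T$ that reaches vertices of small missing degree, then it closes a cycle through $T$. The
  remaining edges outside $T$ are outnumbered by the missing ones, except for a family without singleton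
  intersections, which has at most $\binom{n-t-2}{k-2}$ members by a theorem of Frankl.\<close>

section \<open>Greedy extension\<close>

text \<open>A linear cycle of length l needs s = (l + 1) div 2 vertices to meet all its edges, so t
  + 1, the sum of the s, is the number of centres that supports all cycles at once. With t centres
  one cycle has to do with s - 1: its alternating path through centres lacks one edge if l is odd,
  and two edges meeting in one vertex if l is even. This is the source of J: if all lengths are
  even, one edge outside T creates no cycles, while two that meet in a single vertex can.

  The obstacle is that the shadow count bounds cycle-free families only by a constant times n^(k-1),
  the order of the extremal number itself, so it cannot locate T. Homogeneous families improve it to
  o(n^(k-1)) when all degrees are o(n^(k-1)). There k >= 5 enters: the centre colour of a star
  pattern is played against two disjoint pairs of other colours.

  One bound N on the number of forbidden vertices serves throughout. It allows all disjoint cycles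
  to be built simultaneously rather than one after the other.\<close>

definition cycle_system :: "nat \<Rightarrow> 'i set \<Rightarrow> ('i \<Rightarrow> nat) \<Rightarrow> 'v set set \<Rightarrow> bool" where
  "cycle_system k I l E \<longleftrightarrow> (\<exists>A. (\<forall>i\<in>I. length (A i) = l i \<and> cyclic_list k (A i) \<and> set (A i) \<subseteq> E) \<and>
    (\<forall>i\<in>I. \<forall>j\<in>I. i \<noteq> j \<longrightarrow> \<Union> (set (A i)) \<inter> \<Union> (set (A j)) = {}))"

text \<open>For large N this is a robust form of being the kernel of a sunflower. \<open>Z\<close>
  has to spare only \<open>K\<close> itself, so an edge is rich for every N and can be handled like
  a rich pair.\<close>

definition rich :: "'v set set \<Rightarrow> nat \<Rightarrow> 'v set \<Rightarrow> bool" where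
  "rich E N K \<longleftrightarrow> (\<forall>Z. finite Z \<longrightarrow> card Z \<le> N \<longrightarrow> Z \<inter> K = {} \<longrightarrow> (\<exists>e\<in>E. K \<subseteq> e \<and> e \<inter> Z = {}))"

lemma cycle_system_mono:
  assumes "cycle_system k I l E" "E \<subseteq> F"
  shows "cycle_system k I l F"
proof -
  obtain A where "\<forall>i\<in>I. length (A i) = l i \<and> cyclic_list k (A i) \<and> set (A i) \<subseteq> E"
    "\<forall>i\<in>I. \<forall>j\<in>I. i \<noteq> j \<longrightarrow> \<Union> (set (A i)) \<inter> \<Union> (set (A j)) = {}"
    using assms(1) unfolding cycle_system_def by blast
  with assms(2) show ?thesis unfolding cycle_system_def by (intro exI[of _ A]) blast
qed

lemma richD:
  assumes "rich E N K" "finite Z" "card Z \<le> N" "Z \<inter> K = {}"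
  obtains e where "e \<in> E" "K \<subseteq> e" "e \<inter> Z = {}"
  using assms unfolding rich_def by blast

lemma rich_mono: "rich E N K \<Longrightarrow> E \<subseteq> F \<Longrightarrow> M \<le> N \<Longrightarrow> rich F M K"
  unfolding rich_def by (auto 0 4 dest: subsetD)

lemma rich_edge: "e \<in> E \<Longrightarrow> rich E N e"
  unfolding rich_def by blast

text \<open>Greedy choice: while \<open>K p\<close> is being extended, all edges chosen so far and
  all sets still waiting are forbidden outside \<open>K p\<close>. These are at most
  \<open>k * card P\<close> vertices.\<close>

lemma rich_extend:
  assumes P: "finite P" and E: "\<And>e. e \<in> E \<Longrightarrow> finite e \<and> card e \<le> k"
    and r: "\<And>p. p \<in> P \<Longrightarrow> rich E (k * card P) (K p)"
  obtains e where "\<And>p. p \<in> P \<Longrightarrow> e p \<in> E" "\<And>p. p \<in> P \<Longrightarrow> K p \<subseteq> e p"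
    "\<And>p q. p \<in> P \<Longrightarrow> q \<in> P \<Longrightarrow> p \<noteq> q \<Longrightarrow> e p \<inter> e q = K p \<inter> K q"
proof -
  have Kf: "finite (K p) \<and> card (K p) \<le> k" if p: "p \<in> P" for p
  proof -
    obtain e where "e \<in> E" "K p \<subseteq> e"
      by (rule richD[OF r[OF p], of "{}"]) auto
    with E[of e] show ?thesis
      by (meson card_mono finite_subset le_trans)
  qed
  \<comment> \<open>The clause on all \<open>q\<close> in \<open>P\<close> keeps a chosen edge away
    from the sets not yet extended; otherwise a later edge, which contains its \<open>K q\<close>,
    would meet it in additional vertices.\<close>
  define good where "good e Q \<longleftrightarrow> (\<forall>p\<in>Q. e p \<in> E \<and> K p \<subseteq> e p \<and> (\<forall>q\<in>P. q \<noteq> p \<longrightarrow> e p \<inter> K q = K p \<inter> K q)) \<and>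
      (\<forall>p\<in>Q. \<forall>q\<in>Q. p \<noteq> q \<longrightarrow> e p \<inter> e q = K p \<inter> K q)" for e :: "'a \<Rightarrow> 'b set" and Q
  have "\<exists>e. good e Q" if "Q \<subseteq> P" "finite Q" for Q
    using that(2,1)
  proof (induction Q rule: finite_induct)
    case empty
    show ?case by (auto simp: good_def)
  next
    case (insert p Q)
    then obtain e where e: "good e Q" by auto
    have e1: "e q \<in> E" "K q \<subseteq> e q" "q' \<in> P \<Longrightarrow> q' \<noteq> q \<Longrightarrow> e q \<inter> K q' = K q \<inter> K q'" if "q \<in> Q" for q q'
      using e that unfolding good_def by auto
    have e2: "e q \<inter> e q' = K q \<inter> K q'" if "q \<in> Q" "q' \<in> Q" "q \<noteq> q'" for q q'
      using e that unfolding good_def by auto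
    \<comment> \<open>Indices already treated contribute their edge, the others their bare
      set.\<close>
    define g where "g q = (if q \<in> Q then e q else K q)" for q
    define Z where "Z = (\<Union>q\<in>P. g q) - K p"
    have g: "finite (g q) \<and> card (g q) \<le> k" if "q \<in> P" for q
      using that e1(1) E Kf by (auto simp: g_def)
    have "card (\<Union>q\<in>P. g q) \<le> (\<Sum>q\<in>P. card (g q))"
      by (rule card_UN_le[OF P])
    also have "\<dots> \<le> (\<Sum>q\<in>P. k)" using g by (intro sum_mono) auto
    finally have "card (\<Union>q\<in>P. g q) \<le> k * card P" by (simp add: mult.commute)
    moreover have fu: "finite (\<Union>q\<in>P. g q)" using P g by auto
    ultimately have "card Z \<le> k * card P" "finite Z"
      unfolding Z_def using card_mono[OF fu, of "(\<Union>q\<in>P. g q) - K p"] by auto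
    moreover have "p \<in> P" using insert by auto
    ultimately obtain f where f: "f \<in> E" "K p \<subseteq> f" "f \<inter> Z = {}"
      using richD[OF r, of p Z] by (auto simp: Z_def)
    have fZ: "x \<in> K p" if "x \<in> f" "x \<in> g q" "q \<in> P" for x q
      using f(3) that unfolding Z_def by blast
    have fK: "f \<inter> K q = K p \<inter> K q" if "q \<in> P" "q \<noteq> p" for q
    proof -
      have "K q \<subseteq> g q" using e1(2) by (auto simp: g_def)
      then show ?thesis using fZ[of _ q] that f(2) by blast
    qed
    have fe: "f \<inter> e q = K p \<inter> K q" if "q \<in> Q" for q
    proof -
      have q: "q \<in> P" "q \<noteq> p" using that insert by auto
      have "g q = e q" using that by (simp add: g_def)
      then have "f \<inter> e q = K p \<inter> e q" using fZ[of _ q] q f(2) by blast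
      then show ?thesis using e1(3)[OF that, of p] q \<open>p \<in> P\<close> by blast
    qed
    have "good (e(p := f)) (insert p Q)"
      unfolding good_def using f fK fe e1 e2 insert.hyps insert.prems by (auto simp: Int_commute)
    then show ?case by blast
  qed
  from this[OF order_refl P] obtain e where "good e P" by blast
  then show thesis by (intro that[of e]) (auto simp: good_def)
qed

text \<open>\<open>x i j\<close> is the joint at which edge \<open>j\<close> of cycle
  \<open>i\<close> begins. The sets \<open>K i j\<close> may be larger than the two joints they must
  contain, for instance a prescribed edge, as long as they overlap in joints only;
  \<open>rich_extend\<close> creates no further intersections.\<close>

lemma skeleton:
  fixes x :: "'i \<Rightarrow> nat \<Rightarrow> 'v" and K :: "'i \<Rightarrow> nat \<Rightarrow> 'v set"
  assumes I: "finite I" and l: "\<And>i. i \<in> I \<Longrightarrow> l i \<ge> 3"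
    and E: "\<And>e. e \<in> E \<Longrightarrow> finite e \<and> card e = k"
    and r: "\<And>i j. i \<in> I \<Longrightarrow> j < l i \<Longrightarrow> rich E N (K i j)"
    and N: "N \<ge> k * sum l I"
    and inj: "\<And>i j i' j'. i \<in> I \<Longrightarrow> i' \<in> I \<Longrightarrow> j < l i \<Longrightarrow> j' < l i' \<Longrightarrow> x i j = x i' j' \<Longrightarrow> i = i' \<and> j = j'"
    and K1: "\<And>i j. i \<in> I \<Longrightarrow> j < l i \<Longrightarrow> x i j \<in> K i j"
    and K2: "\<And>i j. i \<in> I \<Longrightarrow> j < l i \<Longrightarrow> x i (Suc j mod l i) \<in> K i j"
    and K3: "\<And>i j i' j'. i \<in> I \<Longrightarrow> i' \<in> I \<Longrightarrow> j < l i \<Longrightarrow> j' < l i' \<Longrightarrow> (i, j) \<noteq> (i', j') \<Longrightarrow>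
      K i j \<inter> K i' j' \<subseteq> {x i j, x i (Suc j mod l i)} \<inter> {x i' j', x i' (Suc j' mod l i')}"
  shows "cycle_system k I l E"
proof -
  define P where "P = (SIGMA i:I. {..<l i})"
  have P: "finite P" "card P = sum l I" using I by (auto simp: P_def card_SigmaI)
  obtain e where e: "\<And>p. p \<in> P \<Longrightarrow> e p \<in> E" "\<And>p. p \<in> P \<Longrightarrow> (case p of (i,j) \<Rightarrow> K i j) \<subseteq> e p"
    "\<And>p q. p \<in> P \<Longrightarrow> q \<in> P \<Longrightarrow> p \<noteq> q \<Longrightarrow> e p \<inter> e q = (case p of (i,j) \<Rightarrow> K i j) \<inter> (case q of (i,j) \<Rightarrow> K i j)"
  proof (rule rich_extend[of P E k "\<lambda>(i,j). K i j"])
    show "rich E (k * card P) (case p of (i,j) \<Rightarrow> K i j)" if "p \<in> P" for p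
      using that r rich_mono[OF _ order_refl N] P by (auto simp: P_def)
  qed (use E P in auto)
  define J where "J i j = {x i j, x i (Suc j mod l i)}" for i j
  have ee: "e (i,j) \<inter> e (i',j') = J i j \<inter> J i' j'"
    if "i \<in> I" "i' \<in> I" "j < l i" "j' < l i'" "(i,j) \<noteq> (i',j')" for i j i' j'
  proof -
    have "e (i,j) \<inter> e (i',j') = K i j \<inter> K i' j'" using e(3)[of "(i,j)" "(i',j')"] that by (auto simp: P_def)
    moreover have "J i j \<subseteq> K i j" "J i' j' \<subseteq> K i' j'" using K1 K2 that by (auto simp: J_def)
    ultimately show ?thesis using K3[OF that] unfolding J_def by blast
  qed
  have lt: "Suc j mod l i < l i" if "i \<in> I" for i j using l[OF that] by simp
  have ne: "Suc j mod l i \<noteq> j" "Suc (Suc j mod l i) mod l i \<noteq> j" if "i \<in> I" "j < l i" for i j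
    using that l[of i] by (auto simp: mod_Suc)
  have sinj: "j = j'" if "Suc j mod l i = Suc j' mod l i" "j < l i" "j' < l i" for i j j'
    using that by (auto simp: mod_Suc split: if_splits)
  have xinj: "x i j = x i' j' \<longleftrightarrow> i = i' \<and> j = j'"
    if "i \<in> I" "i' \<in> I" "j < l i" "j' < l i'" for i j i' j'
    using inj[OF that] by auto
  have cons: "e (i,j) \<inter> e (i, Suc j mod l i) = {x i (Suc j mod l i)}" if i: "i \<in> I" "j < l i" for i j
  proof -
    have "e (i,j) \<inter> e (i, Suc j mod l i) = J i j \<inter> J i (Suc j mod l i)"
      using ne[OF i] lt[OF i(1)] i by (intro ee) auto
    also have "\<dots> = {x i (Suc j mod l i)}"
      using ne[OF i] by (auto simp: J_def xinj i lt)
    finally show ?thesis .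
  qed
  define A where "A i = map (\<lambda>j. e (i,j)) [0..<l i]" for i
  have "cyclic_list k (A i)" if i: "i \<in> I" for i
  proof -
    have "A i ! j \<inter> A i ! j' = {}" if "j < l i" "j' < l i" "j \<noteq> j'" "j' \<noteq> Suc j mod l i" "j \<noteq> Suc j' mod l i" for j j'
    proof -
      have "e (i,j) \<inter> e (i,j') = J i j \<inter> J i j'" using ee i that by auto
      also have "\<dots> = {}"
        using that sinj[of j i j'] by (auto simp: J_def xinj i lt)
      finally show ?thesis using that by (simp add: A_def)
    qed
    \<comment> \<open>This needs an argument of its own for triangles, where no two edges are
      nonconsecutive: three successive edges pass through two distinct joints.\<close>
    moreover have "\<Inter> (set (A i)) = {}"
    proof -
      have "e (i,0) \<inter> e (i,1) = {x i 1}" "e (i,1) \<inter> e (i,2) = {x i (2 mod l i)}" 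
        using cons[OF i, of 0] cons[OF i, of 1] l[OF i] by (auto simp: numeral_2_eq_2)
      moreover have "x i 1 \<noteq> x i 2" using inj[of i i 1 2] i l[OF i] by auto
      ultimately have "e (i,0) \<inter> e (i,1) \<inter> e (i,2) = {}" using l[OF i] by auto
      moreover have "e (i,0) \<in> set (A i)" "e (i,1) \<in> set (A i)" "e (i,2) \<in> set (A i)"
        using l[OF i] by (auto simp: A_def)
      ultimately show ?thesis by blast
    qed
    moreover have "card (A i ! j) = k" if "j < l i" for j
      using e(1)[of "(i,j)"] E i that by (auto simp: P_def A_def)
    moreover have "card (A i ! j \<inter> A i ! (Suc j mod l i)) = 1" if "j < l i" for j
      using cons[OF i that] lt[OF i] that by (auto simp: A_def)
    ultimately show ?thesis
      unfolding cyclic_list_def Let_def by (auto simp: A_def)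
  qed
  moreover have "length (A i) = l i" "set (A i) \<subseteq> E" if "i \<in> I" for i
    using e(1) that by (auto simp: A_def P_def)
  moreover have "\<Union> (set (A i)) \<inter> \<Union> (set (A i')) = {}" if i: "i \<in> I" "i' \<in> I" "i \<noteq> i'" for i i'
  proof -
    have "e (i,j) \<inter> e (i',j') = {}" if "j < l i" "j' < l i'" for j j'
      using ee[OF i(1,2) that] i that by (auto simp: J_def xinj lt)
    then show ?thesis by (fastforce simp: A_def)
  qed
  ultimately show ?thesis unfolding cycle_system_def by (intro exI[of _ A]) blast
qed

section \<open>Counting the k-sets that contain a fixed set\<close>

lemma binomial_le_power: "n choose r \<le> n ^ r"
proof -
  have "(n choose r) * 1 \<le> (n choose r) * fact r" by (intro mult_le_mono2) simp
  also have "\<dots> \<le> n ^ r" by (rule binomial_fact_pow)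
  finally show ?thesis by simp
qed

lemma card_supersets:
  assumes "finite W" "P \<subseteq> W" "card P \<le> k"
  shows "card {e. e \<subseteq> W \<and> card e = k \<and> P \<subseteq> e} = (card W - card P) choose (k - card P)"
proof -
  have fP: "finite P" using assms finite_subset by blast
  have "bij_betw (\<lambda>e. e - P) {e. e \<subseteq> W \<and> card e = k \<and> P \<subseteq> e} {B. B \<subseteq> W - P \<and> card B = k - card P}"
  proof (rule bij_betw_byWitness[where f' = "\<lambda>B. B \<union> P"])
    show "(\<lambda>e. e - P) ` {e. e \<subseteq> W \<and> card e = k \<and> P \<subseteq> e} \<subseteq> {B. B \<subseteq> W - P \<and> card B = k - card P}"
      using fP by (auto simp: card_Diff_subset)
    show "(\<lambda>B. B \<union> P) ` {B. B \<subseteq> W - P \<and> card B = k - card P} \<subseteq> {e. e \<subseteq> W \<and> card e = k \<and> P \<subseteq> e}"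
    proof clarsimp
      fix B assume B: "B \<subseteq> W - P" "card B = k - card P"
      then have "finite B" "B \<inter> P = {}" using assms(1) finite_subset[of B W] by auto
      then show "B \<subseteq> W \<and> P \<subseteq> W \<and> card (B \<union> P) = k"
        using B assms fP by (auto simp: card_Un_disjoint)
    qed
  qed auto
  then have "card {e. e \<subseteq> W \<and> card e = k \<and> P \<subseteq> e} = card {B. B \<subseteq> W - P \<and> card B = k - card P}"
    by (rule bij_betw_same_card)
  also have "\<dots> = card (W - P) choose (k - card P)" using assms by (simp add: n_subsets)
  also have "card (W - P) = card W - card P" using assms fP by (simp add: card_Diff_subset)
  finally show ?thesis .
qed

lemma finite_uniform: "finite V \<Longrightarrow> finite {e. e \<subseteq> V \<and> Q e}"
  by (rule finite_subset[of _ "Pow V"]) auto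

lemma card_supersets_le:
  assumes "finite V" "card P \<le> k"
  shows "card {e. e \<subseteq> V \<and> card e = k \<and> P \<subseteq> e} \<le> card V ^ (k - card P)"
proof (cases "P \<subseteq> V")
  case True
  then have "card {e. e \<subseteq> V \<and> card e = k \<and> P \<subseteq> e} = (card V - card P) choose (k - card P)"
    using assms by (simp add: card_supersets)
  also have "\<dots> \<le> (card V - card P) ^ (k - card P)" by (rule binomial_le_power)
  also have "\<dots> \<le> card V ^ (k - card P)" by (rule power_mono) auto
  finally show ?thesis .
next
  case False
  then have "{e. e \<subseteq> V \<and> card e = k \<and> P \<subseteq> e} = {}" by auto
  then show ?thesis by (simp only: card.empty)
qed

section \<open>Linear cycles of equal length are isomorphic\<close>

text \<open>Three indices that are pairwise neighbours on a cycle force \<open>l = 3\<close>, and in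
  that case the empty total intersection excludes a common vertex.\<close>

lemma cyclic_list_three:
  assumes "cyclic_list k As" "length As = l" "l \<ge> 3" "a < l" "b < l" "c < l" "a \<noteq> b" "b \<noteq> c" "a \<noteq> c"
    "x \<in> As ! a" "x \<in> As ! b" "x \<in> As ! c"
  shows False
proof -
  have nc: "j = Suc i mod l \<or> i = Suc j mod l" if "i < l" "j < l" "i \<noteq> j" "x \<in> As ! i" "x \<in> As ! j" for i j
    using assms(1,2) that unfolding cyclic_list_def Let_def by blast
  have adj: "b = Suc a mod l \<or> a = Suc b mod l" "c = Suc b mod l \<or> b = Suc c mod l" "c = Suc a mod l \<or> a = Suc c mod l"
    using nc[of a b] nc[of b c] nc[of a c] assms by blast+
  show False
  proof (cases "l = 3")
    case True
    then have "{a, b, c} = {0, 1, 2}" using assms by auto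
    then have "j \<in> {a, b, c}" if "j < l" for j using that True by auto
    then have "x \<in> As ! j" if "j < l" for j using that assms(10-12) by blast
    then have "x \<in> \<Inter> (set As)" using assms(2) by (auto simp: in_set_conv_nth)
    then show False using assms(1) unfolding cyclic_list_def Let_def by simp
  next
    case False
    then show False using adj assms(3-9) by (auto simp: mod_Suc split: if_splits)
  qed
qed

lemma cyclic_list_Int_le_1:
  assumes "cyclic_list k As" "i < length As" "j < length As" "i \<noteq> j"
  shows "card (As ! i \<inter> As ! j) \<le> 1"
proof -
  have "As ! i \<inter> As ! j = {} \<or> j = Suc i mod length As \<or> i = Suc j mod length As"
    using assms unfolding cyclic_list_def Let_def by blast
  moreover have "card (As ! i \<inter> As ! (Suc i mod length As)) = 1" "card (As ! j \<inter> As ! (Suc j mod length As)) = 1"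
    using assms unfolding cyclic_list_def Let_def by blast+
  ultimately show ?thesis by (auto simp: Int_commute)
qed

lemma bij_of_fibres:
  assumes "finite X" "finite Y" "\<And>J. card {x \<in> X. \<sigma> x = J} = card {y \<in> Y. \<tau> y = J}"
  obtains g where "bij_betw g X Y" "\<And>x. x \<in> X \<Longrightarrow> \<tau> (g x) = \<sigma> x"
proof -
  have "\<exists>h. bij_betw h {x \<in> X. \<sigma> x = J} {y \<in> Y. \<tau> y = J}" for J
    using assms by (intro finite_same_card_bij) auto
  then obtain h where h: "\<And>J. bij_betw (h J) {x \<in> X. \<sigma> x = J} {y \<in> Y. \<tau> y = J}" by metis
  define g where "g x = h (\<sigma> x) x" for x
  have gx: "g x \<in> Y" "\<tau> (g x) = \<sigma> x" if "x \<in> X" for x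
    using bij_betwE[OF h[of "\<sigma> x"]] that by (auto simp: g_def)
  have "inj_on g X"
  proof (rule inj_onI)
    fix x y assume xy: "x \<in> X" "y \<in> X" "g x = g y"
    then have "\<sigma> x = \<sigma> y" using gx by metis
    moreover from this have "h (\<sigma> x) x = h (\<sigma> x) y" using xy by (simp add: g_def)
    ultimately show "x = y"
      using bij_betw_imp_inj_on[OF h[of "\<sigma> x"]] xy by (auto dest: inj_onD)
  qed
  moreover have "g ` X = Y"
  proof
    show "g ` X \<subseteq> Y" using gx by auto
    show "Y \<subseteq> g ` X"
    proof
      fix y assume "y \<in> Y"
      then have "y \<in> h (\<tau> y) ` {x \<in> X. \<sigma> x = \<tau> y}"
        using bij_betw_imp_surj_on[OF h[of "\<tau> y"]] by auto
      then obtain x where "x \<in> X" "\<sigma> x = \<tau> y" "y = h (\<tau> y) x" by auto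
      then show "y \<in> g ` X" by (intro image_eqI[of _ _ x]) (simp_all add: g_def)
    qed
  qed
  ultimately show thesis using that gx by (simp add: bij_betw_def)
qed

text \<open>A vertex is either private to one edge or the joint of two consecutive ones, so the
  number of vertices with a given incidence pattern depends on k and l only. Matching equal patterns
  by \<open>bij_of_fibres\<close> identifies any two linear cycles with the same parameters.\<close>

lemma cyclic_list_fibre:
  fixes As :: "'v set list"
  assumes c: "cyclic_list k As" and l: "length As = l" "l \<ge> 3" and k: "k \<ge> 1"
  shows "card {x \<in> \<Union> (set As). {j. j < l \<and> x \<in> As ! j} = J} =
    (if \<exists>j<l. J = {j} then k - 2 else if \<exists>j<l. J = {j, Suc j mod l} then 1 else 0)"
proof -
  define sg where "sg x = {j. j < l \<and> x \<in> As ! j}" for x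
  have three: False if "a < l" "b < l" "c < l" "a \<noteq> b" "b \<noteq> c" "a \<noteq> c" "x \<in> As ! a" "x \<in> As ! b" "x \<in> As ! c" for a b c x
    using cyclic_list_three[OF c l that] .
  have Sl: "Suc j mod l < l" for j using l by simp
  have ne: "Suc j mod l \<noteq> j" if "j < l" for j using that l by (auto simp: mod_Suc)
  have fin: "finite (As ! j)" "card (As ! j) = k" if "j < l" for j
    using c k that l unfolding cyclic_list_def Let_def by (auto intro: card_ge_0_finite)
  have one: "card (As ! j \<inter> As ! (Suc j mod l)) = 1" if "j < l" for j
    using c that l unfolding cyclic_list_def Let_def by auto
  have mem: "x \<in> \<Union> (set As)" if "j \<in> sg x" for x j
    using that l by (auto simp: sg_def)
  have "card {x \<in> \<Union> (set As). sg x = J} = (if \<exists>j<l. J = {j} then k - 2 else if \<exists>j<l. J = {j, Suc j mod l} then 1 else 0)"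
  proof (cases "\<exists>j<l. J = {j}")
    case True
    then obtain j where j: "j < l" "J = {j}" by blast
    \<comment> \<open>The predecessor of \<open>j\<close> on the cycle; an edge loses one joint to
      each of its two neighbours, which leaves k - 2 private vertices.\<close>
    define i where "i = (if j = 0 then l - 1 else j - 1)"
    have i: "i < l" "Suc i mod l = j" using j l by (auto simp: i_def)
    have ij: "i \<noteq> Suc j mod l" "i \<noteq> j" using j l by (auto simp: i_def mod_Suc split: if_splits)
    define P where "P = As ! j \<inter> As ! (Suc j mod l)"
    define Q where "Q = As ! i \<inter> As ! j"
    have "card P = 1" "card Q = 1" using one[OF j(1)] one[OF i(1)] i by (auto simp: P_def Q_def)
    moreover have "P \<inter> Q = {}" using three[OF j(1) Sl i(1)] ne[OF j(1)] ij by (force simp: P_def Q_def)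
    moreover have "finite P" "finite Q" using fin[OF j(1)] by (auto simp: P_def Q_def)
    ultimately have "card (P \<union> Q) = 2" by (simp add: card_Un_disjoint)
    have "{x \<in> \<Union> (set As). sg x = J} = As ! j - (P \<union> Q)"
    proof (intro set_eqI iffI)
      fix x assume "x \<in> {x \<in> \<Union> (set As). sg x = J}"
      then have "sg x = {j}" using j by simp
      then have "j \<in> sg x" "i \<notin> sg x" "Suc j mod l \<notin> sg x" using ij ne[OF j(1)] by simp_all
      then show "x \<in> As ! j - (P \<union> Q)" using i(1) Sl[of j] by (simp add: sg_def P_def Q_def)
    next
      fix x assume x: "x \<in> As ! j - (P \<union> Q)"
      have "a = j" if "a < l" "x \<in> As ! a" for a
      proof (rule ccontr)
        assume n: "a \<noteq> j"
        have "As ! j \<inter> As ! a \<noteq> {}" using x that by auto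
        then have "a = Suc j mod l \<or> j = Suc a mod l"
          using c l j that n unfolding cyclic_list_def Let_def by blast
        moreover have "a = i" if "j = Suc a mod l"
          using that \<open>a < l\<close> j l by (auto simp: i_def mod_Suc split: if_splits)
        ultimately show False using x that by (auto simp: P_def Q_def)
      qed
      moreover have "x \<in> As ! j" using x by simp
      ultimately have "\<And>a. a \<in> sg x \<longleftrightarrow> a \<in> J" using j unfolding sg_def by blast
      then have "sg x = J" by blast
      then show "x \<in> {x \<in> \<Union> (set As). sg x = J}" using mem[of j x] j by auto
    qed
    then have "card {x \<in> \<Union> (set As). sg x = J} = k - 2"
      using fin[OF j(1)] \<open>card (P \<union> Q) = 2\<close> by (simp add: card_Diff_subset P_def Q_def Un_subset_iff)
    then show ?thesis using True by simp
  next
    case nT: False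
    show ?thesis
    proof (cases "\<exists>j<l. J = {j, Suc j mod l}")
      case True
      then obtain j where j: "j < l" "J = {j, Suc j mod l}" by blast
      have "{x \<in> \<Union> (set As). sg x = J} = As ! j \<inter> As ! (Suc j mod l)"
      proof (intro set_eqI iffI)
        fix x assume "x \<in> {x \<in> \<Union> (set As). sg x = J}"
        then have "j \<in> sg x" "Suc j mod l \<in> sg x" using j by simp_all
        then show "x \<in> As ! j \<inter> As ! (Suc j mod l)" by (simp add: sg_def)
      next
        fix x assume x: "x \<in> As ! j \<inter> As ! (Suc j mod l)"
        moreover have "a \<in> {j, Suc j mod l}" if "a < l" "x \<in> As ! a" for a
          using three[OF j(1) Sl[of j] that(1) _ _ _ _ _ that(2)] ne[OF j(1)] x by auto
        ultimately have "\<And>a. a \<in> sg x \<longleftrightarrow> a \<in> J" using j Sl[of j] unfolding sg_def by blast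
        then have "sg x = J" by blast
        then show "x \<in> {x \<in> \<Union> (set As). sg x = J}" using mem[of j x] j by auto
      qed
      then show ?thesis by (simp only: one[OF j(1)] nT True if_True if_False)
    next
      case False
      have "sg x \<noteq> J" if xU: "x \<in> \<Union> (set As)" for x
      proof
        assume sJ: "sg x = J"
        obtain j where j: "j < l" "x \<in> As ! j" using xU l by (metis UnionE in_set_conv_nth)
        then have "sg x \<noteq> {j}" using nT sJ by auto
        then obtain a where a: "a < l" "x \<in> As ! a" "a \<noteq> j" using j unfolding sg_def by blast
        have "As ! j \<inter> As ! a \<noteq> {}" using j a by auto
        then have adj: "a = Suc j mod l \<or> j = Suc a mod l"
          using c l j a unfolding cyclic_list_def Let_def by blast
        have "b \<in> {j, a}" if "b < l" "x \<in> As ! b" for b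
          using three[OF j(1) a(1) that(1) _ _ _ j(2) a(2) that(2)] a(3) by auto
        then have sx: "sg x = {j, a}" using j a unfolding sg_def by blast
        from adj show False
        proof
          assume "a = Suc j mod l"
          then show False using False sJ sx j(1) by blast
        next
          assume "j = Suc a mod l"
          then show False using False sJ sx a(1) by (metis insert_commute)
        qed
      qed
      then have "{x \<in> \<Union> (set As). sg x = J} = {}" by blast
      then show ?thesis by (simp only: card.empty nT False if_False)
    qed
  qed
  then show ?thesis by (simp add: sg_def)
qed

lemma cyclic_list_iso:
  fixes As :: "'v set list" and Bs :: "'w set list"
  assumes "cyclic_list k As" "cyclic_list k Bs" "length As = l" "length Bs = l" "l \<ge> 3" "k \<ge> 1"
  obtains g where "bij_betw g (\<Union> (set As)) (\<Union> (set Bs))" "\<And>j. j < l \<Longrightarrow> g ` (As ! j) = Bs ! j"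
proof -
  have fin: "finite (\<Union> (set Cs))" if "cyclic_list k Cs" for Cs :: "'u set list"
  proof (rule finite_Union)
    fix X assume "X \<in> set Cs"
    then obtain i where "i < length Cs" "X = Cs ! i" by (metis in_set_conv_nth)
    then have "card X = k" using that unfolding cyclic_list_def Let_def by blast
    then show "finite X" using assms(6) by (intro card_ge_0_finite) simp
  qed simp
  have eq: "card {x \<in> \<Union> (set As). {j. j < l \<and> x \<in> As ! j} = J} = card {x \<in> \<Union> (set Bs). {j. j < l \<and> x \<in> Bs ! j} = J}" for J
    unfolding cyclic_list_fibre[OF assms(1,3,5,6)] cyclic_list_fibre[OF assms(2,4,5,6)] ..
  obtain g where g: "bij_betw g (\<Union> (set As)) (\<Union> (set Bs))"
    "\<And>x. x \<in> \<Union> (set As) \<Longrightarrow> {j. j < l \<and> g x \<in> Bs ! j} = {j. j < l \<and> x \<in> As ! j}"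
    using bij_of_fibres[OF fin[OF assms(1)] fin[OF assms(2)] eq] by blast
  have "g ` (As ! j) = Bs ! j" if j: "j < l" for j
  proof
    show "g ` (As ! j) \<subseteq> Bs ! j"
    proof
      fix y assume "y \<in> g ` (As ! j)"
      then obtain x where x: "x \<in> As ! j" "y = g x" by blast
      moreover have "x \<in> \<Union> (set As)" using x j assms by auto
      ultimately show "y \<in> Bs ! j" using g(2)[of x] j by auto
    qed
    show "Bs ! j \<subseteq> g ` (As ! j)"
    proof
      fix y assume y: "y \<in> Bs ! j"
      then have "y \<in> \<Union> (set Bs)" using j assms by auto
      then obtain x where x: "x \<in> \<Union> (set As)" "y = g x" using bij_betw_imp_surj_on[OF g(1)] by blast
      then show "y \<in> g ` (As ! j)" using g(2)[OF x(1)] y j by auto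
    qed
  qed
  with g(1) show thesis by (rule that)
qed

text \<open>With the converse \<open>cycle_system_if_contains\<close> this removes the given
  hypergraphs \<open>C i\<close> from the argument: from here on only the lengths matter.\<close>

lemma contains_disjoint_union:
  fixes C :: "'i \<Rightarrow> 'a hypergraph" and E :: "'v set set"
  assumes C: "\<And>i. i \<in> I \<Longrightarrow> linear_cycle k (l i) (C i)" and l: "\<And>i. i \<in> I \<Longrightarrow> l i \<ge> 3" and k: "k \<ge> 1"
    and E: "\<Union> E \<subseteq> V" and sys: "cycle_system k I l E"
  shows "contains (V, E) (disjoint_union I C)"
proof -
  obtain A where A: "\<forall>i\<in>I. length (A i) = l i \<and> cyclic_list k (A i) \<and> set (A i) \<subseteq> E"
    "\<forall>i\<in>I. \<forall>j\<in>I. i \<noteq> j \<longrightarrow> \<Union> (set (A i)) \<inter> \<Union> (set (A j)) = {}"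
    using sys unfolding cycle_system_def by blast
  have "\<forall>i\<in>I. \<exists>g. bij_betw g (fst (C i)) (\<Union> (set (A i))) \<and> (\<forall>e\<in>snd (C i). g ` e \<in> E)"
  proof
    fix i assume i: "i \<in> I"
    obtain As where As: "length As = l i" "cyclic_list k As" "C i = (\<Union> (set As), set As)"
      using C[OF i] unfolding linear_cycle_def by blast
    obtain g where g: "bij_betw g (\<Union> (set As)) (\<Union> (set (A i)))" "\<And>j. j < l i \<Longrightarrow> g ` (As ! j) = A i ! j"
      using cyclic_list_iso[OF As(2) _ As(1) _ l[OF i] k, of "A i"] A(1) i by blast
    have "g ` e \<in> E" if e: "e \<in> set As" for e
    proof -
      obtain j where "j < l i" "e = As ! j" using e As(1) by (auto simp: in_set_conv_nth)
      then have "g ` e = A i ! j" "A i ! j \<in> set (A i)" using g(2) A(1) i by auto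
      then show ?thesis using A(1) i by auto
    qed
    with g(1) show "\<exists>g. bij_betw g (fst (C i)) (\<Union> (set (A i))) \<and> (\<forall>e\<in>snd (C i). g ` e \<in> E)"
      using As(3) by auto
  qed
  then obtain g where g: "\<forall>i\<in>I. bij_betw (g i) (fst (C i)) (\<Union> (set (A i))) \<and> (\<forall>e\<in>snd (C i). g i ` e \<in> E)"
    by (auto simp: bchoice_iff)
  define f where "f = (\<lambda>(i, a). g i a)"
  have gA: "g i a \<in> \<Union> (set (A i))" if "i \<in> I" "a \<in> fst (C i)" for i a
    using g that by (auto dest!: bij_betwE)
  have "hom f (disjoint_union I C) (V, E)"
    unfolding hom_def
  proof (intro conjI ballI)
    have "g i a \<in> V" if "i \<in> I" "a \<in> fst (C i)" for i a
      using gA[OF that] A(1) E that by blast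
    then show "f ` fst (disjoint_union I C) \<subseteq> fst (V, E)"
      by (auto simp: disjoint_union_def f_def)
    fix e assume "e \<in> snd (disjoint_union I C)"
    then obtain i e' where "i \<in> I" "e' \<in> snd (C i)" "e = Pair i ` e'" by (auto simp: disjoint_union_def)
    then show "f ` e \<in> snd (V, E)" using g by (auto simp: f_def image_image)
  qed
  moreover have "inj_on f (fst (disjoint_union I C))"
  proof (rule inj_onI)
    fix p q assume pq: "p \<in> fst (disjoint_union I C)" "q \<in> fst (disjoint_union I C)" "f p = f q"
    obtain i a j b where ab: "p = (i, a)" "q = (j, b)" "i \<in> I" "j \<in> I" "a \<in> fst (C i)" "b \<in> fst (C j)"
      using pq by (auto simp: disjoint_union_def)
    have eq: "g i a = g j b" using pq ab by (simp add: f_def)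
    have "i = j" using A(2) ab gA[OF ab(3,5)] gA[OF ab(4,6)] eq by (metis IntI empty_iff)
    moreover have "inj_on (g i) (fst (C i))" using g ab by (auto simp: bij_betw_def)
    ultimately show "p = q" using eq ab by (auto dest: inj_onD)
  qed
  ultimately show ?thesis unfolding contains_def by blast
qed

lemma cyclic_list_image:
  assumes c: "cyclic_list k As" and g: "inj_on g (\<Union> (set As))" and ne: "As \<noteq> []"
  shows "cyclic_list k (map ((`) g) As)"
proof -
  have sub: "As ! i \<subseteq> \<Union> (set As)" if "i < length As" for i using that by (meson Union_upper nth_mem)
  have int: "g ` (As ! i) \<inter> g ` (As ! j) = g ` (As ! i \<inter> As ! j)" if "i < length As" "j < length As" for i j
    using inj_on_image_Int[OF g sub[OF that(1)] sub[OF that(2)]] by simp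
  have crd: "card (g ` X) = card X" if "X \<subseteq> \<Union> (set As)" for X
    using inj_on_subset[OF g that] by (rule card_image)
  have Sl: "Suc i mod length As < length As" for i using ne by simp
  have "\<Inter> (set (map ((`) g) As)) = {}"
  proof (rule ccontr)
    assume "\<not> ?thesis"
    then obtain y where y: "\<forall>A\<in>set As. y \<in> g ` A" by auto
    obtain A where A: "A \<in> set As" using ne by (meson hd_in_set)
    then obtain x where x: "x \<in> A" "y = g x" using y by blast
    have "x \<in> B" if B: "B \<in> set As" for B
    proof -
      obtain z where "z \<in> B" "y = g z" using y B by blast
      then show ?thesis using g x A B by (metis UnionI inj_onD)
    qed
    then show False using c unfolding cyclic_list_def Let_def by blast
  qed
  moreover have "card (g ` (As ! i) \<inter> g ` (As ! (Suc i mod length As))) = 1" if "i < length As" for i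
  proof -
    have "As ! i \<inter> As ! (Suc i mod length As) \<subseteq> \<Union> (set As)" using sub[OF that] by auto
    then show ?thesis using c that int[OF that Sl] crd unfolding cyclic_list_def Let_def by auto
  qed
  moreover have "card (g ` (As ! i)) = k" if "i < length As" for i
    using c crd[OF sub[OF that]] that unfolding cyclic_list_def Let_def by simp
  moreover have "g ` (As ! i) \<inter> g ` (As ! j) = {}"
    if "i < length As" "j < length As" "i \<noteq> j" "j \<noteq> Suc i mod length As" "i \<noteq> Suc j mod length As" for i j
    using c int[OF that(1,2)] that unfolding cyclic_list_def Let_def by simp
  ultimately show ?thesis
    using Sl unfolding cyclic_list_def Let_def by simp
qed

lemma cycle_system_if_contains:
  fixes C :: "'i \<Rightarrow> 'a hypergraph"
  assumes C: "\<And>i. i \<in> I \<Longrightarrow> linear_cycle k (l i) (C i)" and l: "\<And>i. i \<in> I \<Longrightarrow> l i \<ge> 3"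
    and con: "contains (V, E) (disjoint_union I C)"
  shows "cycle_system k I l E"
proof -
  obtain f where f: "hom f (disjoint_union I C) (V, E)" "inj_on f (fst (disjoint_union I C))"
    using con unfolding contains_def by blast
  have "\<forall>i\<in>I. \<exists>As. length As = l i \<and> cyclic_list k As \<and> C i = (\<Union> (set As), set As)"
    using C unfolding linear_cycle_def by blast
  then obtain As where As: "\<forall>i\<in>I. length (As i) = l i \<and> cyclic_list k (As i) \<and> C i = (\<Union> (set (As i)), set (As i))"
    by (auto simp: bchoice_iff)
  define g where "g i a = f (i, a)" for i a
  have du: "(i, a) \<in> fst (disjoint_union I C)" if "i \<in> I" "a \<in> \<Union> (set (As i))" for i a
    using As that by (auto simp: disjoint_union_def)
  have ginj: "i = j \<and> a = b" if "i \<in> I" "j \<in> I" "a \<in> \<Union> (set (As i))" "b \<in> \<Union> (set (As j))" "g i a = g j b" for i j a b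
    using inj_onD[OF f(2) _ du[OF that(1,3)] du[OF that(2,4)]] that(5) by (auto simp: g_def)
  define A where "A i = map ((`) (g i)) (As i)" for i
  have "cyclic_list k (A i)" if "i \<in> I" for i
    unfolding A_def
  proof (rule cyclic_list_image)
    show "inj_on (g i) (\<Union> (set (As i)))" using ginj[OF that that] by (auto intro!: inj_onI)
  qed (use As that l[OF that] in auto)
  moreover have "set (A i) \<subseteq> E" if i: "i \<in> I" for i
  proof
    fix e assume "e \<in> set (A i)"
    then obtain e' where "e' \<in> set (As i)" "e = g i ` e'" by (auto simp: A_def)
    moreover from this have "e' \<in> snd (C i)" using As i by simp
    ultimately have "Pair i ` e' \<in> snd (disjoint_union I C)" "e = f ` Pair i ` e'"
      using i by (auto simp: disjoint_union_def g_def image_image)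
    then show "e \<in> E" using f(1) unfolding hom_def by auto
  qed
  moreover have "\<Union> (set (A i)) \<inter> \<Union> (set (A j)) = {}" if ij: "i \<in> I" "j \<in> I" "i \<noteq> j" for i j
    using ginj[OF ij(1,2)] ij(3) by (fastforce simp: A_def)
  moreover have "length (A i) = l i" if "i \<in> I" for i using As that by (simp add: A_def)
  ultimately show ?thesis unfolding cycle_system_def by (intro exI[of _ A]) blast
qed

text \<open>The last edge (odd length) or the last two edges (even length) that close an alternating path
  between the star centres and other vertices from $p$ back to $q$.\<close>

definition closer :: "'v set set \<Rightarrow> nat \<Rightarrow> nat \<Rightarrow> 'v set \<Rightarrow> 'v \<Rightarrow> 'v \<Rightarrow> bool" where
  "closer E N l C p q \<longleftrightarrow> p \<noteq> q \<and>
     (if odd l then p \<in> C \<and> q \<in> C \<and> rich E N C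
      else \<exists>Q Q' z. C = Q \<union> Q' \<and> Q \<inter> Q' = {z} \<and> p \<in> Q \<and> q \<in> Q' \<and> p \<noteq> z \<and> q \<noteq> z \<and> rich E N Q \<and> rich E N Q')"

text \<open>Cycle \<open>i\<close> runs through \<open>Y i 0\<close>, \<open>v i 0\<close>,
  \<open>Y i 1\<close>, and so on up to \<open>Y i (s i - 1)\<close>, which takes 2 (s i - 1) edges.
  The closing set adds one edge for the odd length 2 s i - 1 and two for the even length 2 s i. Only
  \<open>s i - 1\<close> vertices \<open>v i a\<close>, the later centres, are spent on the
  path.\<close>

lemma closed_alternating_paths:
  fixes Y v :: "'i \<Rightarrow> nat \<Rightarrow> 'v" and C :: "'i \<Rightarrow> 'v set"
  assumes I: "finite I" and l: "\<And>i. i \<in> I \<Longrightarrow> l i \<ge> 3"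
    and E: "\<And>e. e \<in> E \<Longrightarrow> finite e \<and> card e = k"
    and N: "N \<ge> k * sum l I"
    and s: "\<And>i. s i = (l i + 1) div 2"
    and C: "\<And>i. i \<in> I \<Longrightarrow> closer E N (l i) (C i) (Y i (s i - 1)) (Y i 0)"
    and Cdisj: "\<And>i j. i \<in> I \<Longrightarrow> j \<in> I \<Longrightarrow> i \<noteq> j \<Longrightarrow> C i \<inter> C j = {}"
    and Yinj: "\<And>i j a b. i \<in> I \<Longrightarrow> j \<in> I \<Longrightarrow> a < s i \<Longrightarrow> b < s j \<Longrightarrow> Y i a = Y j b \<Longrightarrow> i = j \<and> a = b"
    and vinj: "\<And>i j a b. i \<in> I \<Longrightarrow> j \<in> I \<Longrightarrow> a < s i - 1 \<Longrightarrow> b < s j - 1 \<Longrightarrow> v i a = v j b \<Longrightarrow> i = j \<and> a = b"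
    and Yv: "\<And>i j a b. i \<in> I \<Longrightarrow> j \<in> I \<Longrightarrow> a < s i \<Longrightarrow> b < s j - 1 \<Longrightarrow> Y i a \<noteq> v j b"
    and vC: "\<And>i j a. i \<in> I \<Longrightarrow> j \<in> I \<Longrightarrow> a < s i - 1 \<Longrightarrow> v i a \<notin> C j"
    and YC: "\<And>i j a. i \<in> I \<Longrightarrow> j \<in> I \<Longrightarrow> a < s i \<Longrightarrow> Y i a \<in> C j \<Longrightarrow> i = j \<and> (a = 0 \<or> a = s i - 1)"
    and r1: "\<And>i a. i \<in> I \<Longrightarrow> a < s i - 1 \<Longrightarrow> rich E N {Y i a, v i a}"
    and r2: "\<And>i a. i \<in> I \<Longrightarrow> a < s i - 1 \<Longrightarrow> rich E N {v i a, Y i (Suc a)}"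
  shows "cycle_system k I l E"
proof -
  have "\<exists>Q Q' z. C i = Q \<union> Q' \<and> rich E N Q \<and> Y i (s i - 1) \<in> Q \<and>
      (odd (l i) \<longrightarrow> Y i 0 \<in> Q \<and> Q' = {}) \<and>
      (even (l i) \<longrightarrow> rich E N Q' \<and> Q \<inter> Q' = {z} \<and> Y i 0 \<in> Q' \<and> Y i (s i - 1) \<noteq> z \<and> Y i 0 \<noteq> z)"
    if i: "i \<in> I" for i
  proof (cases "odd (l i)")
    case True
    with C[OF i] show ?thesis by (intro exI[of _ "C i"] exI[of _ "{}"]) (auto simp: closer_def)
  next
    case False
    with C[OF i] show ?thesis by (simp add: closer_def) blast
  qed
  then have "\<forall>i\<in>I. \<exists>Q Q' z. C i = Q \<union> Q' \<and> rich E N Q \<and> Y i (s i - 1) \<in> Q \<and>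
      (odd (l i) \<longrightarrow> Y i 0 \<in> Q \<and> Q' = {}) \<and>
      (even (l i) \<longrightarrow> rich E N Q' \<and> Q \<inter> Q' = {z} \<and> Y i 0 \<in> Q' \<and> Y i (s i - 1) \<noteq> z \<and> Y i 0 \<noteq> z)"
    by blast
  then obtain Q Q' z where Q: "\<forall>i\<in>I. C i = Q i \<union> Q' i \<and> rich E N (Q i) \<and> Y i (s i - 1) \<in> Q i \<and>
      (odd (l i) \<longrightarrow> Y i 0 \<in> Q i \<and> Q' i = {}) \<and>
      (even (l i) \<longrightarrow> rich E N (Q' i) \<and> Q i \<inter> Q' i = {z i} \<and> Y i 0 \<in> Q' i \<and> Y i (s i - 1) \<noteq> z i \<and> Y i 0 \<noteq> z i)"
    unfolding bchoice_iff by blast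
  have CQ: "C i = Q i \<union> Q' i" "rich E N (Q i)" "Y i (s i - 1) \<in> Q i" if "i \<in> I" for i
    using Q that by auto
  have Qodd: "Y i 0 \<in> Q i" "Q' i = {}" if "i \<in> I" "odd (l i)" for i
    using Q that by auto
  have Qeven: "rich E N (Q' i)" "Q i \<inter> Q' i = {z i}" "Y i 0 \<in> Q' i" "Y i (s i - 1) \<noteq> z i" "Y i 0 \<noteq> z i"
    if "i \<in> I" "even (l i)" for i
    using Q that by auto
  have s2: "s i \<ge> 2" "l i = (if odd (l i) then 2 * s i - 1 else 2 * s i)" if "i \<in> I" for i
    using l[OF that] by (auto simp: s elim!: oddE evenE)
  \<comment> \<open>The joints in cyclic order: \<open>Y\<close> at even and \<open>v\<close> at odd
    positions. Position \<open>2 * s i - 1\<close> exists only for even length and is the common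
    vertex of the two closing edges.\<close>
  define jn where "jn i j = (if j = 2 * s i - 1 then z i else if even j then Y i (j div 2) else v i (j div 2))" for i j
  define K where "K i j = (if j = 2 * s i - 2 then Q i else if j = 2 * s i - 1 then Q' i else {jn i j, jn i (Suc j)})" for i j
  have jnY: "jn i j = Y i (j div 2) \<and> j div 2 < s i" if "i \<in> I" "j < l i" "j \<noteq> 2 * s i - 1" "even j" for i j
    using that s2[OF that(1)] by (auto simp: jn_def split: if_splits)
  have jnv: "jn i j = v i (j div 2) \<and> j div 2 < s i - 1" if "i \<in> I" "j < l i" "j \<noteq> 2 * s i - 1" "odd j" for i j
    using that s2[OF that(1)] by (auto simp: jn_def split: if_splits elim!: oddE)
  have jnz: "jn i j = z i \<and> even (l i)" if "i \<in> I" "j < l i" "j = 2 * s i - 1" for i j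
    using that s2[OF that(1)] by (auto simp: jn_def split: if_splits)
  have zC: "z i \<in> Q i" "z i \<in> Q' i" "z i \<in> C i" if "i \<in> I" "even (l i)" for i
    using Qeven[OF that] CQ that by auto
  have zY: "z i \<noteq> Y j a" if "i \<in> I" "even (l i)" "j \<in> I" "a < s j" for i j a
    using YC[of j i a] that zC[OF that(1,2)] Qeven[OF that(1,2)] by metis
  have zv: "z i \<noteq> v j a" if "i \<in> I" "even (l i)" "j \<in> I" "a < s j - 1" for i j a
    using vC[of j i a] that zC[OF that(1,2)] by metis
  have zz: "i = j" if "i \<in> I" "even (l i)" "j \<in> I" "even (l j)" "z i = z j" for i j
    using Cdisj[of i j] that zC[OF that(1,2)] zC[OF that(3,4)] by fastforce
  have inj: "i = i' \<and> j = j'" if a: "i \<in> I" "i' \<in> I" "j < l i" "j' < l i'" "jn i j = jn i' j'" for i j i' j'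
  proof -
    consider "j = 2 * s i - 1" | "j \<noteq> 2 * s i - 1" "even j" | "j \<noteq> 2 * s i - 1" "odd j" by blast
    then show ?thesis
    proof cases
      case 1
      then have 2: "jn i j = z i" "even (l i)" using jnz[OF a(1,3)] by auto
      have "j' = 2 * s i' - 1"
        using jnY[OF a(2,4)] jnv[OF a(2,4)] 2 a zY[OF a(1) 2(2) a(2)] zv[OF a(1) 2(2) a(2)] by metis
      then show ?thesis using 1 2 jnz[OF a(2,4)] a zz[OF a(1) 2(2) a(2)] by metis
    next
      case 2
      have 3: "jn i j = Y i (j div 2)" "j div 2 < s i" using jnY[OF a(1,3)] 2 by auto
      have 4: "j' \<noteq> 2 * s i' - 1" using jnz[OF a(2,4)] 3 zY[OF a(2) _ a(1)] a(5) by metis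
      have 5: "even j'" using jnv[OF a(2,4) 4] 3 Yv[OF a(1,2) 3(2)] a(5) by metis
      have "i = i' \<and> j div 2 = j' div 2"
        using jnY[OF a(2,4) 4 5] 3 Yinj[OF a(1,2) 3(2)] a(5) by metis
      then show ?thesis using 2 5 by (metis dvd_mult_div_cancel)
    next
      case 3
      have 6: "jn i j = v i (j div 2)" "j div 2 < s i - 1" using jnv[OF a(1,3)] 3 by auto
      have 4: "j' \<noteq> 2 * s i' - 1" using jnz[OF a(2,4)] 6 zv[OF a(2) _ a(1)] a(5) by metis
      have 5: "odd j'" using jnY[OF a(2,4) 4] 6 Yv[OF a(2,1) _ 6(2)] a(5) by metis
      have "i = i' \<and> j div 2 = j' div 2"
        using jnv[OF a(2,4) 4 5] 6 vinj[OF a(1,2) 6(2)] a(5) by metis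
      then show ?thesis using 3 5 by (metis odd_two_times_div_two_succ)
    qed
  qed
  define J where "J i j = {jn i j, jn i (Suc j mod l i)}" for i j
  define X where "X = (\<Union>i\<in>I. jn i ` {..<l i})"
  have J_last: "J i (2 * s i - 2) = {Y i (s i - 1), if odd (l i) then Y i 0 else z i}" if i: "i \<in> I" for i
  proof -
    have "(2 * s i - 2) div 2 = s i - 1" "2 * s i - 2 \<noteq> 2 * s i - 1" "even (2 * s i - 2)" using s2[OF i] by auto
    then have "jn i (2 * s i - 2) = Y i (s i - 1)" by (simp add: jn_def)
    moreover have "jn i (Suc (2 * s i - 2) mod l i) = (if odd (l i) then Y i 0 else z i)"
    proof (cases "odd (l i)")
      case True
      then have "Suc (2 * s i - 2) = l i" using s2[OF i] by simp
      then have "Suc (2 * s i - 2) mod l i = 0" by simp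
      then show ?thesis using True s2[OF i] by (simp add: jn_def)
    next
      case False
      then have "Suc (2 * s i - 2) = 2 * s i - 1" "2 * s i - 1 < l i" using s2[OF i] by auto
      then have "Suc (2 * s i - 2) mod l i = 2 * s i - 1" by simp
      then show ?thesis using False s2[OF i] by (simp add: jn_def)
    qed
    ultimately show ?thesis by (simp add: J_def)
  qed
  have J_last': "J i (2 * s i - 1) = {z i, Y i 0}" if i: "i \<in> I" "even (l i)" for i
  proof -
    have "Suc (2 * s i - 1) mod l i = 0" using s2[OF i(1)] i by auto
    then show ?thesis using s2[OF i(1)] by (auto simp: J_def jn_def)
  qed
  \<comment> \<open>A closing set contains no joints except the two ends of its path and, for even
    length, \<open>z i\<close>; hence its size does no harm in \<open>skeleton\<close>.\<close>
  have CX: "x \<in> {Y i 0, Y i (s i - 1)} \<union> (if even (l i) then {z i} else {})" if i: "i \<in> I" "x \<in> C i" "x \<in> X" for i x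
  proof -
    obtain i' j where j: "i' \<in> I" "j < l i'" "x = jn i' j" using i by (auto simp: X_def)
    consider "j = 2 * s i' - 1" | "j \<noteq> 2 * s i' - 1" "even j" | "j \<noteq> 2 * s i' - 1" "odd j" by blast
    then show ?thesis
    proof cases
      case 1
      then have "x = z i'" "even (l i')" using jnz[OF j(1,2)] j by auto
      moreover from this have "i' = i" using zC[OF j(1)] Cdisj[OF i(1) j(1)] i by blast
      ultimately show ?thesis by auto
    next
      case 2
      then have "x = Y i' (j div 2)" "j div 2 < s i'" using jnY[OF j(1,2)] j by auto
      then show ?thesis using YC[OF j(1) i(1), of "j div 2"] i by auto
    next
      case 3
      then show ?thesis using jnv[OF j(1,2)] j vC[OF j(1) i(1)] i by auto
    qed
  qed
  have QX: "Q i \<inter> X \<subseteq> J i (2 * s i - 2)" if i: "i \<in> I" for i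
  proof
    fix x assume x: "x \<in> Q i \<inter> X"
    then have "x \<in> {Y i 0, Y i (s i - 1)} \<union> (if even (l i) then {z i} else {})"
      using CX[OF i] CQ[OF i] by auto
    then show "x \<in> J i (2 * s i - 2)"
      using x Qeven[OF i] unfolding J_last[OF i] by (cases "even (l i)") auto
  qed
  have QX': "Q' i \<inter> X \<subseteq> J i (2 * s i - 1)" if i: "i \<in> I" "even (l i)" for i
  proof
    fix x assume x: "x \<in> Q' i \<inter> X"
    then have "x \<in> {Y i 0, Y i (s i - 1)} \<union> {z i}"
      using CX[OF i(1)] CQ[OF i(1)] i by auto
    then show "x \<in> J i (2 * s i - 1)"
      using x Qeven[OF i] CQ[OF i(1)] unfolding J_last'[OF i] by auto
  qed
  have lt: "Suc j mod l i < l i" if "i \<in> I" for i j using l[OF that] by simp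
  have JX: "J i j \<subseteq> X" if "i \<in> I" "j < l i" for i j
  proof -
    have "jn i a \<in> X" if "a < l i" for a using \<open>i \<in> I\<close> that unfolding X_def by blast
    then show ?thesis using that lt[OF that(1)] by (auto simp: J_def)
  qed
  have Kcase: "K i j = J i j \<or> (j = 2 * s i - 2 \<and> K i j = Q i) \<or> (j = 2 * s i - 1 \<and> even (l i) \<and> K i j = Q' i)"
    if i: "i \<in> I" "j < l i" for i j
  proof -
    have "j < 2 * s i" using i s2[OF i(1)] by (cases "odd (l i)") auto
    then have "j = 2 * s i - 2 \<or> j = 2 * s i - 1 \<or> j < 2 * s i - 2" by linarith
    then consider "j = 2 * s i - 2" | "j = 2 * s i - 1" | "j < 2 * s i - 2" by blast
    then show ?thesis
    proof cases
      case 1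
      then show ?thesis by (simp add: K_def)
    next
      case 2
      then have "j \<noteq> 2 * s i - 2" using s2[OF i(1)] by auto
      with 2 show ?thesis using i jnz[OF i] by (simp add: K_def)
    next
      case 3
      then have "Suc j < l i" using s2[OF i(1)] by (auto split: if_splits)
      moreover have "j \<noteq> 2 * s i - 2" "j \<noteq> 2 * s i - 1" using 3 by auto
      ultimately show ?thesis by (simp add: K_def J_def)
    qed
  qed
  have JK: "J i j \<subseteq> K i j" if i: "i \<in> I" "j < l i" for i j
    using Kcase[OF i] CQ[OF i(1)] J_last[OF i(1)] J_last'[OF i(1)] Qodd[OF i(1)] Qeven[OF i(1)] zC[OF i(1)]
    by (cases "even (l i)") auto
  show ?thesis
  proof (rule skeleton[OF I l E _ N, where x = jn and K = K])
    fix i j assume i: "i \<in> I" "j < l i"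
    show "jn i j \<in> K i j" "jn i (Suc j mod l i) \<in> K i j"
      using JK[OF i] by (auto simp: J_def)
    show "rich E N (K i j)"
    proof (cases "j < 2 * s i - 2")
      case True
      have "j \<noteq> 2 * s i - 1" "Suc j \<noteq> 2 * s i - 1" "j div 2 < s i - 1" "odd j \<Longrightarrow> Suc j div 2 = Suc (j div 2)"
        "even j \<Longrightarrow> Suc j div 2 = j div 2" using True by auto
      then have "K i j = (if even j then {Y i (j div 2), v i (j div 2)} else {v i (j div 2), Y i (Suc (j div 2))})"
        using True by (simp add: K_def jn_def)
      then show ?thesis using r1[OF i(1)] r2[OF i(1)] \<open>j div 2 < s i - 1\<close> by auto
    next
      case False
      moreover have "j < 2 * s i" using i s2[OF i(1)] by (cases "odd (l i)") auto
      ultimately have "j = 2 * s i - 2 \<or> j = 2 * s i - 1" by linarith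
      then consider "j = 2 * s i - 2" | "j = 2 * s i - 1" by blast
      then show ?thesis
      proof cases
        case 1
        then show ?thesis using CQ[OF i(1)] by (simp add: K_def)
      next
        case 2
        moreover have "j \<noteq> 2 * s i - 2" using s2[OF i(1)] 2 by auto
        ultimately show ?thesis using Qeven(1)[OF i(1)] jnz[OF i] by (simp add: K_def)
      qed
    qed
  next
    fix i j i' j'
    assume a: "i \<in> I" "i' \<in> I" "j < l i" "j' < l i'"
    show "jn i j = jn i' j' \<Longrightarrow> i = i' \<and> j = j'" using inj[OF a] .
    assume ne: "(i, j) \<noteq> (i', j')"
    have KX: "K i j \<inter> X \<subseteq> J i j" if "i \<in> I" "j < l i" for i j
      using Kcase[OF that] QX[OF that(1)] QX'[OF that(1)] by auto
    \<comment> \<open>An intersection outside the joints would have to come from two closing sets,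
      but those of one cycle share only \<open>z i\<close> and those of different cycles are
      disjoint.\<close>
    have "K i j \<inter> K i' j' \<subseteq> X"
    proof (rule ccontr)
      assume n: "\<not> ?thesis"
      then have "K i j \<noteq> J i j" "K i' j' \<noteq> J i' j'" using JX a by auto
      then have b: "(j = 2 * s i - 2 \<and> K i j = Q i) \<or> (j = 2 * s i - 1 \<and> even (l i) \<and> K i j = Q' i)"
        "(j' = 2 * s i' - 2 \<and> K i' j' = Q i') \<or> (j' = 2 * s i' - 1 \<and> even (l i') \<and> K i' j' = Q' i')"
        using Kcase[OF a(1,3)] Kcase[OF a(2,4)] by auto
      show False
      proof (cases "i = i'")
        case True
        have "z i \<in> X" if "even (l i)"
          using JX[OF a(1), of "2 * s i - 1"] J_last'[OF a(1) that] s2[OF a(1)] that by auto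
        moreover have "K i j \<inter> K i' j' \<subseteq> {z i}" "even (l i)"
          using b ne True Qeven(2)[OF a(1)] by auto
        ultimately show False using n by auto
      next
        case False
        then have "C i \<inter> C i' = {}" by (rule Cdisj[OF a(1,2)])
        moreover have "K i j \<subseteq> C i" "K i' j' \<subseteq> C i'" using b CQ(1)[OF a(1)] CQ(1)[OF a(2)] by auto
        ultimately show False using n by blast
      qed
    qed
    then have "K i j \<inter> K i' j' \<subseteq> J i j \<inter> J i' j'" using KX[OF a(1,3)] KX[OF a(2,4)] by blast
    then show "K i j \<inter> K i' j' \<subseteq> {jn i j, jn i (Suc j mod l i)} \<inter> {jn i' j', jn i' (Suc j' mod l i')}"
      unfolding J_def .
  qed
qed

lemma choose_disjoint_pairs:
  assumes A: "finite A" and P: "\<And>Z. finite Z \<Longrightarrow> card Z \<le> N \<Longrightarrow> \<exists>p q. (p, q) \<in> P \<and> p \<notin> Z \<and> q \<notin> Z"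
    and Z0: "finite Z0" "card Z0 + 2 * card A \<le> N"
  obtains p q where "\<And>a. a \<in> A \<Longrightarrow> (p a, q a) \<in> P" "\<And>a. a \<in> A \<Longrightarrow> p a \<notin> Z0 \<and> q a \<notin> Z0"
    "\<And>a b. a \<in> A \<Longrightarrow> b \<in> A \<Longrightarrow> a \<noteq> b \<Longrightarrow> {p a, q a} \<inter> {p b, q b} = {}"
proof -
  have "\<exists>p q. (\<forall>a\<in>A. (p a, q a) \<in> P \<and> p a \<notin> Z0 \<and> q a \<notin> Z0) \<and> (\<forall>a\<in>A. \<forall>b\<in>A. a \<noteq> b \<longrightarrow> {p a, q a} \<inter> {p b, q b} = {})"
    using A Z0(2)
  proof (induction A rule: finite_induct)
    case (insert x F)
    then obtain p q where pq: "\<forall>a\<in>F. (p a, q a) \<in> P \<and> p a \<notin> Z0 \<and> q a \<notin> Z0"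
      "\<forall>a\<in>F. \<forall>b\<in>F. a \<noteq> b \<longrightarrow> {p a, q a} \<inter> {p b, q b} = {}" by auto
    define Z where "Z = Z0 \<union> p ` F \<union> q ` F"
    have "card Z \<le> card Z0 + card (p ` F) + card (q ` F)"
      unfolding Z_def by (meson add_le_mono1 card_Un_le le_trans)
    also have "\<dots> \<le> card Z0 + card F + card F"
      using card_image_le[OF insert.hyps(1), of p] card_image_le[OF insert.hyps(1), of q] by linarith
    also have "\<dots> \<le> N" using insert by simp
    finally have "card Z \<le> N" .
    moreover have "finite Z" using insert.hyps Z0 by (simp add: Z_def)
    ultimately obtain a b where ab: "(a, b) \<in> P" "a \<notin> Z" "b \<notin> Z" using P by blast
    show ?case
      by (rule exI[of _ "p(x := a)"], rule exI[of _ "q(x := b)"])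
        (use pq ab insert.hyps in \<open>auto simp: Z_def\<close>)
  qed auto
  then show thesis using that by blast
qed

section \<open>Shadows and full subfamilies\<close>

definition shadow :: "'v set set \<Rightarrow> 'v set set" where
  "shadow E = {e - {x} | e x. e \<in> E \<and> x \<in> e}"

lemma card_shadow_le:
  assumes "finite V" "\<And>e. e \<in> H \<Longrightarrow> e \<subseteq> V \<and> card e = m"
  shows "card (shadow H) \<le> card V ^ (m - 1)"
proof -
  have "shadow H \<subseteq> {g. g \<subseteq> V \<and> card g = m - 1}"
  proof
    fix g assume "g \<in> shadow H"
    then obtain e x where e: "e \<in> H" "x \<in> e" "g = e - {x}" by (auto simp: shadow_def)
    then have "finite e" using assms finite_subset by blast
    then show "g \<in> {g. g \<subseteq> V \<and> card g = m - 1}" using e assms(2)[OF e(1)] by auto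
  qed
  then have "card (shadow H) \<le> card {g. g \<subseteq> V \<and> card g = m - 1}"
    using assms(1) by (intro card_mono finite_uniform)
  also have "\<dots> \<le> card V ^ (m - 1)" using assms(1) by (simp add: n_subsets binomial_le_power)
  finally show ?thesis .
qed

text \<open>If some \<open>e - {x}\<close> lies in at most \<open>D\<close> edges, delete all of
  these. At most \<open>D\<close> edges are lost and the shadow loses a member, so the strict
  inequality persists; it fails for the empty family, so the deletions stop earlier.\<close>

lemma full_subfamily:
  assumes "finite E" "\<And>e. e \<in> E \<Longrightarrow> finite e" "card E > D * card (shadow E)"
  obtains H where "H \<subseteq> E" "H \<noteq> {}" "\<And>e x. e \<in> H \<Longrightarrow> x \<in> e \<Longrightarrow> card {e' \<in> H. e - {x} \<subseteq> e'} > D"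
proof -
  have "\<exists>H\<subseteq>E. H \<noteq> {} \<and> (\<forall>e\<in>H. \<forall>x\<in>e. card {e' \<in> H. e - {x} \<subseteq> e'} > D)"
    using assms
  proof (induction E rule: finite_psubset_induct)
    case (psubset E)
    show ?case
    proof (cases "\<forall>e\<in>E. \<forall>x\<in>e. card {e' \<in> E. e - {x} \<subseteq> e'} > D")
      case True
      moreover have "E \<noteq> {}" using psubset.prems by auto
      ultimately show ?thesis by blast
    next
      case False
      then obtain e x where ex: "e \<in> E" "x \<in> e" "card {e' \<in> E. e - {x} \<subseteq> e'} \<le> D" by (auto simp: not_less)
      define R where "R = {e' \<in> E. e - {x} \<subseteq> e'}"
      have "e \<in> R" using ex by (auto simp: R_def)
      then have ps: "E - R \<subset> E" using ex by auto
      have fs: "finite (shadow E)"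
        by (rule finite_subset[of _ "\<Union> (Pow ` E)"]) (use psubset in \<open>auto simp: shadow_def\<close>)
      have "shadow (E - R) \<subseteq> shadow E - {e - {x}}"
        by (auto simp: shadow_def R_def)
      then have a: "card (shadow (E - R)) \<le> card (shadow E - {e - {x}})"
        using fs by (intro card_mono) auto
      have "e - {x} \<in> shadow E" using ex by (auto simp: shadow_def)
      then have "Suc (card (shadow E - {e - {x}})) = card (shadow E)" using fs by (metis card_Suc_Diff1)
      then have "Suc (card (shadow (E - R))) \<le> card (shadow E)" using a by simp
      then have "D * Suc (card (shadow (E - R))) \<le> D * card (shadow E)" by (rule mult_le_mono2)
      then have 1: "D * card (shadow (E - R)) + D \<le> D * card (shadow E)" by simp
      have "card (E - R) = card E - card R"
        using psubset.hyps by (intro card_Diff_subset) (auto simp: R_def)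
      then have "card (E - R) > D * card (shadow (E - R))"
        using 1 psubset.prems(2) ex(3) unfolding R_def by linarith
      then obtain H where "H \<subseteq> E - R" "H \<noteq> {}" "\<forall>e\<in>H. \<forall>x\<in>e. card {e' \<in> H. e - {x} \<subseteq> e'} > D"
        using psubset.IH[OF ps psubset.prems(1)] by (metis DiffD1)
      then show ?thesis by (intro exI[of _ H]) auto
    qed
  qed
  then show thesis by (elim exE conjE) (rule that, auto)
qed

text \<open>Exchange argument: among the edges containing \<open>K\<close> take one with fewest
  vertices in \<open>Z\<close>. A vertex \<open>z\<close> of it in \<open>Z\<close> can be swapped
  for one outside \<open>Z\<close>, because the more than N edges over \<open>f - {z}\<close> cannot
  all arise by adding an element of \<open>Z\<close>.\<close>

lemma full_rich:
  assumes H: "\<And>e. e \<in> H \<Longrightarrow> finite e \<and> card e = k"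
    and full: "\<And>e x. e \<in> H \<Longrightarrow> x \<in> e \<Longrightarrow> card {e' \<in> H. e - {x} \<subseteq> e'} > N"
    and K: "e \<in> H" "K \<subseteq> e"
  shows "rich H N K"
  unfolding rich_def
proof (intro allI impI)
  fix Z assume Z: "finite Z" "card Z \<le> N" "Z \<inter> K = {}"
  define Q where "Q e' \<longleftrightarrow> e' \<in> H \<and> K \<subseteq> e'" for e'
  obtain f where f: "Q f" "\<And>g. Q g \<Longrightarrow> card (f \<inter> Z) \<le> card (g \<inter> Z)"
    using ex_has_least_nat[of Q e "\<lambda>f. card (f \<inter> Z)"] K by (auto simp: Q_def)
  have "f \<inter> Z = {}"
  proof (rule ccontr)
    assume "f \<inter> Z \<noteq> {}"
    then obtain z where z: "z \<in> f" "z \<in> Z" by blast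
    define g where "g = f - {z}"
    have fH: "f \<in> H" "K \<subseteq> f" using f by (auto simp: Q_def)
    have cg: "finite g" "Suc (card g) = k"
      using z H[OF fH(1)] card_Suc_Diff1[of f z] by (auto simp: g_def)
    have "\<exists>h\<in>{e' \<in> H. g \<subseteq> e'}. h \<notin> (\<lambda>z. insert z g) ` Z"
    proof (rule ccontr)
      assume "\<not> ?thesis"
      then have "{e' \<in> H. g \<subseteq> e'} \<subseteq> (\<lambda>z. insert z g) ` Z" by blast
      then have "card {e' \<in> H. g \<subseteq> e'} \<le> card Z"
        using Z(1) by (meson card_image_le card_mono finite_imageI le_trans)
      then show False using full[OF fH(1) z(1)] Z(2) by (simp add: g_def)
    qed
    then obtain h where h: "h \<in> H" "g \<subseteq> h" "h \<notin> (\<lambda>z. insert z g) ` Z" by blast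
    have "card (h - g) = 1" using h(2) H[OF h(1)] cg by (simp add: card_Diff_subset)
    then obtain w where w: "h - g = {w}" by (auto simp: card_1_singleton_iff)
    then have hw: "h = insert w g" using h(2) by blast
    then have "w \<notin> Z" using h(3) by auto
    then have "h \<inter> Z = f \<inter> Z - {z}" using hw by (auto simp: g_def)
    moreover have "Q h" using h fH z Z(3) by (auto simp: Q_def g_def)
    ultimately have "card (f \<inter> Z) \<le> card (f \<inter> Z - {z})" using f(2)[of h] by simp
    moreover have "card (f \<inter> Z - {z}) < card (f \<inter> Z)" using z Z(1) by (intro card_Diff1_less) auto
    ultimately show False by linarith
  qed
  then show "\<exists>e\<in>H. K \<subseteq> e \<and> e \<inter> Z = {}" using f(1) by (auto simp: Q_def)
qed

section \<open>Cycles grown from rich pairs and triangles\<close>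

text \<open>A cycle gains a vertex when its closing pair is replaced by the other two sides of a
  triangle. The start \<open>n = 2\<close> is degenerate: one pair traversed in both
  directions.\<close>

lemma one_cycle_of_triangles:
  assumes tri: "\<And>Z x y. P x y \<Longrightarrow> finite Z \<Longrightarrow> card Z \<le> M \<Longrightarrow> \<exists>z. z \<notin> Z \<and> P x z \<and> P z y"
    and start: "\<And>Z. finite Z \<Longrightarrow> card Z \<le> M \<Longrightarrow> \<exists>x y. x \<notin> Z \<and> y \<notin> Z \<and> P x y"
    and sym: "\<And>x y. P x y \<Longrightarrow> P y x" and irr: "\<And>x y. P x y \<Longrightarrow> x \<noteq> y"
    and Z: "finite Z" and n: "n \<ge> 2" "n + card Z \<le> M"
  shows "\<exists>x. inj_on x {..<n} \<and> (\<forall>j<n. x j \<notin> Z) \<and> (\<forall>j<n-1. P (x j) (x (Suc j))) \<and> P (x (n-1)) (x (0::nat))"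
  using n
proof (induction n rule: nat_induct_at_least)
  case base
  then obtain a b where "a \<notin> Z" "b \<notin> Z" "P a b" using start[OF Z] by auto
  then show ?case using irr[of a b] sym[of a b]
    by (intro exI[of _ "\<lambda>j. if j = 0 then a else b"]) (auto simp: inj_on_def less_2_cases_iff)
next
  case (Suc n)
  then obtain x where x: "inj_on x {..<n}" "\<forall>j<n. x j \<notin> Z" "\<forall>j<n-1. P (x j) (x (Suc j))" "P (x (n-1)) (x 0)"
    by auto
  have "card (Z \<union> x ` {..<n}) \<le> card Z + card (x ` {..<n})" by (rule card_Un_le)
  also have "\<dots> \<le> M" using Suc.prems card_image_le[of "{..<n}" x] by simp
  finally obtain z where z: "z \<notin> Z \<union> x ` {..<n}" "P (x (n-1)) z" "P z (x 0)"
    using tri[OF x(4), of "Z \<union> x ` {..<n}"] Z by auto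
  show ?case
  proof (intro exI[of _ "x(n := z)"] conjI allI impI)
    show "inj_on (x(n := z)) {..<Suc n}"
      using x(1) z(1) by (auto simp: inj_on_def lessThan_Suc)
  next
    fix j assume "j < Suc n"
    then show "(x(n := z)) j \<notin> Z" using x(2) z(1) by auto
  next
    fix j assume "j < Suc n - 1"
    then show "P ((x(n := z)) j) ((x(n := z)) (Suc j))"
      using x(3) z(2) by (cases "j = n - 1") auto
  qed (use z Suc in auto)
qed

lemma cycles_of_triangles:
  assumes I: "finite I" and l: "\<And>i. i \<in> I \<Longrightarrow> l i \<ge> 3"
    and E: "\<And>e. e \<in> E \<Longrightarrow> finite e \<and> card e = k" and k: "k \<ge> 1"
    and N: "N \<ge> k * sum l I"
    and tri: "\<And>Z x y. P x y \<Longrightarrow> finite Z \<Longrightarrow> card Z \<le> N \<Longrightarrow> \<exists>z. z \<notin> Z \<and> P x z \<and> P z y"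
    and start: "\<And>Z. finite Z \<Longrightarrow> card Z \<le> N \<Longrightarrow> \<exists>x y. x \<notin> Z \<and> y \<notin> Z \<and> P x y"
    and sym: "\<And>x y. P x y \<Longrightarrow> P y x" and irr: "\<And>x y. P x y \<Longrightarrow> x \<noteq> y"
    and r: "\<And>x y. P x y \<Longrightarrow> rich E N {x, y}"
  shows "cycle_system k I l E"
proof -
  define cyc where "cyc x n \<longleftrightarrow> inj_on x {..<n} \<and> (\<forall>j<n-1. P (x j) (x (Suc j))) \<and> P (x (n-1)) (x (0::nat))" for x n
  have sN: "sum l I \<le> N" using mult_le_mono1[OF k, of "sum l I"] N unfolding mult_1 by (rule order_trans)
  have "\<exists>x. (\<forall>i\<in>I. cyc (x i) (l i)) \<and> (\<forall>i\<in>I. \<forall>i'\<in>I. i \<noteq> i' \<longrightarrow> x i ` {..<l i} \<inter> x i' ` {..<l i'} = {})"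
    using I l sN
  proof (induction I rule: finite_induct)
    case (insert i I)
    then obtain x where x: "\<forall>i\<in>I. cyc (x i) (l i)" "\<forall>i\<in>I. \<forall>i'\<in>I. i \<noteq> i' \<longrightarrow> x i ` {..<l i} \<inter> x i' ` {..<l i'} = {}"
      by auto
    define Z where "Z = (\<Union>i\<in>I. x i ` {..<l i})"
    have "card Z \<le> (\<Sum>i\<in>I. card (x i ` {..<l i}))" unfolding Z_def by (rule card_UN_le[OF insert.hyps(1)])
    also have "\<dots> \<le> sum l I" by (intro sum_mono order_trans[OF card_image_le]) auto
    finally have "l i + card Z \<le> N" using insert.hyps insert.prems(2) by simp
    moreover have "finite Z" "l i \<ge> 2" using insert.hyps insert.prems(1)[of i] by (auto simp: Z_def)
    ultimately have "\<exists>y. inj_on y {..<l i} \<and> (\<forall>j<l i. y j \<notin> Z) \<and> (\<forall>j<l i - 1. P (y j) (y (Suc j))) \<and> P (y (l i - 1)) (y 0)"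
      by (intro one_cycle_of_triangles[where P = P and M = N and Z = Z and n = "l i", OF tri start sym irr])
    then obtain y where y: "cyc y (l i)" "\<forall>j<l i. y j \<notin> Z" unfolding cyc_def by blast
    have yI: "y ` {..<l i} \<inter> x i' ` {..<l i'} = {}" if "i' \<in> I" for i'
      using y(2) that unfolding Z_def by blast
    define w where "w = x(i := y)"
    have w: "w i = y" "\<And>i'. i' \<in> I \<Longrightarrow> w i' = x i'" using insert.hyps by (auto simp: w_def)
    have "cyc (w i') (l i')" if "i' \<in> insert i I" for i' using that w x(1) y(1) by auto
    moreover have "w a ` {..<l a} \<inter> w b ` {..<l b} = {}" if ab: "a \<in> insert i I" "b \<in> insert i I" "a \<noteq> b" for a b
    proof -
      consider "a = i" "b \<in> I" | "b = i" "a \<in> I" | "a \<in> I" "b \<in> I" using ab by blast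
      then show ?thesis
        by cases (use ab x(2) yI in \<open>simp_all add: w Int_commute\<close>)
    qed
    ultimately show ?case by blast
  qed auto
  then obtain x where x: "\<forall>i\<in>I. cyc (x i) (l i)" "\<forall>i\<in>I. \<forall>i'\<in>I. i \<noteq> i' \<longrightarrow> x i ` {..<l i} \<inter> x i' ` {..<l i'} = {}"
    by blast
  have xinj: "i = i' \<and> j = j'" if "i \<in> I" "i' \<in> I" "j < l i" "j' < l i'" "x i j = x i' j'" for i i' j j'
  proof (cases "i = i'")
    case True
    have "inj_on (x i) {..<l i}" using x(1) that(1) unfolding cyc_def by blast
    then have "j = j'" by (rule inj_onD) (use that True in simp_all)
    then show ?thesis using True by blast
  next
    case False
    then have "x i ` {..<l i} \<inter> x i' ` {..<l i'} = {}" using x(2) that by blast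
    then show ?thesis using that by blast
  qed
  have xP: "P (x i j) (x i (Suc j mod l i))" if i: "i \<in> I" "j < l i" for i j
  proof (cases "j = l i - 1")
    case True
    then have "Suc j mod l i = 0" using i by simp
    then show ?thesis using x(1) i True unfolding cyc_def by simp
  next
    case False
    then have "Suc j < l i" using i by auto
    moreover have "\<forall>j<l i - 1. P (x i j) (x i (Suc j))" using x(1) i(1) unfolding cyc_def by blast
    ultimately show ?thesis by simp
  qed
  show ?thesis
  proof (rule skeleton[OF I l E _ N, where x = x and K = "\<lambda>i j. {x i j, x i (Suc j mod l i)}"])
    fix i j assume "i \<in> I" "j < l i"
    then show "rich E N {x i j, x i (Suc j mod l i)}" using xP r by blast
  next
    fix i j i' j' assume "i \<in> I" "i' \<in> I" "j < l i" "j' < l i'" "x i j = x i' j'"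
    then show "i = i' \<and> j = j'" by (rule xinj)
  qed simp_all
qed

text \<open>In a full subfamily every two vertices of a common edge form a rich pair, and this pair
  extends to a triangle avoiding any N vertices. Since the shadow has at most n^(k-1) members,
  cycle-free families have at most N n^(k-1) edges: the correct order, but not the correct
  constant.\<close>

lemma full_cycles:
  fixes E :: "'v set set"
  assumes I: "finite I" and l: "\<And>i. i \<in> I \<Longrightarrow> l i \<ge> 3"
    and E: "finite E" "\<And>e. e \<in> E \<Longrightarrow> finite e \<and> card e = k" and k: "k \<ge> 3"
    and N: "N \<ge> k * sum l I"
    and big: "card E > N * card (shadow E)"
  shows "cycle_system k I l E"
proof -
  obtain H where H: "H \<subseteq> E" "H \<noteq> {}" "\<And>e x. e \<in> H \<Longrightarrow> x \<in> e \<Longrightarrow> card {e' \<in> H. e - {x} \<subseteq> e'} > N"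
    by (rule full_subfamily[OF E(1) _ big]) (use E(2) in blast)+
  have HE: "finite e \<and> card e = k" if "e \<in> H" for e using that H E by auto
  have rH: "rich H N K" if "e \<in> H" "K \<subseteq> e" for e K
    using full_rich[of H k N e K] HE H that by blast
  define P where "P x y \<longleftrightarrow> x \<noteq> y \<and> (\<exists>e\<in>H. x \<in> e \<and> y \<in> e)" for x y
  have "cycle_system k I l H"
  proof (rule cycles_of_triangles[OF I l HE _ N, where P = P])
    fix Z :: "'v set" assume Z: "finite Z" "card Z \<le> N"
    fix x y assume "P x y"
    then obtain e where e: "x \<noteq> y" "e \<in> H" "x \<in> e" "y \<in> e" by (auto simp: P_def)
    have cZ: "card (Z - {x,y}) \<le> N"
      by (rule le_trans[OF card_mono[OF Z(1)] Z(2)]) blast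
    have "rich H N {x,y}" using rH[OF e(2)] e by simp
    from this _ cZ obtain f where f: "f \<in> H" "{x,y} \<subseteq> f" "f \<inter> (Z - {x,y}) = {}"
      by (rule richD) (use Z in simp_all)
    have "card (f - {x,y}) > 0" using f HE[OF f(1)] k e(1) by (simp add: card_Diff_subset)
    then obtain z where "z \<in> f - {x,y}" by (metis card_gt_0_iff ex_in_conv)
    then show "\<exists>z. z \<notin> Z \<and> P x z \<and> P z y"
      using f by (intro exI[of _ z]) (auto simp: P_def)
  next
    fix Z :: "'v set" assume Z: "finite Z" "card Z \<le> N"
    obtain e where "e \<in> H" using H by blast
    then have "rich H N {}" using rH by simp
    from this Z obtain f where f: "f \<in> H" "f \<inter> Z = {}"
      by (rule richD) simp
    obtain x where x: "x \<in> f" using HE[OF f(1)] k by fastforce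
    have "card (f - {x}) > 0" using HE[OF f(1)] k x by simp
    then obtain y where "y \<in> f - {x}" by (metis card_gt_0_iff ex_in_conv)
    then show "\<exists>x y. x \<notin> Z \<and> y \<notin> Z \<and> P x y"
      using f x by (intro exI[of _ x] exI[of _ y]) (auto simp: P_def)
  next
    fix x y assume "P x y"
    then show "rich H N {x,y}" using rH by (auto simp: P_def)
  qed (use k in \<open>auto simp: P_def\<close>)
  then show ?thesis using H(1) by (rule cycle_system_mono)
qed

section \<open>Cycles through a set of centres\<close>

text \<open>\<open>U\<close> is the set of centres. Cycle \<open>i0\<close> is closed by the
  prescribed set \<open>C0\<close>, whose own centres are not counted. Every other cycle spends one
  extra centre w on closing, by the triple {p, q, w} for odd length or the pairs {p, w} and {w, q}
  for even length. So \<open>sum s I - 1\<close> centres outside \<open>C0\<close> suffice.\<close>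

lemma star_cycles:
  fixes E :: "'v set set" and l s :: "'i \<Rightarrow> nat"
  assumes I: "finite I" "i0 \<in> I" and l: "\<And>i. i \<in> I \<Longrightarrow> l i \<ge> 3"
    and E: "\<And>e. e \<in> E \<Longrightarrow> finite e \<and> card e = k"
    and s: "\<And>i. s i = (l i + 1) div 2"
    and N: "N \<ge> k * sum l I" "N \<ge> card C0 + 3 * sum l I"
    and C0: "closer E N (l i0) C0 p0 q0" "finite C0"
    and U: "finite U" "card (U - C0) + 1 \<ge> sum s I"
    and p0: "p0 \<notin> U" "q0 \<notin> U" "\<And>w. w \<in> U \<Longrightarrow> rich E N {p0, w}" "\<And>w. w \<in> U \<Longrightarrow> rich E N {q0, w}"
    and PP: "\<And>Z. finite Z \<Longrightarrow> card Z \<le> N \<Longrightarrow> \<exists>p q. (p, q) \<in> PP \<and> p \<notin> Z \<and> q \<notin> Z"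
    and PP1: "\<And>p q. (p, q) \<in> PP \<Longrightarrow> p \<noteq> q \<and> p \<notin> U \<and> q \<notin> U"
    and PP2: "\<And>p q w. (p, q) \<in> PP \<Longrightarrow> w \<in> U \<Longrightarrow> rich E N {p, q, w} \<and> rich E N {p, w} \<and> rich E N {q, w}"
  shows "cycle_system k I l E"
proof -
  have s2: "s i \<ge> 2" "s i \<le> l i" if "i \<in> I" for i using l[OF that] by (auto simp: s)
  \<comment> \<open>The number of centres given to cycle \<open>i\<close>: \<open>s i - 1\<close> on
    its path and one for its closing set, except that \<open>i0\<close> is closed by
    \<open>C0\<close>.\<close>
  define m where "m i = (if i = i0 then s i - 1 else s i)" for i
  define A where "A = (SIGMA i:I. {..<m i})"
  have fA: "finite A" using I by (simp add: A_def)
  have "card A = sum m I" using I by (simp add: A_def card_SigmaI)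
  also have "\<dots> = m i0 + sum m (I - {i0})" using I by (simp add: sum.remove)
  also have "sum m (I - {i0}) = sum s (I - {i0})" by (intro sum.cong) (auto simp: m_def)
  also have "m i0 + sum s (I - {i0}) + 1 = sum s I"
    using I s2(1)[OF I(2)] by (simp add: sum.remove m_def)
  finally have cA: "card A + 1 = sum s I" by simp
  have "card A \<le> card (U - C0)" using cA U(2) by linarith
  then obtain u where u: "u ` A \<subseteq> U - C0" "inj_on u A"
    using card_le_inj[OF fA, of "U - C0"] U(1) by auto
  define B where "B = (SIGMA i:I. {..<s i})"
  have ss: "sum s I \<le> sum l I" by (intro sum_mono s2(2))
  have cB: "finite B" "card B = sum s I" using I by (simp_all add: B_def card_SigmaI)
  \<comment> \<open>Beyond \<open>C0\<close> at most \<open>sum l I\<close> vertices are blocked by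
    the centres taken, and the pairs themselves use at most \<open>2 * sum l I\<close>; this is the
    origin of \<open>3 * sum l I\<close> in the bound on N.\<close>
  define Z0 where "Z0 = C0 \<union> u ` A"
  have "card Z0 \<le> card C0 + card A"
    unfolding Z0_def using card_Un_le[of C0 "u ` A"] card_image_le[OF fA, of u] by linarith
  then have Z0: "finite Z0" "card Z0 + 2 * card B \<le> N"
    using N(2) cA cB ss fA C0(2) by (auto simp: Z0_def)
  obtain pp qq where pq: "\<And>a. a \<in> B \<Longrightarrow> (pp a, qq a) \<in> PP" "\<And>a. a \<in> B \<Longrightarrow> pp a \<notin> Z0 \<and> qq a \<notin> Z0"
    "\<And>a b. a \<in> B \<Longrightarrow> b \<in> B \<Longrightarrow> a \<noteq> b \<Longrightarrow> {pp a, qq a} \<inter> {pp b, qq b} = {}"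
    using choose_disjoint_pairs[OF cB(1) PP Z0] by blast
  have pC0: "p0 \<in> C0" "q0 \<in> C0" "p0 \<noteq> q0" using C0(1) by (auto simp: closer_def split: if_splits)
  \<comment> \<open>At position 0 of cycle \<open>i0\<close> the prescribed ends \<open>p0\<close>,
    \<open>q0\<close> replace a pair from the pool.\<close>
  define P where "P i a = (if i = i0 \<and> a = 0 then p0 else pp (i, a))" for i and a :: nat
  define Q where "Q i a = (if i = i0 \<and> a = 0 then q0 else qq (i, a))" for i and a :: nat
  have P1: "P i a \<noteq> Q i a" "P i a \<notin> U" "Q i a \<notin> U" if "i \<in> I" "a < s i" for i a
    using that PP1[OF pq(1)[of "(i,a)"]] p0 pC0 by (auto simp: P_def Q_def B_def)
  have P2: "rich E N {P i a, w}" "rich E N {Q i a, w}" if "i \<in> I" "a < s i" "w \<in> U" for i a w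
    using that PP2[OF pq(1)[of "(i,a)"]] p0 by (auto simp: P_def Q_def B_def)
  have P3: "i = j \<and> a = b" if "i \<in> I" "j \<in> I" "a < s i" "b < s j" "{P i a, Q i a} \<inter> {P j b, Q j b} \<noteq> {}" for i j a b
  proof (rule ccontr)
    assume n: "\<not> ?thesis"
    then have "{pp (i,a), qq (i,a)} \<inter> {pp (j,b), qq (j,b)} = {}" 
      using pq(3)[of "(i,a)" "(j,b)"] that by (auto simp: B_def)
    moreover have "pp (i,a) \<notin> C0" "qq (i,a) \<notin> C0" "pp (j,b) \<notin> C0" "qq (j,b) \<notin> C0"
      using pq(2)[of "(i,a)"] pq(2)[of "(j,b)"] that by (auto simp: B_def Z0_def)
    ultimately show False using n that(5) pC0 by (auto simp: P_def Q_def split: if_splits)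
  qed
  define C where "C i = (if i = i0 then C0 else {P i 0, Q i 0, u (i, s i - 1)})" for i
  have uA: "(i, s i - 1) \<in> A" if "i \<in> I" "i \<noteq> i0" for i using that s2[OF that(1)] by (auto simp: A_def m_def)
  have vA: "(i, a) \<in> A" if "i \<in> I" "a < s i - 1" for i a using that by (auto simp: A_def m_def)
  have uU: "u x \<in> U" "u x \<notin> C0" if "x \<in> A" for x using u(1) that by auto
  have P4: "i = j \<and> a = 0" if "i \<in> I" "j \<in> I" "a < s i" "P i a \<in> C j \<or> Q i a \<in> C j" for i j a
  proof (cases "j = i0")
    case True
    then show ?thesis using that pq(2)[of "(i,a)"]
      by (auto simp: C_def P_def Q_def B_def Z0_def split: if_splits)
  next
    case False
    then have "u (j, s j - 1) \<in> U" using uU uA that by blast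
    then have "P i a \<in> {P j 0, Q j 0} \<or> Q i a \<in> {P j 0, Q j 0}"
      using that False P1[OF that(1,3)] by (auto simp: C_def)
    then show ?thesis using P3[of i j a 0] that s2[of j] by auto
  qed
  \<comment> \<open>The two ends of a path are the two members of the pair at position 0, which the
    closing set joins; in between, first members of the pairs are used. \<open>ix\<close> tells from
    which pair a vertex was taken.\<close>
  define Y where "Y i a = (if a = 0 then Q i 0 else if a = s i - 1 then P i 0 else P i a)" for i a
  define ix where "ix i a = (if a = s i - 1 then 0 else a)" for i a
  have Yix: "Y i a \<in> {P i (ix i a), Q i (ix i a)}" "ix i a < s i" if "i \<in> I" "a < s i" for i a
    using that by (auto simp: Y_def ix_def)
  show ?thesis
  proof (rule closed_alternating_paths[OF I(1) l E N(1) s, where C = C and Y = Y and v = "\<lambda>i a. u (i, a)"])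
    fix i assume i: "i \<in> I"
    have Yp: "Y i (s i - 1) = P i 0" "Y i 0 = Q i 0" using s2[OF i] by (auto simp: Y_def)
    show "closer E N (l i) (C i) (Y i (s i - 1)) (Y i 0)"
    proof (cases "i = i0")
      case True
      then show ?thesis using C0 unfolding Yp by (simp add: C_def P_def Q_def)
    next
      case False
      let ?w = "u (i, s i - 1)"
      have w: "?w \<in> U" using uU uA i False by blast
      have B: "(i, 0) \<in> B" using i s2[OF i] by (auto simp: B_def)
      have pq0: "P i 0 = pp (i,0)" "Q i 0 = qq (i,0)" using False by (auto simp: P_def Q_def)
      have ne: "P i 0 \<noteq> Q i 0" "P i 0 \<noteq> ?w" "Q i 0 \<noteq> ?w" using P1[OF i, of 0] s2[OF i] w by auto
      have r: "rich E N {P i 0, Q i 0, ?w}" "rich E N {P i 0, ?w}" "rich E N {?w, Q i 0}"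
        using PP2[OF pq(1)[OF B] w] by (auto simp: pq0 insert_commute)
      have "{P i 0, ?w} \<union> {?w, Q i 0} = {P i 0, Q i 0, ?w}" "{P i 0, ?w} \<inter> {?w, Q i 0} = {?w}"
        using ne by auto
      then have "\<exists>Q1 Q' z. {P i 0, Q i 0, ?w} = Q1 \<union> Q' \<and> Q1 \<inter> Q' = {z} \<and> P i 0 \<in> Q1 \<and> Q i 0 \<in> Q' \<and> P i 0 \<noteq> z \<and> Q i 0 \<noteq> z \<and> rich E N Q1 \<and> rich E N Q'"
        using ne r by (intro exI[of _ "{P i 0, ?w}"] exI[of _ "{?w, Q i 0}"] exI[of _ ?w]) auto
      then show ?thesis using r(1) ne(1) False unfolding Yp by (simp add: C_def closer_def)
    qed
  next
    fix i j assume ij: "i \<in> I" "j \<in> I" "i \<noteq> j"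
    have *: "C i \<inter> C j = {}" if ij: "i \<in> I" "j \<in> I" "i \<noteq> j" "i \<noteq> i0" for i j
    proof -
      have "P i 0 \<notin> C j" "Q i 0 \<notin> C j" using P4[of i j 0] ij s2[of i] by auto
      moreover have "u (i, s i - 1) \<notin> C j"
      proof (cases "j = i0")
        case True
        then show ?thesis using uU(2)[OF uA] ij by (simp add: C_def)
      next
        case False
        have "u (i, s i - 1) \<noteq> u (j, s j - 1)"
          using inj_onD[OF u(2) _ uA[of i] uA[of j]] ij False by auto
        then show ?thesis using False P1[of j 0] s2[of j] uU(1)[OF uA[of i]] ij by (auto simp: C_def)
      qed
      ultimately show ?thesis using ij by (simp add: C_def)
    qed
    show "C i \<inter> C j = {}" using *[OF ij] *[of j i] ij by auto
  next
    fix i j a b assume ij: "i \<in> I" "j \<in> I" "a < s i" "b < s j" "Y i a = Y j b"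
    have "i = j \<and> ix i a = ix j b"
      using P3[OF ij(1,2) Yix(2)[OF ij(1,3)] Yix(2)[OF ij(2,4)]] Yix(1)[OF ij(1,3)] Yix(1)[OF ij(2,4)] ij(5) by auto
    then show "i = j \<and> a = b"
      using ij P1(1)[OF ij(1), of 0] s2[OF ij(1)] by (auto simp: ix_def Y_def split: if_splits)
  next
    fix i j a b assume "i \<in> I" "j \<in> I" "a < s i - 1" "b < s j - 1" "u (i, a) = u (j, b)"
    then show "i = j \<and> a = b" using inj_onD[OF u(2), of "(i,a)" "(j,b)"] vA by auto
  next
    fix i j a b assume ij: "i \<in> I" "j \<in> I" "a < s i" "b < s j - 1"
    then show "Y i a \<noteq> u (j, b)"
      using Yix[OF ij(1,3)] P1[OF ij(1) Yix(2)[OF ij(1,3)]] uU(1)[OF vA[OF ij(2,4)]] by auto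
  next
    fix i j a assume ij: "i \<in> I" "j \<in> I" "a < s i - 1"
    have w: "u (i,a) \<in> U" "u (i,a) \<notin> C0" using uU vA ij by blast+
    show "u (i, a) \<notin> C j"
    proof (cases "j = i0")
      case False
      have "u (i,a) \<noteq> u (j, s j - 1)"
      proof
        assume "u (i,a) = u (j, s j - 1)"
        then have "(i,a) = (j, s j - 1)" using inj_onD[OF u(2)] vA ij uA False by blast
        then show False using ij by auto
      qed
      then show ?thesis using False P1[of j 0] s2[of j] w ij by (auto simp: C_def)
    qed (use w in \<open>simp add: C_def\<close>)
  next
    fix i j a assume ij: "i \<in> I" "j \<in> I" "a < s i" "Y i a \<in> C j"
    then have "i = j \<and> ix i a = 0"
      using P4[OF ij(1,2) Yix(2)[OF ij(1,3)]] Yix(1)[OF ij(1,3)] by auto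
    then show "i = j \<and> (a = 0 \<or> a = s i - 1)" by (auto simp: ix_def split: if_splits)
  next
    fix i a assume i: "i \<in> I" "a < s i - 1"
    have w: "u (i,a) \<in> U" using uU vA i by blast
    have R: "rich E N {Y i b, u (i,a)}" if "b < s i" for b
      using Yix[OF i(1) that] P2[OF i(1) Yix(2)[OF i(1) that] w] by auto
    show "rich E N {Y i a, u (i, a)}" using R[of a] i by simp
    show "rich E N {u (i, a), Y i (Suc a)}" using R[of "Suc a"] i by (simp add: insert_commute)
  qed
qed

section \<open>The construction\<close>

text \<open>Disjoint cycles share the t vertices below \<open>t\<close>, so some cycle has fewer
  than \<open>s i\<close> of them. Each meets at most two of its edges, hence at least one edge for
  odd and two edges for even length avoid these vertices and contain {t, t + 1}. The former requires
  all lengths to be even, and the latter contradicts linearity.\<close>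

lemma lower_construction:
  fixes l s :: "'i \<Rightarrow> nat" and n t k :: nat
  assumes I: "finite I" and l: "\<And>i. i \<in> I \<Longrightarrow> l i \<ge> 3"
    and s: "\<And>i. s i = (l i + 1) div 2" and t: "t + 1 = sum s I" and n: "n \<ge> t + 2" and k: "k \<ge> 2"
  defines "ev \<equiv> \<forall>i\<in>I. even (l i)"
  defines "E \<equiv> {e. e \<subseteq> {..<n} \<and> card e = k \<and> (e \<inter> {..<t} \<noteq> {} \<or> ev \<and> {t, t + 1} \<subseteq> e)}"
  shows "\<not> cycle_system k I l E"
    and "card E = (n choose k) - ((n - t) choose k) + (if ev then (n - t - 2) choose (k - 2) else 0)"
proof -
  show "\<not> cycle_system k I l E"
  proof
    assume "cycle_system k I l E"
    then obtain A where A: "\<forall>i\<in>I. length (A i) = l i \<and> cyclic_list k (A i) \<and> set (A i) \<subseteq> E"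
      "\<forall>i\<in>I. \<forall>j\<in>I. i \<noteq> j \<longrightarrow> \<Union> (set (A i)) \<inter> \<Union> (set (A j)) = {}"
      unfolding cycle_system_def by blast
    define X where "X i = {..<t} \<inter> \<Union> (set (A i))" for i
    have "\<exists>i\<in>I. card (X i) < s i"
    proof (rule ccontr)
      assume "\<not> ?thesis"
      then have "sum s I \<le> (\<Sum>i\<in>I. card (X i))" by (intro sum_mono) (auto simp: not_less)
      also have "\<dots> = card (\<Union>i\<in>I. X i)"
      proof (rule card_UN_disjoint[symmetric, OF I])
        show "\<forall>i\<in>I. finite (X i)" by (simp add: X_def)
        show "\<forall>i\<in>I. \<forall>j\<in>I. i \<noteq> j \<longrightarrow> X i \<inter> X j = {}" using A(2) unfolding X_def by blast
      qed
      also have "\<dots> \<le> card {..<t}" by (intro card_mono) (auto simp: X_def)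
      finally show False using t by simp
    qed
    then obtain i where i: "i \<in> I" "card (X i) < s i" by blast
    define H where "H = {j. j < l i \<and> A i ! j \<inter> {..<t} \<noteq> {}}"
    have Ai: "length (A i) = l i" "cyclic_list k (A i)" "set (A i) \<subseteq> E" using A(1) i by auto
    have two: "card {j. j < l i \<and> x \<in> A i ! j} \<le> 2" for x
    proof (rule ccontr)
      assume "\<not> ?thesis"
      then have "3 \<le> card {j. j < l i \<and> x \<in> A i ! j}" by simp
      then obtain S where S: "S \<subseteq> {j. j < l i \<and> x \<in> A i ! j}" "card S = 3"
        by (meson obtain_subset_with_card_n)
      then obtain a b c where "S = {a, b, c}" "a \<noteq> b" "b \<noteq> c" "a \<noteq> c" by (auto simp: card_3_iff)
      then show False using cyclic_list_three[OF Ai(2,1) l[OF i(1)], of a b c x] S by auto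
    qed
    have "H = (\<Union>x\<in>X i. {j. j < l i \<and> x \<in> A i ! j})"
      using Ai(1) by (fastforce simp: H_def X_def)
    then have "card H \<le> (\<Sum>x\<in>X i. card {j. j < l i \<and> x \<in> A i ! j})"
      using card_UN_le[of "X i" "\<lambda>x. {j. j < l i \<and> x \<in> A i ! j}"] by (simp add: X_def)
    also have "\<dots> \<le> (\<Sum>x\<in>X i. 2)" by (intro sum_mono two)
    finally have cH: "card H \<le> 2 * (s i - 1)" using i(2) by simp
    define D where "D = {..<l i} - H"
    have "H \<subseteq> {..<l i}" by (auto simp: H_def)
    then have cD: "card D = l i - card H" unfolding D_def by (subst card_Diff_subset) (auto intro: finite_subset)
    have D: "ev" "{t, t + 1} \<subseteq> A i ! j" if "j \<in> D" for j
    proof -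
      have "A i ! j \<in> E" "A i ! j \<inter> {..<t} = {}" using that Ai by (auto simp: D_def H_def)
      then show "ev" "{t, t + 1} \<subseteq> A i ! j" unfolding E_def by blast+
    qed
    \<comment> \<open>A single avoiding edge shows that all lengths are even; evenness of
      \<open>l i\<close> then supplies a second one.\<close>
    have "card D \<ge> 1" using cD cH l[OF i(1)] by (auto simp: s)
    then have "D \<noteq> {}" by auto
    then have "even (l i)" using D(1) i(1) by (auto simp: ev_def)
    then have "card D \<ge> 2" using cD cH l[OF i(1)] by (auto simp: s elim!: evenE)
    then obtain S where "S \<subseteq> D" "card S = 2" by (meson obtain_subset_with_card_n)
    then obtain a b where ab: "a \<in> D" "b \<in> D" "a \<noteq> b" by (auto simp: card_2_iff)
    then have "card (A i ! a \<inter> A i ! b) \<le> 1" 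
      using cyclic_list_Int_le_1[OF Ai(2), of a b] Ai(1) by (auto simp: D_def)
    moreover have "{t, t + 1} \<subseteq> A i ! a \<inter> A i ! b" using D ab by blast
    moreover have "finite (A i ! a)"
    proof -
      have "A i ! a \<in> E" using ab Ai by (auto simp: D_def)
      then show ?thesis using finite_subset[of _ "{..<n}"] by (auto simp: E_def)
    qed
    ultimately show False using card_mono[of "A i ! a \<inter> A i ! b" "{t, t + 1}"] by auto
  qed
  define X Y W where "X = {e. e \<subseteq> {..<n} \<and> card e = k}" and "Y = {e. e \<subseteq> {t..<n} \<and> card e = k}"
    and "W = {e. e \<subseteq> {t..<n} \<and> card e = k \<and> {t, t + 1} \<subseteq> e}"
  have fin: "finite X" "finite Y" "finite W" by (auto simp: X_def Y_def W_def finite_uniform)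
  have "card X = n choose k" "card Y = (n - t) choose k"
    by (simp_all add: X_def Y_def n_subsets)
  moreover have "card W = (n - t - 2) choose (k - 2)"
    unfolding W_def using n k by (subst card_supersets) (auto simp: numeral_2_eq_2)
  moreover have "E = (X - Y) \<union> (if ev then W else {})"
    by (auto simp: E_def X_def Y_def W_def subset_iff)
  moreover have "(X - Y) \<inter> W = {}" "Y \<subseteq> X" by (auto simp: X_def Y_def W_def)
  ultimately show "card E = (n choose k) - ((n - t) choose k) + (if ev then (n - t - 2) choose (k - 2) else 0)"
    using fin by (auto simp: card_Un_disjoint card_Diff_subset)
qed

section \<open>Homogeneous families\<close>

text \<open>On an edge coloured bijectively by \<open>{..<k}\<close>, colour sets index the subsets,
  so that subsets of different edges become comparable.\<close>

definition restr :: "('v \<Rightarrow> nat) \<Rightarrow> 'v set \<Rightarrow> nat set \<Rightarrow> 'v set" where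
  "restr \<chi> e A = {x \<in> e. \<chi> x \<in> A}"

lemma restr_subset: "restr \<chi> e A \<subseteq> e" by (auto simp: restr_def)

lemma restr_eq:
  assumes "bij_betw \<chi> e {..<k}" "bij_betw \<chi> e' {..<k}" "restr \<chi> e' A \<subseteq> e"
  shows "restr \<chi> e A = restr \<chi> e' A"
proof
  show "restr \<chi> e' A \<subseteq> restr \<chi> e A" using assms(3) by (auto simp: restr_def)
  show "restr \<chi> e A \<subseteq> restr \<chi> e' A"
  proof
    fix x assume x: "x \<in> restr \<chi> e A"
    then have "\<chi> x \<in> {..<k}" using bij_betwE[OF assms(1)] by (auto simp: restr_def)
    then have "\<chi> x \<in> \<chi> ` e'" using bij_betw_imp_surj_on[OF assms(2)] by blast
    then obtain y where y: "y \<in> e'" "\<chi> y = \<chi> x" by (metis imageE)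
    then have y2: "y \<in> restr \<chi> e' A" using x by (auto simp: restr_def)
    then have "y = x" using assms(3) y x bij_betw_imp_inj_on[OF assms(1)] by (auto simp: restr_def dest: inj_onD)
    then show "x \<in> restr \<chi> e' A" using y2 by simp
  qed
qed

lemma Int_eq_restr:
  assumes "bij_betw \<chi> e {..<k}" shows "e \<inter> e' = restr \<chi> e (\<chi> ` (e \<inter> e'))"
proof
  show "restr \<chi> e (\<chi> ` (e \<inter> e')) \<subseteq> e \<inter> e'"
  proof
    fix x assume "x \<in> restr \<chi> e (\<chi> ` (e \<inter> e'))"
    then obtain y where "x \<in> e" "y \<in> e" "y \<in> e'" "\<chi> x = \<chi> y" by (auto simp: restr_def)
    then show "x \<in> e \<inter> e'" using bij_betw_imp_inj_on[OF assms] by (auto dest: inj_onD)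
  qed
qed (auto simp: restr_def)

lemma not_richE:
  assumes "\<not> rich E N K"
  obtains Z where "finite Z" "card Z \<le> N" "Z \<inter> K = {}" "\<And>e. e \<in> E \<Longrightarrow> K \<subseteq> e \<Longrightarrow> e \<inter> Z \<noteq> {}"
proof -
  from assms obtain Z where "finite Z" "card Z \<le> N" "Z \<inter> K = {}" "\<not> (\<exists>e\<in>E. K \<subseteq> e \<and> e \<inter> Z = {})"
    unfolding rich_def not_all not_imp by (elim exE conjE)
  then show thesis by (intro that[of Z]) auto
qed

text \<open>$H$ remains after repeatedly deleting from $F$ all edges containing some $B$ that is not rich; the
  deleted edge $e$ remembers in $\alpha(e)$ the colour set of that $B$. Each $B$ is used once, hence one
  set $Z$ meets all edges deleted on its account.\<close>

definition peeled :: "('v \<Rightarrow> nat) \<Rightarrow> nat set set \<Rightarrow> nat \<Rightarrow> 'v set set \<Rightarrow> 'v set set \<Rightarrow> ('v set \<Rightarrow> nat set) \<Rightarrow> bool" where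
  "peeled \<chi> L s F H \<alpha> \<longleftrightarrow> H \<subseteq> F \<and> (\<forall>e\<in>H. \<forall>A\<in>L. rich H s (restr \<chi> e A)) \<and> (\<forall>e\<in>F - H. \<alpha> e \<in> L) \<and>
    (\<forall>A B. \<exists>Z. finite Z \<and> card Z \<le> s \<and> Z \<inter> B = {} \<and> (\<forall>e\<in>F - H. \<alpha> e = A \<and> restr \<chi> e A = B \<longrightarrow> e \<inter> Z \<noteq> {}))"

lemma peel:
  assumes "finite F" "\<And>e. e \<in> F \<Longrightarrow> bij_betw \<chi> e {..<k}"
  shows "\<exists>H \<alpha>. peeled \<chi> L s F H \<alpha>"
  using assms
proof (induction F rule: finite_psubset_induct)
  case (psubset F)
  show ?case
  proof (cases "\<forall>e\<in>F. \<forall>A\<in>L. rich F s (restr \<chi> e A)")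
    case True
    then show ?thesis unfolding peeled_def by (intro exI[of _ F] exI[of _ "\<lambda>_. {}"]) (auto intro!: exI[of _ "{}"])
  next
    case False
    then obtain e0 A0 where e0: "e0 \<in> F" "A0 \<in> L" "\<not> rich F s (restr \<chi> e0 A0)" by blast
    define B0 where "B0 = restr \<chi> e0 A0"
    obtain Z0 where Z0: "finite Z0" "card Z0 \<le> s" "Z0 \<inter> B0 = {}" "\<And>e. e \<in> F \<Longrightarrow> B0 \<subseteq> e \<Longrightarrow> e \<inter> Z0 \<noteq> {}"
      using e0(3) unfolding B0_def[symmetric] by (rule not_richE) blast
    define S where "S = {e \<in> F. B0 \<subseteq> e}"
    have "e0 \<in> S" using e0 by (auto simp: S_def B0_def restr_def)
    then have "F - S \<subset> F" using e0 by auto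
    moreover have "\<And>e. e \<in> F - S \<Longrightarrow> bij_betw \<chi> e {..<k}" using psubset.prems by auto
    ultimately obtain H \<alpha> where "peeled \<chi> L s (F - S) H \<alpha>" using psubset.IH by presburger
    then have H: "H \<subseteq> F - S" "\<forall>e\<in>H. \<forall>A\<in>L. rich H s (restr \<chi> e A)" "\<forall>e\<in>(F - S) - H. \<alpha> e \<in> L"
      "\<forall>A B. \<exists>Z. finite Z \<and> card Z \<le> s \<and> Z \<inter> B = {} \<and> (\<forall>e\<in>(F - S) - H. \<alpha> e = A \<and> restr \<chi> e A = B \<longrightarrow> e \<inter> Z \<noteq> {})"
      unfolding peeled_def by simp_all
    \<comment> \<open>Every edge of \<open>S\<close> contains \<open>B0\<close>, so by
      \<open>restr_eq\<close> its trace in the colours \<open>A0\<close> is \<open>B0\<close>. Thus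
      \<open>S\<close> affects only the pair \<open>(A0, B0)\<close>, for which \<open>Z0\<close> is
      the witness.\<close>
    define \<beta> where "\<beta> e = (if e \<in> S then A0 else \<alpha> e)" for e
    have "\<exists>Z. finite Z \<and> card Z \<le> s \<and> Z \<inter> B = {} \<and> (\<forall>e\<in>F - H. \<beta> e = A \<and> restr \<chi> e A = B \<longrightarrow> e \<inter> Z \<noteq> {})" for A B
    proof (cases "A = A0 \<and> B = B0")
      case True
      have "e \<inter> Z0 \<noteq> {}" if "e \<in> F" "restr \<chi> e A = B" for e
        using Z0(4) that True restr_subset[of \<chi> e A] by auto
      then show ?thesis using Z0(1-3) True by (intro exI[of _ Z0]) simp
    next
      case False
      obtain Z where Z: "finite Z" "card Z \<le> s" "Z \<inter> B = {}" "\<forall>e\<in>(F - S) - H. \<alpha> e = A \<and> restr \<chi> e A = B \<longrightarrow> e \<inter> Z \<noteq> {}"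
        using H(4)[rule_format, of B A] by (elim exE conjE)
      have "e \<inter> Z \<noteq> {}" if e: "e \<in> F - H" "\<beta> e = A" "restr \<chi> e A = B" for e
      proof (cases "e \<in> S")
        case True
        then have "A = A0" using e by (simp add: \<beta>_def)
        moreover have "restr \<chi> e A0 = B0"
          unfolding B0_def using restr_eq[OF psubset.prems psubset.prems, of e e0 A0] True e0 by (auto simp: S_def B0_def)
        ultimately show ?thesis using False e by simp
      next
        case False
        then show ?thesis using Z(4) e by (auto simp: \<beta>_def)
      qed
      then show ?thesis using Z(1-3) by (intro exI[of _ Z]) simp
    qed
    moreover have "\<forall>e\<in>F - H. \<beta> e \<in> L" using H(3) e0(2) by (auto simp: \<beta>_def)
    moreover have "H \<subseteq> F" using H(1) by auto
    ultimately have "peeled \<chi> L s F H \<beta>" using H(2) unfolding peeled_def by simp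
    then show ?thesis by blast
  qed
qed

lemma popular_vertex:
  assumes "finite R" "finite Z" "card Z \<le> s" "\<And>e. e \<in> R \<Longrightarrow> e \<inter> Z \<noteq> {}"
  shows "\<exists>z. (R \<noteq> {} \<longrightarrow> z \<in> Z) \<and> card R \<le> s * card {e \<in> R. z \<in> e}"
proof (rule ccontr)
  assume n: "\<not> ?thesis"
  then have R: "R \<noteq> {}" by auto
  have "card R \<le> card (\<Union>z\<in>Z. {e \<in> R. z \<in> e})"
    using assms by (intro card_mono) auto
  also have "\<dots> \<le> (\<Sum>z\<in>Z. card {e \<in> R. z \<in> e})" by (rule card_UN_le[OF assms(2)])
  finally have "s * card R \<le> (\<Sum>z\<in>Z. s * card {e \<in> R. z \<in> e})"
    by (simp add: sum_distrib_left[symmetric] mult_le_mono2)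
  also have "\<dots> < (\<Sum>z\<in>Z. card R)"
  proof (rule sum_strict_mono[OF assms(2)])
    show "Z \<noteq> {}" using R assms(4) by auto
    show "s * card {e \<in> R. z \<in> e} < card R" if "z \<in> Z" for z using n that by (auto simp: not_le)
  qed
  finally show False using assms(3) by (simp add: mult_le_mono1 leD)
qed

text \<open>The structure of Fueredi's theorem: every colour pattern that occurs as an intersection
  is robust on every edge. Richness takes the place of being the kernel of a large
  sunflower.\<close>

definition homogeneous :: "nat \<Rightarrow> ('v \<Rightarrow> nat) \<Rightarrow> nat \<Rightarrow> 'v set set \<Rightarrow> nat set set \<Rightarrow> bool" where
  "homogeneous k \<chi> s G J \<longleftrightarrow> J \<subseteq> Pow {..<k} \<and> (\<forall>e\<in>G. \<forall>A\<in>J. rich G s (restr \<chi> e A)) \<and>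
    (\<forall>e\<in>G. \<forall>e'\<in>G. e \<noteq> e' \<longrightarrow> \<chi> ` (e \<inter> e') \<in> J)"

text \<open>Induction on the number of patterns outside \<open>Dd\<close>, the patterns known not to
  occur as intersections. If at least half of the edges survive peeling, the survivors are
  homogeneous. Otherwise one pattern \<open>A\<close> accounts for a share 1 / 2^k of the deleted
  edges, and thinning these by a factor \<open>s\<close> makes \<open>A\<close> impossible. Each
  round costs the factor 2 * 2^k * s.\<close>

lemma homogeneous_subfamily:
  assumes "card (Pow {..<k} - Dd) = m" "finite F" "\<And>e. e \<in> F \<Longrightarrow> bij_betw \<chi> e {..<k}" and s: "s \<ge> 1"
    "\<And>e e'. e \<in> F \<Longrightarrow> e' \<in> F \<Longrightarrow> e \<noteq> e' \<Longrightarrow> \<chi> ` (e \<inter> e') \<notin> Dd"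
  shows "\<exists>G J. G \<subseteq> F \<and> card F \<le> (2 ^ (k + 1) * s) ^ m * card G \<and> homogeneous k \<chi> s G J"
  using assms
proof (induction m arbitrary: Dd F)
  case 0
  have sub: "\<chi> ` (e \<inter> e') \<in> Pow {..<k}" if "e \<in> F" for e e'
    using bij_betwE[OF "0.prems"(3)[OF that]] by auto
  have "Pow {..<k} \<subseteq> Dd" using "0.prems"(1) by simp
  then have "e = e'" if "e \<in> F" "e' \<in> F" for e e' using "0.prems"(5)[OF that] sub[OF that(1), of e'] by (meson subsetD)
  then show ?case by (intro exI[of _ F] exI[of _ "{}"]) (auto simp: homogeneous_def)
next
  case (Suc m)
  define c where "c = 2 ^ (k + 1) * s"
  have c: "c \<ge> 2" using s by (auto simp: c_def)
  define L where "L = Pow {..<k} - Dd"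
  have cL: "finite L" "card L = Suc m" "card L \<le> 2 ^ k"
    using Suc.prems(1) card_mono[of "Pow {..<k}" L] by (auto simp: L_def card_Pow)
  obtain H \<alpha> where "peeled \<chi> L s F H \<alpha>" using peel[of F \<chi> k L s] Suc.prems(2,3) by presburger
  then have H: "H \<subseteq> F" "\<forall>e\<in>H. \<forall>A\<in>L. rich H s (restr \<chi> e A)" "\<forall>e\<in>F - H. \<alpha> e \<in> L"
    "\<forall>A B. \<exists>Z. finite Z \<and> card Z \<le> s \<and> Z \<inter> B = {} \<and> (\<forall>e\<in>F - H. \<alpha> e = A \<and> restr \<chi> e A = B \<longrightarrow> e \<inter> Z \<noteq> {})"
    unfolding peeled_def by simp_all
  have inL: "\<chi> ` (e \<inter> e') \<in> L" if "e \<in> F" "e' \<in> F" "e \<noteq> e'" for e e'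
    using Suc.prems(5)[OF that] bij_betwE[OF Suc.prems(3)[OF that(1)]] by (auto simp: L_def)
  show ?case
  proof (cases "card F \<le> 2 * card H")
    case True
    have "2 * 1 \<le> c * c ^ m" using c by (intro mult_le_mono) auto
    then have "2 * card H \<le> c ^ Suc m * card H" by (intro mult_le_mono1) simp
    then have "card F \<le> c ^ Suc m * card H" using True by linarith
    moreover have "homogeneous k \<chi> s H L"
      unfolding homogeneous_def
    proof (intro conjI ballI impI)
      show "L \<subseteq> Pow {..<k}" by (auto simp: L_def)
      show "rich H s (restr \<chi> e A)" if "e \<in> H" "A \<in> L" for e A using H(2) that by blast
      show "\<chi> ` (e \<inter> e') \<in> L" if "e \<in> H" "e' \<in> H" "e \<noteq> e'" for e e' using inL that H(1) by blast
    qed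
    ultimately show ?thesis using H(1) unfolding c_def[symmetric] by blast
  next
    case False
    define R where "R = F - H"
    have fR: "finite R" using Suc.prems(2) by (simp add: R_def)
    have "card R = card F - card H" unfolding R_def using H(1) Suc.prems(2) by (simp add: card_Diff_subset finite_subset)
    then have cR: "card F \<le> 2 * card R" using False by simp
    have "\<exists>A\<in>L. card R \<le> 2 ^ k * card {e \<in> R. \<alpha> e = A}"
    proof (rule ccontr)
      assume "\<not> ?thesis"
      then have lt: "2 ^ k * card {e \<in> R. \<alpha> e = A} < card R" if "A \<in> L" for A using that by (auto simp: not_le)
      have "\<alpha> ` R \<subseteq> L" using H(3) by (auto simp: R_def)
      then have "card R = (\<Sum>A\<in>L. card {e \<in> R. \<alpha> e = A})"
        using sum.group[OF fR cL(1), of \<alpha> "\<lambda>_. 1::nat"] by simp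
      then have "2 ^ k * card R = (\<Sum>A\<in>L. 2 ^ k * card {e \<in> R. \<alpha> e = A})" by (simp add: sum_distrib_left)
      also have "\<dots> < (\<Sum>A\<in>L. card R)" using lt cL by (intro sum_strict_mono) auto
      also have "\<dots> = card L * card R" by simp
      also have "\<dots> \<le> 2 ^ k * card R" using cL(3) by (rule mult_le_mono1)
      finally show False by simp
    qed
    then obtain A where A: "A \<in> L" "card R \<le> 2 ^ k * card {e \<in> R. \<alpha> e = A}" by blast
    define RA where "RA = {e \<in> R. \<alpha> e = A}"
    have fRA: "finite RA" using fR by (simp add: RA_def)
    \<comment> \<open>For each trace \<open>B\<close>, the set \<open>Z\<close> supplied by peeling
      meets all deleted edges with this trace, so one of its vertices, which lies outside
      \<open>B\<close>, is in a share of at least 1 / s of them.\<close>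
    have "\<forall>B. \<exists>z. card {e \<in> RA. restr \<chi> e A = B} \<le> s * card {e \<in> RA. restr \<chi> e A = B \<and> z \<in> e} \<and>
      ({e \<in> RA. restr \<chi> e A = B} \<noteq> {} \<longrightarrow> z \<notin> B)"
    proof
      fix B
      obtain Z where Z: "finite Z" "card Z \<le> s" "Z \<inter> B = {}" "\<forall>e\<in>F - H. \<alpha> e = A \<and> restr \<chi> e A = B \<longrightarrow> e \<inter> Z \<noteq> {}"
        using H(4)[rule_format, of B A] by (elim exE conjE)
      define X where "X = {e \<in> RA. restr \<chi> e A = B}"
      have "\<exists>z. (X \<noteq> {} \<longrightarrow> z \<in> Z) \<and> card X \<le> s * card {e \<in> X. z \<in> e}"
      proof (rule popular_vertex[OF _ Z(1,2)])
        show "finite X" using fRA by (simp add: X_def)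
        show "e \<inter> Z \<noteq> {}" if "e \<in> X" for e using Z(4) that by (simp add: X_def RA_def R_def)
      qed
      then obtain z where z: "X \<noteq> {} \<longrightarrow> z \<in> Z" "card X \<le> s * card {e \<in> X. z \<in> e}" by blast
      have "{e \<in> X. z \<in> e} = {e \<in> RA. restr \<chi> e A = B \<and> z \<in> e}" by (auto simp: X_def)
      then show "\<exists>z. card {e \<in> RA. restr \<chi> e A = B} \<le> s * card {e \<in> RA. restr \<chi> e A = B \<and> z \<in> e} \<and>
        ({e \<in> RA. restr \<chi> e A = B} \<noteq> {} \<longrightarrow> z \<notin> B)" using z Z(3) unfolding X_def[symmetric] by (intro exI[of _ z]) auto
    qed
    from choice[OF this] obtain z where zz: "\<forall>B. card {e \<in> RA. restr \<chi> e A = B} \<le> s * card {e \<in> RA. restr \<chi> e A = B \<and> z B \<in> e} \<and>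
      ({e \<in> RA. restr \<chi> e A = B} \<noteq> {} \<longrightarrow> z B \<notin> B)" by (elim exE)
    have z: "card {e \<in> RA. restr \<chi> e A = B} \<le> s * card {e \<in> RA. restr \<chi> e A = B \<and> z B \<in> e}"
      "{e \<in> RA. restr \<chi> e A = B} \<noteq> {} \<Longrightarrow> z B \<notin> B" for B
      using zz by simp_all
    define R' where "R' = {e \<in> RA. z (restr \<chi> e A) \<in> e}"
    have fR': "finite R'" "R' \<subseteq> F" using fRA finite_subset[of R' RA] by (auto simp: R'_def RA_def R_def)
    define T where "T = (\<lambda>e. restr \<chi> e A) ` RA"
    have fT: "finite T" using fRA by (simp add: T_def)
    have "card RA = (\<Sum>B\<in>T. card {e \<in> RA. restr \<chi> e A = B})"
      using sum.group[OF fRA fT, of "\<lambda>e. restr \<chi> e A" "\<lambda>_. 1::nat"] by (simp add: T_def)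
    also have "\<dots> \<le> (\<Sum>B\<in>T. s * card {e \<in> R'. restr \<chi> e A = B})"
    proof (rule sum_mono)
      fix B
      have "{e \<in> RA. restr \<chi> e A = B \<and> z B \<in> e} = {e \<in> R'. restr \<chi> e A = B}" by (auto simp: R'_def)
      then show "card {e \<in> RA. restr \<chi> e A = B} \<le> s * card {e \<in> R'. restr \<chi> e A = B}" using z(1)[of B] by simp
    qed
    also have "\<dots> = s * (\<Sum>B\<in>T. card {e \<in> R'. restr \<chi> e A = B})" by (simp add: sum_distrib_left)
    also have "(\<Sum>B\<in>T. card {e \<in> R'. restr \<chi> e A = B}) = card R'"
    proof -
      have "(\<lambda>e. restr \<chi> e A) ` R' \<subseteq> T" by (auto simp: T_def R'_def)
      then show ?thesis using sum.group[OF fR'(1) fT, of "\<lambda>e. restr \<chi> e A" "\<lambda>_. 1::nat"] by simp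
    qed
    finally have cRA: "card RA \<le> s * card R'" .
    have "card F \<le> 2 * (2 ^ k * card RA)" using cR A(2) unfolding RA_def by linarith
    also have "\<dots> \<le> 2 * (2 ^ k * (s * card R'))" using cRA by simp
    finally have cF: "card F \<le> c * card R'" by (simp add: c_def mult.assoc)
    \<comment> \<open>Two edges of \<open>R'\<close> meeting in pattern \<open>A\<close> have their
      intersection as common trace. Then both contain the vertex selected for this trace, although
      it lies outside the intersection.\<close>
    have dead: "\<chi> ` (e \<inter> e') \<notin> insert A Dd" if e: "e \<in> R'" "e' \<in> R'" "e \<noteq> e'" for e e'
    proof -
      have eF: "e \<in> F" "e' \<in> F" using e fR' by auto
      have "\<chi> ` (e \<inter> e') \<noteq> A"
      proof
        assume a: "\<chi> ` (e \<inter> e') = A"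
        have 1: "e \<inter> e' = restr \<chi> e A" using Int_eq_restr[OF Suc.prems(3)[OF eF(1)], of e'] a by simp
        have 2: "e \<inter> e' = restr \<chi> e' A" using Int_eq_restr[OF Suc.prems(3)[OF eF(2)], of e] a by (simp add: Int_commute)
        have "z (e \<inter> e') \<in> e" "z (e \<inter> e') \<in> e'" using e 1 2 by (auto simp: R'_def)
        moreover have "z (e \<inter> e') \<notin> e \<inter> e'" using e 1 by (intro z(2)) (auto simp: R'_def)
        ultimately show False by blast
      qed
      then show ?thesis using Suc.prems(5)[OF eF e(3)] by simp
    qed
    have "Pow {..<k} - insert A Dd = L - {A}" by (auto simp: L_def)
    then have "card (Pow {..<k} - insert A Dd) = m" using A(1) cL by simp
    have "\<exists>G J. G \<subseteq> R' \<and> card R' \<le> c ^ m * card G \<and> homogeneous k \<chi> s G J"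
      unfolding c_def
    proof (rule Suc.IH[of "insert A Dd" R'])
      show "card (Pow {..<k} - insert A Dd) = m" by fact
      show "bij_betw \<chi> e {..<k}" if "e \<in> R'" for e using Suc.prems(3) fR'(2) that by blast
      show "\<chi> ` (e \<inter> e') \<notin> insert A Dd" if "e \<in> R'" "e' \<in> R'" "e \<noteq> e'" for e e' by (rule dead[OF that])
    qed (use fR'(1) s in simp_all)
    then obtain G J where G: "G \<subseteq> R'" "card R' \<le> c ^ m * card G" "homogeneous k \<chi> s G J" by (elim exE conjE)
    have "card F \<le> c * (c ^ m * card G)" using cF G(2) by (meson le_trans mult_le_mono2)
    then have "card F \<le> c ^ Suc m * card G" by (simp add: mult.assoc)
    then show ?thesis using G fR'(2) unfolding c_def[symmetric] by blast
  qed
qed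

section \<open>Intersection patterns: triangle or star\<close>

text \<open>\<open>O'\<close> collects the colours whose complement is not a pattern. By covering
  and intersecting, every proper set of colours is a pattern unless it misses exactly one element of
  \<open>O'\<close>. If \<open>O'\<close> is not a single colour, three colours can be chosen such
  that none of their pairs does so, which gives a triangle. If \<open>O'\<close> is {c}, all proper
  sets through c are patterns, and one further pair without c completes a triangle.\<close>

lemma patterns_dichotomy:
  fixes k :: nat
  assumes k: "k \<ge> 5" and J: "J \<subseteq> Pow {..<k}"
    and inter: "\<And>A B. A \<in> J \<Longrightarrow> B \<in> J \<Longrightarrow> A \<inter> B \<noteq> {..<k} \<Longrightarrow> A \<inter> B \<in> J"
    and cover: "\<And>W. W \<subseteq> {..<k} \<Longrightarrow> card W = k - 2 \<Longrightarrow> \<exists>A\<in>J. W \<subseteq> A \<and> A \<noteq> {..<k}"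
  shows "(\<exists>p q r. p < k \<and> q < k \<and> r < k \<and> p \<noteq> q \<and> q \<noteq> r \<and> p \<noteq> r \<and> {p, q} \<in> J \<and> {q, r} \<in> J \<and> {p, r} \<in> J) \<or>
    (\<exists>c<k. (\<forall>A. A \<subseteq> {..<k} \<longrightarrow> c \<in> A \<longrightarrow> A \<noteq> {..<k} \<longrightarrow> A \<in> J) \<and>
      (\<forall>p q. p < k \<longrightarrow> q < k \<longrightarrow> p \<noteq> q \<longrightarrow> p \<noteq> c \<longrightarrow> q \<noteq> c \<longrightarrow> {p, q} \<notin> J))" (is "?tri \<or> ?star")
proof -
  define O' where "O' = {c. c < k \<and> {..<k} - {c} \<notin> J}"
  have O'k: "O' \<subseteq> {..<k}" "finite O'" by (auto simp: O'_def)
  \<comment> \<open>The pattern covering the complement of {i, j} is equal to it: adding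
    \<open>i\<close> or \<open>j\<close> would give the complement of a single element of
    \<open>O'\<close>, or everything.\<close>
  have pairs: "{..<k} - {i, j} \<in> J" if "i \<in> O'" "j \<in> O'" "i \<noteq> j" for i j
  proof -
    have "card ({..<k} - {i, j}) = k - 2" using that by (simp add: O'_def card_Diff_subset)
    then obtain A where A: "A \<in> J" "{..<k} - {i, j} \<subseteq> A" "A \<noteq> {..<k}" using cover[of "{..<k} - {i, j}"] by blast
    have "A \<subseteq> {..<k}" using A J by auto
    have "A \<noteq> {..<k} - {i}" "A \<noteq> {..<k} - {j}" using A that by (auto simp: O'_def)
    then have "A = {..<k} - {i, j}" using A \<open>A \<subseteq> {..<k}\<close> that by (auto simp: O'_def)
    then show ?thesis using A by simp
  qed
  have main: "{..<k} - W \<in> J" if "W \<subseteq> {..<k}" "W \<noteq> {}" "card (W \<inter> O') \<noteq> 1" for W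
  proof -
    have "finite W" using that(1) finite_subset by blast
    from this that show ?thesis
    proof (induction W rule: finite_psubset_induct)
      case (psubset W)
      show ?case
      proof (cases "W \<subseteq> O'")
        case False
        then obtain i where i: "i \<in> W" "i \<notin> O'" by blast
        have iJ: "{..<k} - {i} \<in> J" using i psubset.prems by (auto simp: O'_def)
        show ?thesis
        proof (cases "W = {i}")
          case False
          have "(W - {i}) \<inter> O' = W \<inter> O'" using i by auto
          then have "{..<k} - (W - {i}) \<in> J" using psubset.IH[of "W - {i}"] psubset.prems False i by auto
          moreover have "({..<k} - (W - {i})) \<inter> ({..<k} - {i}) = {..<k} - W" using i psubset.prems by auto
          moreover have "{..<k} - W \<noteq> {..<k}" using i psubset.prems by auto
          ultimately show ?thesis using inter[OF _ iJ, of "{..<k} - (W - {i})"] by simp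
        qed (use iJ in simp)
      next
        case True
        then have "card W \<noteq> 1" "card W \<noteq> 0" using psubset.prems psubset.hyps by (auto simp: Int_absorb2)
        then have "card W \<ge> 2" by linarith
        then obtain S where "S \<subseteq> W" "card S = 2" by (meson obtain_subset_with_card_n)
        then obtain i j where ij: "i \<in> W" "j \<in> W" "i \<noteq> j" by (auto simp: card_2_iff)
        then have pJ: "{..<k} - {i, j} \<in> J" using pairs True by auto
        show ?thesis
        proof (cases "W = {i, j}")
          case False
          have "card {i, j} < card W" using ij False psubset.hyps by (intro psubset_card_mono) auto
          then have "card (W - {i}) \<noteq> 1" using ij psubset.hyps by simp
          moreover have "(W - {i}) \<inter> O' = W - {i}" using True by auto
          moreover have "W - {i} \<noteq> {}" using ij by auto
          ultimately have "{..<k} - (W - {i}) \<in> J" using psubset.IH[of "W - {i}"] psubset.prems ij by auto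
          moreover have "({..<k} - (W - {i})) \<inter> ({..<k} - {i, j}) = {..<k} - W" using ij psubset.prems by auto
          moreover have "{..<k} - W \<noteq> {..<k}" using ij psubset.prems by auto
          ultimately show ?thesis using inter[OF _ pJ, of "{..<k} - (W - {i})"] by simp
        qed (use pJ in simp)
      qed
    qed
  qed
  have main': "A \<in> J" if "A \<subseteq> {..<k}" "A \<noteq> {..<k}" "card (O' - A) \<noteq> 1" for A
  proof -
    have "({..<k} - A) \<inter> O' = O' - A" using O'k by auto
    moreover have "{..<k} - ({..<k} - A) = A" using that by auto
    moreover have "{..<k} - A \<noteq> {}" using that by auto
    ultimately show ?thesis using main[of "{..<k} - A"] that by simp
  qed
  have two: "{p, q} \<in> J" if "p < k" "q < k" "p \<noteq> q" "card (O' - {p, q}) \<noteq> 1" for p q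
  proof -
    have "card {p, q} \<noteq> card {..<k}" using that k by simp
    then have "{p, q} \<noteq> {..<k}" by metis
    then show ?thesis using main'[of "{p, q}"] that by simp
  qed
  have cI: "card ({..<k} - O') = k - card O'" using O'k by (simp add: card_Diff_subset)
  have three: "?tri \<or> ?star"
    if p: "p < k" "q < k" "r < k" "p \<noteq> q" "q \<noteq> r" "p \<noteq> r"
      "card (O' - {p, q}) \<noteq> 1" "card (O' - {q, r}) \<noteq> 1" "card (O' - {p, r}) \<noteq> 1" for p q r
  proof -
    have "{p, q} \<in> J" "{q, r} \<in> J" "{p, r} \<in> J" using two p by simp_all
    then have ?tri using p by - (rule exI[of _ p], rule exI[of _ q], rule exI[of _ r], simp)
    then show ?thesis by (rule disjI1)
  qed
  consider "card O' = 0" | "card O' = 1" | "card O' = 2" | "card O' = 3" | "card O' \<ge> 4" by linarith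
  then show ?thesis
  proof cases
    case 1
    then have "O' = {}" using O'k by simp
    then show ?thesis using k by (intro three[of 0 1 2]) auto
  next
    case 2
    then obtain c where c: "O' = {c}" by (auto simp: card_1_singleton_iff)
    have ck: "c < k" using c O'k by auto
    have cA: "A \<in> J" if "A \<subseteq> {..<k}" "c \<in> A" "A \<noteq> {..<k}" for A using main'[of A] that c by auto
    show ?thesis
    proof (cases "\<exists>p q. p < k \<and> q < k \<and> p \<noteq> q \<and> p \<noteq> c \<and> q \<noteq> c \<and> {p, q} \<in> J")
      case True
      then obtain p q where p: "p < k" "q < k" "p \<noteq> q" "p \<noteq> c" "q \<noteq> c" "{p, q} \<in> J" by blast
      have ne: "{x, c} \<noteq> {..<k}" for x
      proof
        assume "{x, c} = {..<k}"
        then have "card {x, c} = k" by simp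
        then show False using k card_insert_le_m1[of 2 "{c}" x] by simp
      qed
      have "{q, c} \<in> J" "{p, c} \<in> J" using cA[of "{q, c}"] cA[of "{p, c}"] ne p ck by auto
      then show ?thesis using p ck by blast
    next
      case False
      then show ?thesis using cA ck by blast
    qed
  next
    case 3
    \<comment> \<open>Here k >= 5 is used: with three colours outside \<open>O'\<close>, each of
      their pairs misses both elements of \<open>O'\<close>.\<close>
    then have "card ({..<k} - O') \<ge> 3" using cI k by simp
    then obtain S where S: "S \<subseteq> {..<k} - O'" "card S = 3" by (meson obtain_subset_with_card_n)
    then obtain p q r where p: "S = {p, q, r}" "p \<noteq> q" "q \<noteq> r" "p \<noteq> r" by (auto simp: card_3_iff)
    have "O' - {p, q} = O'" "O' - {q, r} = O'" "O' - {p, r} = O'" using S p by auto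
    then show ?thesis using S p 3 by (intro three[of p q r]) auto
  next
    case 4
    then have "card ({..<k} - O') \<ge> 2" using cI k by simp
    then obtain S where S: "S \<subseteq> {..<k} - O'" "card S = 2" by (meson obtain_subset_with_card_n)
    then obtain p q where p: "S = {p, q}" "p \<noteq> q" by (auto simp: card_2_iff)
    obtain r where r: "r \<in> O'" using 4 by fastforce
    have "O' - {p, q} = O'" "O' - {q, r} = O' - {r}" "O' - {p, r} = O' - {r}" using S p by auto
    then show ?thesis using S p 4 r O'k by (intro three[of p q r]) auto
  next
    case 5
    have "card (O' - {p, q}) \<noteq> 1" for p q
      using 5 diff_card_le_card_Diff[of "{p, q}" O'] card_insert_le_m1[of 2 "{q}" p] by simp
    then show ?thesis using k by (intro three[of 0 1 2]) auto
  qed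
qed

text \<open>Averaging over all k^n colourings of the n vertices: a bijection on a given edge extends
  freely, so the edge is rainbow in at least k^(n-k) of them.\<close>

lemma rainbow_colouring:
  assumes V: "finite V" and E: "\<And>e. e \<in> E \<Longrightarrow> e \<subseteq> V \<and> card e = k" and k: "k \<ge> 1"
  shows "\<exists>\<chi> :: 'v \<Rightarrow> nat. card E \<le> k ^ k * card {e \<in> E. bij_betw \<chi> e {..<k}}"
proof (cases "E = {}")
  case False
  have fE: "finite E" using V E by (intro finite_subset[of E "Pow V"]) auto
  obtain e0 where "e0 \<in> E" using False by blast
  then have nk: "k \<le> card V" using E[of e0] V card_mono by auto
  define \<Omega> where "\<Omega> = V \<rightarrow>\<^sub>E {..<k}"
  have f\<Omega>: "finite \<Omega>" "card \<Omega> = k ^ card V" using V by (simp_all add: \<Omega>_def finite_PiE card_PiE)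
  have lower: "k ^ (card V - k) \<le> card {\<chi> \<in> \<Omega>. bij_betw \<chi> e {..<k}}" if e: "e \<in> E" for e
  proof -
    have eV: "e \<subseteq> V" "finite e" "card e = k" using E[OF e] V finite_subset by auto
    obtain b where b: "bij_betw b e {..<k}"
      using ex_bij_betw_finite_nat[OF eV(2)] eV(3) by (auto simp: atLeast0LessThan)
    define h where "h g = (\<lambda>x. if x \<in> e then b x else g x)" for g :: "'v \<Rightarrow> nat"
    have "inj_on h ((V - e) \<rightarrow>\<^sub>E {..<k})"
    proof (rule inj_onI)
      fix g g' assume g: "g \<in> (V - e) \<rightarrow>\<^sub>E {..<k}" "g' \<in> (V - e) \<rightarrow>\<^sub>E {..<k}" "h g = h g'"
      show "g = g'"
      proof
        fix x
        show "g x = g' x"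
        proof (cases "x \<in> V - e")
          case True
          then show ?thesis using fun_cong[OF g(3), of x] by (simp add: h_def)
        next
          case False
          then show ?thesis using PiE_arb[OF g(1) False] PiE_arb[OF g(2) False] by simp
        qed
      qed
    qed
    moreover have "h ` ((V - e) \<rightarrow>\<^sub>E {..<k}) \<subseteq> {\<chi> \<in> \<Omega>. bij_betw \<chi> e {..<k}}"
    proof
      fix \<chi> assume "\<chi> \<in> h ` ((V - e) \<rightarrow>\<^sub>E {..<k})"
      then obtain g where g: "g \<in> (V - e) \<rightarrow>\<^sub>E {..<k}" "\<chi> = h g" by blast
      have "bij_betw \<chi> e {..<k}" using b by (subst bij_betw_cong[of e \<chi> b]) (auto simp: g h_def)
      moreover have "\<chi> \<in> \<Omega>"
        unfolding \<Omega>_def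
      proof (rule PiE_I)
        fix x assume "x \<in> V"
        then show "\<chi> x \<in> {..<k}" using bij_betwE[OF b] PiE_mem[OF g(1), of x] by (auto simp: g(2) h_def)
      next
        fix x assume "x \<notin> V"
        then show "\<chi> x = undefined" using PiE_arb[OF g(1), of x] eV(1) by (auto simp: g(2) h_def)
      qed
      ultimately show "\<chi> \<in> {\<chi> \<in> \<Omega>. bij_betw \<chi> e {..<k}}" by simp
    qed
    ultimately have "card ((V - e) \<rightarrow>\<^sub>E {..<k}) \<le> card {\<chi> \<in> \<Omega>. bij_betw \<chi> e {..<k}}"
      using f\<Omega>(1) by (intro card_inj_on_le[of h]) auto
    then show ?thesis using V eV by (simp add: card_PiE card_Diff_subset)
  qed
  show ?thesis
  proof (rule ccontr)
    assume "\<not> ?thesis"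
    then have lt: "k ^ k * card {e \<in> E. bij_betw \<chi> e {..<k}} < card E" for \<chi> :: "'v \<Rightarrow> nat" by (simp add: not_le)
    have "\<Omega> \<noteq> {}" using f\<Omega> k by auto
    have "k ^ k * (\<Sum>\<chi>\<in>\<Omega>. card {e \<in> E. bij_betw \<chi> e {..<k}}) = (\<Sum>\<chi>\<in>\<Omega>. k ^ k * card {e \<in> E. bij_betw \<chi> e {..<k}})"
      by (simp add: sum_distrib_left)
    also have "\<dots> < (\<Sum>\<chi>\<in>\<Omega>. card E)"
      using lt \<open>\<Omega> \<noteq> {}\<close> f\<Omega> by (intro sum_strict_mono) auto
    also have "\<dots> = k ^ card V * card E" using f\<Omega> by simp
    also have "k ^ card V = k ^ k * k ^ (card V - k)" using nk by (simp add: power_add[symmetric])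
    finally have "k ^ k * (\<Sum>\<chi>\<in>\<Omega>. card {e \<in> E. bij_betw \<chi> e {..<k}}) < k ^ k * (k ^ (card V - k) * card E)" by (simp add: mult.assoc)
    moreover have "k ^ (card V - k) * card E \<le> (\<Sum>\<chi>\<in>\<Omega>. card {e \<in> E. bij_betw \<chi> e {..<k}})"
    proof -
      have "k ^ (card V - k) * card E = (\<Sum>e\<in>E. k ^ (card V - k))" by simp
      also have "\<dots> \<le> (\<Sum>e\<in>E. card {\<chi> \<in> \<Omega>. bij_betw \<chi> e {..<k}})" using lower by (rule sum_mono)
      also have "\<dots> = (\<Sum>\<chi>\<in>\<Omega>. card {e \<in> E. bij_betw \<chi> e {..<k}})"
        by (rule sum_multicount_gen[symmetric, OF f\<Omega>(1) fE]) simp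
      finally show ?thesis .
    qed
    ultimately show False by (meson leD mult_le_mono2)
  qed
qed simp

text \<open>Richness makes the patterns closed under intersection, and size beyond n^(k-2) provides
  the covering hypothesis of \<open>patterns_dichotomy\<close>. A triangle of patterns yields a
  graph of rich pairs full of triangles, hence cycles. In the star case the vertex of colour
  \<open>c\<close> is determined by any two other vertices of its edge.\<close>

lemma homogeneous_dichotomy:
  fixes G :: "'v set set"
  assumes V: "finite V" and G: "\<And>e. e \<in> G \<Longrightarrow> e \<subseteq> V \<and> card e = k \<and> bij_betw \<chi> e {..<k}"
    and h: "homogeneous k \<chi> N G J" and k: "k \<ge> 5" and N: "N \<ge> 2 * k"
    and big: "card G > card V ^ (k - 2)"
    and I: "finite I" "\<And>i. i \<in> I \<Longrightarrow> l i \<ge> 3" "N \<ge> k * sum l I"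
  shows "cycle_system k I l G \<or> (\<exists>c<k. \<forall>e\<in>G. \<forall>e'\<in>G. \<forall>x y z z'. x \<in> e \<inter> e' \<longrightarrow> y \<in> e \<inter> e' \<longrightarrow> x \<noteq> y \<longrightarrow>
    \<chi> x \<noteq> c \<longrightarrow> \<chi> y \<noteq> c \<longrightarrow> z \<in> e \<longrightarrow> z' \<in> e' \<longrightarrow> \<chi> z = c \<longrightarrow> \<chi> z' = c \<longrightarrow> z = z')"
proof -
  have GG: "finite e" "card e = k" "inj_on \<chi> e" "\<chi> ` e = {..<k}" if "e \<in> G" for e
    using G[OF that] V finite_subset by (auto simp: bij_betw_def)
  have hJ: "J \<subseteq> Pow {..<k}" "\<And>e A. e \<in> G \<Longrightarrow> A \<in> J \<Longrightarrow> rich G N (restr \<chi> e A)"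
    "\<And>e e'. e \<in> G \<Longrightarrow> e' \<in> G \<Longrightarrow> e \<noteq> e' \<Longrightarrow> \<chi> ` (e \<inter> e') \<in> J"
    using h unfolding homogeneous_def by blast+
  have im: "\<chi> ` restr \<chi> e A = A" if "e \<in> G" "A \<subseteq> {..<k}" for e A
    using GG(4)[OF that(1)] that(2) by (auto simp: restr_def image_iff)
  obtain e0 where e0: "e0 \<in> G" using big by fastforce
  have inter: "A \<inter> B \<in> J" if AB: "A \<in> J" "B \<in> J" "A \<inter> B \<noteq> {..<k}" for A B
  proof -
    have AB': "A \<subseteq> {..<k}" "B \<subseteq> {..<k}" using AB hJ(1) by auto
    \<comment> \<open>\<open>e1\<close> leaves \<open>e0\<close> outside the trace of
      \<open>A\<close>, and \<open>e2\<close> leaves both outside the trace of \<open>B\<close>, so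
      they meet exactly in the trace of the intersection. The second step forbids up to 2k vertices,
      whence \<open>N \<ge> 2 * k\<close>.\<close>
    have c1: "card (e0 - restr \<chi> e0 A) \<le> N" using GG[OF e0] N card_mono[of e0 "e0 - restr \<chi> e0 A"] by auto
    obtain e1 where e1: "e1 \<in> G" "restr \<chi> e0 A \<subseteq> e1" "e1 \<inter> (e0 - restr \<chi> e0 A) = {}"
      by (rule richD[OF hJ(2)[OF e0 AB(1)] _ c1]) (use GG[OF e0] in auto)
    have "card ((e0 \<union> e1) - restr \<chi> e0 B) \<le> card (e0 \<union> e1)" using GG[OF e0] GG[OF e1(1)] by (intro card_mono) auto
    also have "\<dots> \<le> N" using GG(2)[OF e0] GG(2)[OF e1(1)] card_Un_le[of e0 e1] N by linarith
    finally have c2: "card ((e0 \<union> e1) - restr \<chi> e0 B) \<le> N" .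
    obtain e2 where e2: "e2 \<in> G" "restr \<chi> e0 B \<subseteq> e2" "e2 \<inter> ((e0 \<union> e1) - restr \<chi> e0 B) = {}"
      by (rule richD[OF hJ(2)[OF e0 AB(2)] _ c2]) (use GG[OF e0] GG[OF e1(1)] in auto)
    have eq: "e1 \<inter> e2 = restr \<chi> e0 (A \<inter> B)"
    proof
      show "restr \<chi> e0 (A \<inter> B) \<subseteq> e1 \<inter> e2" using e1(2) e2(2) by (auto simp: restr_def)
      show "e1 \<inter> e2 \<subseteq> restr \<chi> e0 (A \<inter> B)"
      proof
        fix x assume x: "x \<in> e1 \<inter> e2"
        then have "x \<in> restr \<chi> e0 B" using e2(3) by blast
        moreover from this have "x \<in> restr \<chi> e0 A" using e1(3) x restr_subset[of \<chi> e0 B] by blast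
        ultimately show "x \<in> restr \<chi> e0 (A \<inter> B)" by (auto simp: restr_def)
      qed
    qed
    have imAB: "\<chi> ` (e1 \<inter> e2) = A \<inter> B" using eq im[OF e0, of "A \<inter> B"] AB' by auto
    have "e1 \<noteq> e2"
    proof
      assume "e1 = e2"
      then have "A \<inter> B = {..<k}" using imAB GG(4)[OF e1(1)] by simp
      then show False using AB by simp
    qed
    then show ?thesis using hJ(3)[OF e1(1) e2(1)] imAB by simp
  qed
  have cover: "\<exists>A\<in>J. W \<subseteq> A \<and> A \<noteq> {..<k}" if W: "W \<subseteq> {..<k}" "card W = k - 2" for W
  proof -
    \<comment> \<open>If no two edges agreed on the colours in \<open>W\<close>, an edge would be
      determined by k - 2 of its vertices, contradicting the size of \<open>G\<close>.\<close>
    have "\<not> inj_on (\<lambda>e. restr \<chi> e W) G"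
    proof
      assume inj: "inj_on (\<lambda>e. restr \<chi> e W) G"
      have "card (restr \<chi> e W) = k - 2" if "e \<in> G" for e
        using card_image[of \<chi> "restr \<chi> e W"] im[OF that W(1)] W(2) inj_on_subset[OF GG(3)[OF that] restr_subset] by simp
      then have "(\<lambda>e. restr \<chi> e W) ` G \<subseteq> {B. B \<subseteq> V \<and> card B = k - 2}"
        using G restr_subset[of \<chi>] by blast
      then have "card G \<le> card {B. B \<subseteq> V \<and> card B = k - 2}"
        using inj V by (intro card_inj_on_le[OF inj]) (auto simp: finite_uniform)
      also have "\<dots> \<le> card V ^ (k - 2)" using V by (simp add: n_subsets binomial_le_power)
      finally show False using big by simp
    qed
    then obtain e e' where e: "e \<in> G" "e' \<in> G" "e \<noteq> e'" "restr \<chi> e W = restr \<chi> e' W" unfolding inj_on_def by blast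
    have "W \<subseteq> \<chi> ` (e \<inter> e')"
    proof
      fix w assume "w \<in> W"
      then have "w \<in> \<chi> ` restr \<chi> e W" using im[OF e(1) W(1)] by simp
      then obtain x where "x \<in> restr \<chi> e W" "w = \<chi> x" by blast
      then show "w \<in> \<chi> ` (e \<inter> e')" using e(4) restr_subset[of \<chi> e W] restr_subset[of \<chi> e' W] by blast
    qed
    moreover have "\<chi> ` (e \<inter> e') \<noteq> {..<k}"
    proof
      assume a: "\<chi> ` (e \<inter> e') = {..<k}"
      have "card (\<chi> ` (e \<inter> e')) \<le> card (e \<inter> e')" using GG[OF e(1)] by (intro card_image_le) auto
      then have "k \<le> card (e \<inter> e')" using a by simp
      then have "e \<inter> e' = e" "e \<inter> e' = e'"
        using GG(1,2)[OF e(1)] GG(1,2)[OF e(2)] by (metis card_seteq inf_le1, metis card_seteq inf_le2)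
      then show False using e(3) by blast
    qed
    ultimately show ?thesis using hJ(3)[OF e(1-3)] by blast
  qed
  have "(\<exists>p q r. p < k \<and> q < k \<and> r < k \<and> p \<noteq> q \<and> q \<noteq> r \<and> p \<noteq> r \<and> {p, q} \<in> J \<and> {q, r} \<in> J \<and> {p, r} \<in> J) \<or>
    (\<exists>c<k. (\<forall>A. A \<subseteq> {..<k} \<longrightarrow> c \<in> A \<longrightarrow> A \<noteq> {..<k} \<longrightarrow> A \<in> J) \<and>
      (\<forall>p q. p < k \<longrightarrow> q < k \<longrightarrow> p \<noteq> q \<longrightarrow> p \<noteq> c \<longrightarrow> q \<noteq> c \<longrightarrow> {p, q} \<notin> J))"
    by (rule patterns_dichotomy[OF k hJ(1)]) (rule inter, assumption+, rule cover, assumption+)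
  then show ?thesis
  proof (elim disjE exE conjE)
    fix p q r
    assume tri: "p < k" "q < k" "r < k" "p \<noteq> q" "q \<noteq> r" "p \<noteq> r" "{p, q} \<in> J" "{q, r} \<in> J" "{p, r} \<in> J"
    define T where "T = {p, q, r}"
    have TJ: "{a, b} \<in> J" if "a \<in> T" "b \<in> T" "a \<noteq> b" for a b
      using that tri by (auto simp: T_def insert_commute)
    define P where "P x y \<longleftrightarrow> x \<noteq> y \<and> (\<exists>e\<in>G. x \<in> e \<and> y \<in> e \<and> \<chi> x \<in> T \<and> \<chi> y \<in> T)" for x y
    have Prich: "rich G N {x, y}" if Pxy: "P x y" for x y
    proof -
      obtain e where e: "x \<noteq> y" "e \<in> G" "x \<in> e" "y \<in> e" "\<chi> x \<in> T" "\<chi> y \<in> T" using Pxy by (auto simp: P_def)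
      have "\<chi> x \<noteq> \<chi> y" using GG(3)[OF e(2)] e by (auto dest: inj_onD)
      then have "{\<chi> x, \<chi> y} \<in> J" using TJ e by blast
      moreover have "restr \<chi> e {\<chi> x, \<chi> y} = {x, y}" using GG(3)[OF e(2)] e by (auto simp: restr_def dest: inj_onD)
      ultimately show ?thesis using hJ(2)[OF e(2), of "{\<chi> x, \<chi> y}"] by simp
    qed
    have "cycle_system k I l G"
    proof (rule cycles_of_triangles[OF I(1,2) _ _ I(3), where P = P])
      show "finite e \<and> card e = k" if "e \<in> G" for e using GG that by blast
      show "k \<ge> 1" using k by simp
      show "P y x" if "P x y" for x y using that by (auto simp: P_def)
      show "x \<noteq> y" if "P x y" for x y using that by (auto simp: P_def)
      show "rich G N {x, y}" if "P x y" for x y using Prich that .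
    next
      fix Z :: "'v set" and x y assume a: "P x y" "finite Z" "card Z \<le> N"
      then have xy: "x \<noteq> y" "\<chi> x \<in> T" "\<chi> y \<in> T" by (auto simp: P_def)
      have cZ: "card (Z - {x, y}) \<le> N" by (rule le_trans[OF card_mono[OF a(2)] a(3)]) blast
      obtain e where e: "e \<in> G" "{x, y} \<subseteq> e" "e \<inter> (Z - {x, y}) = {}"
        by (rule richD[OF Prich[OF a(1)] _ cZ]) (use a(2) in auto)
      obtain d where d: "d \<in> T" "d \<noteq> \<chi> x" "d \<noteq> \<chi> y" using tri(4-6) by (auto simp: T_def)
      then have "d \<in> \<chi> ` e" using GG(4)[OF e(1)] tri by (auto simp: T_def)
      then obtain z where z: "z \<in> e" "\<chi> z = d" by auto
      then have "z \<notin> Z" "z \<noteq> x" "z \<noteq> y" using e d by auto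
      then show "\<exists>z. z \<notin> Z \<and> P x z \<and> P z y" using z d e xy by (intro exI[of _ z]) (auto simp: P_def)
    next
      fix Z :: "'v set" assume Z: "finite Z" "card Z \<le> N"
      \<comment> \<open>The three pairs intersect in the empty pattern, so the empty set is rich and
        edges can avoid any N vertices.\<close>
      have kk: "{} \<noteq> {..<k}" "{q} \<noteq> {..<k}" using k tri by (auto simp: set_eq_iff)
      have i: "{p, q} \<inter> {q, r} = {q}" "{q} \<inter> {p, r} = {}" using tri by auto
      have "{q} \<in> J" using inter[OF tri(7,8)] kk(2) unfolding i(1) by blast
      from inter[OF this tri(9)] have "{} \<in> J" using kk(1) unfolding i(2) by blast
      then have "rich G N {}" using hJ(2)[OF e0, of "{}"] by (simp add: restr_def)
      from this Z obtain e where e: "e \<in> G" "e \<inter> Z = {}" by (rule richD) simp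
      have "p \<in> \<chi> ` e" "q \<in> \<chi> ` e" using GG(4)[OF e(1)] tri by auto
      then obtain x y where xy: "x \<in> e" "\<chi> x = p" "y \<in> e" "\<chi> y = q" by auto
      then have "P x y" unfolding P_def T_def using e(1) tri(4) by auto
      moreover have "x \<notin> Z" "y \<notin> Z" using e(2) xy by auto
      ultimately show "\<exists>x y. x \<notin> Z \<and> y \<notin> Z \<and> P x y" by blast
    qed
    then show ?thesis ..
  next
    fix c
    assume star: "c < k" "\<forall>A. A \<subseteq> {..<k} \<longrightarrow> c \<in> A \<longrightarrow> A \<noteq> {..<k} \<longrightarrow> A \<in> J"
      "\<forall>p q. p < k \<longrightarrow> q < k \<longrightarrow> p \<noteq> q \<longrightarrow> p \<noteq> c \<longrightarrow> q \<noteq> c \<longrightarrow> {p, q} \<notin> J"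
    have "z = z'" if a: "e \<in> G" "e' \<in> G" "x \<in> e \<inter> e'" "y \<in> e \<inter> e'" "x \<noteq> y" "\<chi> x \<noteq> c" "\<chi> y \<noteq> c"
      "z \<in> e" "z' \<in> e'" "\<chi> z = c" "\<chi> z' = c" for e e' x y z z'
    proof (cases "e = e'")
      case True
      then show ?thesis using GG(3)[OF a(1)] a by (auto dest: inj_onD)
    next
      case False
      have xk: "\<chi> x < k" "\<chi> y < k" using GG(4)[OF a(1)] a by auto
      have ne: "\<chi> x \<noteq> \<chi> y" using GG(3)[OF a(1)] a by (auto dest: inj_onD)
      have AJ: "\<chi> ` (e \<inter> e') \<in> J" by (rule hJ(3)[OF a(1,2) False])
      have "card {c, \<chi> x, \<chi> y} \<noteq> card {..<k}" using k card_insert_le_m1[of 3 "{\<chi> x, \<chi> y}" c] card_insert_le_m1[of 2 "{\<chi> y}" "\<chi> x"] by simp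
      then have "{c, \<chi> x, \<chi> y} \<noteq> {..<k}" by metis
      then have BJ: "{c, \<chi> x, \<chi> y} \<in> J" using star(2)[rule_format, of "{c, \<chi> x, \<chi> y}"] star(1) xk by simp
      \<comment> \<open>Otherwise intersecting with the pattern {c, \<chi> x, \<chi> y} makes
        {\<chi> x, \<chi> y} a pattern, which the star excludes.\<close>
      have "c \<in> \<chi> ` (e \<inter> e')"
      proof (rule ccontr)
        assume "c \<notin> \<chi> ` (e \<inter> e')"
        then have eq: "\<chi> ` (e \<inter> e') \<inter> {c, \<chi> x, \<chi> y} = {\<chi> x, \<chi> y}" using a by auto
        have "{\<chi> x, \<chi> y} \<noteq> {..<k}" using star(1) a(6,7) by (metis insertE lessThan_iff singletonD)
        then have "{\<chi> x, \<chi> y} \<in> J" using inter[OF AJ BJ] eq by simp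
        then show False using star(3) xk ne a(6,7) by blast
      qed
      then obtain w where "w \<in> e" "w \<in> e'" "\<chi> w = c" by auto
      then show ?thesis using GG(3)[OF a(1)] GG(3)[OF a(2)] a by (metis inj_onD)
    qed
    then show ?thesis using star(1) by blast
  qed
qed

lemma two_elements:
  assumes "card S \<ge> 2" obtains a b where "a \<in> S" "b \<in> S" "a \<noteq> b"
proof -
  obtain T where "T \<subseteq> S" "card T = 2" using assms by (meson obtain_subset_with_card_n)
  then show thesis using that by (auto simp: card_2_iff)
qed

text \<open>For v of colour \<open>c\<close> let \<open>Pi v\<close> be the ordered pairs of other
  vertices in common edges with v. By \<open>uniq\<close> these sets are disjoint, so their sizes
  add up to at most n^2. The degree of v is at most d, and also at most
  \<open>(card (Pi v))\<^sup>2\<close> times n^(k-5), since two pairs and k - 5 further vertices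
  determine an edge. The geometric mean of both bounds is linear in \<open>card (Pi v)\<close> and
  can be summed over v.\<close>

lemma star_bound:
  fixes G :: "'v set set"
  assumes V: "finite V" and G: "\<And>e. e \<in> G \<Longrightarrow> e \<subseteq> V \<and> card e = k \<and> bij_betw \<chi> e {..<k}" and k: "k \<ge> 5"
    and c: "c < k"
    and uniq: "\<And>e e' x y z z'. e \<in> G \<Longrightarrow> e' \<in> G \<Longrightarrow> x \<in> e \<inter> e' \<Longrightarrow> y \<in> e \<inter> e' \<Longrightarrow> x \<noteq> y \<Longrightarrow>
      \<chi> x \<noteq> c \<Longrightarrow> \<chi> y \<noteq> c \<Longrightarrow> z \<in> e \<Longrightarrow> z' \<in> e' \<Longrightarrow> \<chi> z = c \<Longrightarrow> \<chi> z' = c \<Longrightarrow> z = z'"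
    and d: "\<And>v. v \<in> V \<Longrightarrow> card {e \<in> G. v \<in> e} \<le> d"
  shows "(card G)\<^sup>2 \<le> d * card V ^ (k - 1)"
proof -
  define n where "n = card V"
  have fG: "finite G" using V G by (intro finite_subset[of G "Pow V"]) auto
  have GG: "e \<subseteq> V" "finite e" "card e = k" "inj_on \<chi> e" "\<chi> ` e = {..<k}" if "e \<in> G" for e
    using G[OF that] V finite_subset by (auto simp: bij_betw_def)
  have "card ({..<k} - {c}) \<ge> 2" using k c by simp
  then obtain p q where p: "p < k" "q < k" "p \<noteq> c" "q \<noteq> c" "p \<noteq> q" by (rule two_elements) auto
  have "card ({..<k} - {c, p, q}) = k - 3" using p c by (simp add: card_Diff_subset)
  then have "card ({..<k} - {c, p, q}) \<ge> 2" using k by simp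
  then obtain p' q' where p': "p' < k" "q' < k" "p' \<notin> {c, p, q}" "q' \<notin> {c, p, q}" "p' \<noteq> q'" by (rule two_elements) auto
  define R where "R = {..<k} - {c, p, q, p', q'}"
  have "card {c, p, q, p', q'} = 5" using p p' by (auto simp: card_insert_if)
  then have cR: "card R = k - 5" unfolding R_def using p p' c by (subst card_Diff_subset) auto
  define U where "U = {v \<in> V. \<chi> v = c \<and> (\<exists>e\<in>G. v \<in> e)}"
  define D where "D v = {e \<in> G. v \<in> e}" for v
  define Pi where "Pi v = {(x, y). x \<noteq> y \<and> \<chi> x \<noteq> c \<and> \<chi> y \<noteq> c \<and> (\<exists>e\<in>G. v \<in> e \<and> x \<in> e \<and> y \<in> e)}" for v
  have fU: "finite U" using V by (simp add: U_def)
  have PiV: "Pi v \<subseteq> V \<times> V" for v using GG(1) by (auto simp: Pi_def)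
  have fPi: "finite (Pi v)" for v using PiV V by (meson finite_SigmaI finite_subset)
  have "(\<Sum>v\<in>U. card (Pi v)) = card (\<Union>v\<in>U. Pi v)"
  proof (rule card_UN_disjoint[symmetric, OF fU])
    show "\<forall>v\<in>U. finite (Pi v)" using fPi by blast
    show "\<forall>v\<in>U. \<forall>w\<in>U. v \<noteq> w \<longrightarrow> Pi v \<inter> Pi w = {}"
    proof (intro ballI impI)
      fix v w assume vw: "v \<in> U" "w \<in> U" "v \<noteq> w"
      have False if xy: "(x, y) \<in> Pi v" "(x, y) \<in> Pi w" for x y
      proof -
        obtain e e' where "e \<in> G" "e' \<in> G" "x \<in> e \<inter> e'" "y \<in> e \<inter> e'" "x \<noteq> y" "\<chi> x \<noteq> c" "\<chi> y \<noteq> c" "v \<in> e" "w \<in> e'"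
          using xy by (auto simp: Pi_def)
        then have "v = w" using uniq[of e e' x y v w] vw by (auto simp: U_def)
        then show False using vw by simp
      qed
      then show "Pi v \<inter> Pi w = {}" by fast
    qed
  qed
  also have "\<dots> \<le> card (V \<times> V)" using PiV V by (intro card_mono) auto
  finally have sumPi: "(\<Sum>v\<in>U. card (Pi v)) \<le> n\<^sup>2" by (simp add: card_cartesian_product n_def power2_eq_square)
  have fv: "card (D v) \<le> (card (Pi v))\<^sup>2 * n ^ (k - 5)" if v: "v \<in> U" for v
  proof -
    define i where "i e a = inv_into e \<chi> a" for e a
    have i: "i e a \<in> e" "\<chi> (i e a) = a" if "e \<in> G" "a < k" for e a
      using that GG(5)[OF that(1)] by (auto simp: i_def intro!: inv_into_into f_inv_into_f)
    \<comment> \<open>Four vertices of fixed colours, grouped into two pairs, and the k - 5 vertices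
      with colours in \<open>R\<close>; together with \<open>v\<close> in colour \<open>c\<close>
      they make up the whole edge.\<close>
    define \<phi> where "\<phi> e = ((i e p, i e q), (i e p', i e q'), restr \<chi> e R)" for e
    have sub: "e \<subseteq> e'" if e: "e \<in> D v" "e' \<in> D v" "\<phi> e = \<phi> e'" for e e'
    proof
      fix x assume x: "x \<in> e"
      have eG: "e \<in> G" "e' \<in> G" "v \<in> e" "v \<in> e'" using e by (auto simp: D_def)
      have xk: "\<chi> x < k" using GG(5)[OF eG(1)] x by auto
      have xi: "x = i e (\<chi> x)" using inj_onD[OF GG(4)[OF eG(1)]] i[OF eG(1) xk] x by metis
      have eqs: "i e p = i e' p" "i e q = i e' q" "i e p' = i e' p'" "i e q' = i e' q'" "restr \<chi> e R = restr \<chi> e' R"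
        using e(3) by (simp_all add: \<phi>_def)
      consider "\<chi> x = c" | "\<chi> x \<in> {p, q, p', q'}" | "\<chi> x \<in> R" using xk by (auto simp: R_def)
      then show "x \<in> e'"
      proof cases
        case 1
        then have "x = v" using inj_onD[OF GG(4)[OF eG(1)]] x eG v by (auto simp: U_def)
        then show ?thesis using eG by simp
      next
        case 2
        then have "i e (\<chi> x) = i e' (\<chi> x)" using eqs by auto
        then show ?thesis using xi i(1)[OF eG(2) xk] by metis
      next
        case 3
        then have "x \<in> restr \<chi> e R" using x by (simp add: restr_def)
        then show ?thesis using eqs(5) restr_subset[of \<chi> e' R] by auto
      qed
    qed
    have "inj_on \<phi> (D v)"
    proof (rule inj_onI)
      fix e e' assume "e \<in> D v" "e' \<in> D v" "\<phi> e = \<phi> e'"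
      then show "e = e'" using sub[of e e'] sub[of e' e] by simp
    qed
    moreover have "\<phi> ` D v \<subseteq> Pi v \<times> Pi v \<times> {B. B \<subseteq> V \<and> card B = k - 5}"
    proof
      fix y assume "y \<in> \<phi> ` D v"
      then obtain e where e: "e \<in> D v" "y = \<phi> e" by blast
      then have eG: "e \<in> G" "v \<in> e" by (auto simp: D_def)
      have pr: "(i e a, i e b) \<in> Pi v" if "a < k" "b < k" "a \<noteq> b" "a \<noteq> c" "b \<noteq> c" for a b
      proof -
        have "i e a \<noteq> i e b" using i(2)[OF eG(1) that(1)] i(2)[OF eG(1) that(2)] that(3) by metis
        then show ?thesis using i[OF eG(1) that(1)] i[OF eG(1) that(2)] that eG unfolding Pi_def by auto
      qed
      have "\<chi> ` restr \<chi> e R = R"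
      proof
        show "R \<subseteq> \<chi> ` restr \<chi> e R"
        proof
          fix a assume a: "a \<in> R"
          then have "a \<in> \<chi> ` e" using GG(5)[OF eG(1)] by (simp add: R_def)
          then show "a \<in> \<chi> ` restr \<chi> e R" using a by (auto simp: restr_def)
        qed
      qed (auto simp: restr_def)
      then have "card (restr \<chi> e R) = k - 5"
        using card_image[OF inj_on_subset[OF GG(4)[OF eG(1)] restr_subset[of \<chi> e R]]] cR by simp
      moreover have "restr \<chi> e R \<subseteq> V" using GG(1)[OF eG(1)] restr_subset[of \<chi> e R] by blast
      ultimately show "y \<in> Pi v \<times> Pi v \<times> {B. B \<subseteq> V \<and> card B = k - 5}"
        unfolding e(2) \<phi>_def using pr[of p q] pr[of p' q'] p p' by simp
    qed
    ultimately have "card (D v) \<le> card (Pi v \<times> Pi v \<times> {B. B \<subseteq> V \<and> card B = k - 5})"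
      using fPi V by (intro card_inj_on_le[of \<phi>]) (auto simp: finite_uniform)
    also have "\<dots> = card (Pi v) * (card (Pi v) * (n choose (k - 5)))"
      using V by (simp add: card_cartesian_product n_subsets n_def)
    also have "\<dots> \<le> card (Pi v) * (card (Pi v) * n ^ (k - 5))"
      by (intro mult_le_mono2 binomial_le_power)
    finally show ?thesis by (simp add: power2_eq_square mult.assoc)
  qed
  \<comment> \<open>The geometric mean of the two degree bounds is
    \<open>r * card (Pi v)\<close>.\<close>
  define r where "r = sqrt (real d * real n ^ (k - 5))"
  have fr: "real (card (D v)) \<le> r * real (card (Pi v))" if v: "v \<in> U" for v
  proof (rule power2_le_imp_le)
    have "card (D v) \<le> d" using d[of v] v by (auto simp: D_def U_def)
    then have "card (D v) * card (D v) \<le> d * ((card (Pi v))\<^sup>2 * n ^ (k - 5))" using fv[OF v] by (rule mult_le_mono)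
    then have "real (card (D v) * card (D v)) \<le> real (d * ((card (Pi v))\<^sup>2 * n ^ (k - 5)))" by (simp only: of_nat_le_iff)
    then show "(real (card (D v)))\<^sup>2 \<le> (r * real (card (Pi v)))\<^sup>2"
      by (simp add: r_def power_mult_distrib power2_eq_square mult_ac)
  qed (simp add: r_def)
  have "G \<subseteq> (\<Union>v\<in>U. D v)"
  proof
    fix e assume e: "e \<in> G"
    then have "c \<in> \<chi> ` e" using GG(5) c by auto
    then obtain v where "v \<in> e" "\<chi> v = c" by auto
    then show "e \<in> (\<Union>v\<in>U. D v)" using e GG(1)[OF e] by (auto simp: U_def D_def)
  qed
  then have "card G \<le> card (\<Union>v\<in>U. D v)" using fU fG by (intro card_mono) (auto simp: D_def)
  also have "\<dots> \<le> (\<Sum>v\<in>U. card (D v))" by (rule card_UN_le[OF fU])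
  finally have "real (card G) \<le> (\<Sum>v\<in>U. real (card (D v)))" by (simp only: of_nat_sum[symmetric] of_nat_le_iff)
  also have "\<dots> \<le> (\<Sum>v\<in>U. r * real (card (Pi v)))" by (intro sum_mono fr)
  also have "\<dots> = r * real (\<Sum>v\<in>U. card (Pi v))" by (simp add: sum_distrib_left)
  also have "\<dots> \<le> r * real (n\<^sup>2)" by (intro mult_left_mono) (use sumPi in \<open>simp_all only: of_nat_le_iff r_def, simp\<close>)
  finally have "(real (card G))\<^sup>2 \<le> (r * real (n\<^sup>2))\<^sup>2" by (intro power_mono) auto
  also have "\<dots> = real d * (real n ^ (k - 5) * real n ^ 4)" by (simp add: r_def power_mult_distrib)
  also have "real n ^ (k - 5) * real n ^ 4 = real n ^ (k - 1)" using k by (simp add: power_add[symmetric])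
  finally have "real ((card G)\<^sup>2) \<le> real (d * n ^ (k - 1))" by simp
  then show ?thesis by (simp only: of_nat_le_iff n_def)
qed

text \<open>For d = \<delta> n^(k-1) the second alternative reads: at most C sqrt \<delta> n^(k-1)
  edges. So a dense family without the cycles has a vertex of high degree. \<open>C\<close>
  multiplies the losses of \<open>rainbow_colouring\<close> and
  \<open>homogeneous_subfamily\<close>.\<close>

lemma high_degree:
  fixes F :: "'v set set"
  assumes V: "finite V" and F: "\<And>e. e \<in> F \<Longrightarrow> e \<subseteq> V \<and> card e = k" and k: "k \<ge> 5" and N: "N \<ge> 2 * k"
    and I: "finite I" "\<And>i. i \<in> I \<Longrightarrow> l i \<ge> 3" "N \<ge> k * sum l I"
    and no: "\<not> cycle_system k I l F"
    and d: "\<And>v. v \<in> V \<Longrightarrow> card {e \<in> F. v \<in> e} \<le> d"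
    and C: "C = k ^ k * (2 ^ (k + 1) * N) ^ (2 ^ k)"
  shows "card F \<le> C * card V ^ (k - 2) \<or> (card F)\<^sup>2 \<le> C\<^sup>2 * (d * card V ^ (k - 1))"
proof -
  have fF: "finite F" using V F by (intro finite_subset[of F "Pow V"]) auto
  obtain \<chi> :: "'v \<Rightarrow> nat" where \<chi>: "card F \<le> k ^ k * card {e \<in> F. bij_betw \<chi> e {..<k}}"
    using rainbow_colouring[OF V F] k by fastforce
  define F1 where "F1 = {e \<in> F. bij_betw \<chi> e {..<k}}"
  have "\<exists>G J. G \<subseteq> F1 \<and> card F1 \<le> (2 ^ (k + 1) * N) ^ card (Pow {..<k} - {}) * card G \<and> homogeneous k \<chi> N G J"
    by (rule homogeneous_subfamily[OF refl]) (use fF k N in \<open>auto simp: F1_def\<close>)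
  then obtain G J where G: "G \<subseteq> F1" "card F1 \<le> (2 ^ (k + 1) * N) ^ (2 ^ k) * card G" "homogeneous k \<chi> N G J"
    by (auto simp: card_Pow)
  have GF: "G \<subseteq> F" using G(1) by (auto simp: F1_def)
  have GG: "e \<subseteq> V \<and> card e = k \<and> bij_betw \<chi> e {..<k}" if "e \<in> G" for e
    using that G(1) F[of e] unfolding F1_def by blast
  have "card F \<le> k ^ k * card F1" using \<chi> by (simp add: F1_def)
  also have "\<dots> \<le> k ^ k * ((2 ^ (k + 1) * N) ^ (2 ^ k) * card G)" using G(2) by (rule mult_le_mono2)
  finally have cF: "card F \<le> C * card G" by (simp add: C mult.assoc)
  show ?thesis
  proof (cases "card G > card V ^ (k - 2)")
    case False
    then have "C * card G \<le> C * card V ^ (k - 2)" by (intro mult_le_mono2) simp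
    then show ?thesis using cF by linarith
  next
    case True
    have "\<not> cycle_system k I l G" using no cycle_system_mono[OF _ GF] by blast
    then obtain c where c: "c < k" "\<forall>e\<in>G. \<forall>e'\<in>G. \<forall>x y z z'. x \<in> e \<inter> e' \<longrightarrow> y \<in> e \<inter> e' \<longrightarrow> x \<noteq> y \<longrightarrow>
        \<chi> x \<noteq> c \<longrightarrow> \<chi> y \<noteq> c \<longrightarrow> z \<in> e \<longrightarrow> z' \<in> e' \<longrightarrow> \<chi> z = c \<longrightarrow> \<chi> z' = c \<longrightarrow> z = z'"
      using homogeneous_dichotomy[OF V GG G(3) k N True I] by blast
    have "(card G)\<^sup>2 \<le> d * card V ^ (k - 1)"
    proof (rule star_bound[OF V GG k c(1)])
      fix v assume "v \<in> V"
      have "card {e \<in> G. v \<in> e} \<le> card {e \<in> F. v \<in> e}" using fF GF by (intro card_mono) auto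
      then show "card {e \<in> G. v \<in> e} \<le> d" using d[OF \<open>v \<in> V\<close>] by linarith
    next
      fix e e' x y z z'
      assume "e \<in> G" "e' \<in> G" "x \<in> e \<inter> e'" "y \<in> e \<inter> e'" "x \<noteq> y" "\<chi> x \<noteq> c" "\<chi> y \<noteq> c" "z \<in> e" "z' \<in> e'" "\<chi> z = c" "\<chi> z' = c"
      then show "z = z'" using c(2)[rule_format, of e e' x y z z'] by blast
    qed
    then have "(C * card G)\<^sup>2 \<le> C\<^sup>2 * (d * card V ^ (k - 1))" by (simp add: power_mult_distrib)
    moreover have "(card F)\<^sup>2 \<le> (C * card G)\<^sup>2" using cF by (rule power_mono) simp
    ultimately show ?thesis by linarith
  qed
qed

section \<open>Asymptotics of binomial coefficients\<close>

lemma binomial_fact_ge: "(m + 1 - r) ^ r \<le> fact r * (m choose r)"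
proof (induction r)
  case (Suc r)
  have "(m + 1 - Suc r) ^ Suc r = (m - r) * (m - r) ^ r" by simp
  also have "\<dots> \<le> (m - r) * (m + 1 - r) ^ r" by (intro mult_le_mono2 power_mono) auto
  also have "\<dots> \<le> (m - r) * (fact r * (m choose r))" using Suc by (rule mult_le_mono2)
  also have "\<dots> = fact r * ((m choose r) * (m - r))" by simp
  also have "(m choose r) * (m - r) = Suc r * (m choose Suc r)" by (metis binomial_absorb_comp binomial_absorption mult.commute)
  also have "fact r * (Suc r * (m choose Suc r)) = fact (Suc r) * (m choose Suc r)" by (simp add: algebra_simps)
  finally show ?case .
qed simp

lemma binomial_asymp: "(\<lambda>n. real ((n - j) choose r) / real n ^ r) \<longlonglongrightarrow> 1 / fact r"
proof (rule tendsto_sandwich)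
  have "(\<lambda>n. real (j + r) / real n) \<longlonglongrightarrow> 0" by (rule lim_const_over_n)
  then have "(\<lambda>n. 1 - real (j + r) / real n) \<longlonglongrightarrow> 1 - 0" by (intro tendsto_diff tendsto_const)
  then have "(\<lambda>n. (1 - real (j + r) / real n) ^ r / fact r) \<longlonglongrightarrow> (1 - 0) ^ r / fact r"
    by (intro tendsto_divide tendsto_power tendsto_const) auto
  then show "(\<lambda>n. (1 - real (j + r) / real n) ^ r / fact r) \<longlonglongrightarrow> 1 / fact r" by simp
  show "(\<lambda>n. 1 / fact r) \<longlonglongrightarrow> (1 / fact r :: real)" by simp
  show "\<forall>\<^sub>F n in sequentially. (1 - real (j + r) / real n) ^ r / fact r \<le> real ((n - j) choose r) / real n ^ r"
  proof (rule eventually_mono[OF eventually_ge_at_top[of "j + r + 1"]])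
    fix n assume n: "j + r + 1 \<le> n"
    have "1 - real (j + r) / real n = (real n - real (j + r)) / real n" using n by (simp add: field_simps)
    then have "(1 - real (j + r) / real n) ^ r = (real n - real (j + r)) ^ r / real n ^ r" by (simp add: power_divide)
    moreover have "(real n - real (j + r)) ^ r \<le> fact r * real ((n - j) choose r)"
    proof -
      have "(real n - real (j + r)) ^ r \<le> real ((n - j) + 1 - r) ^ r" using n by (intro power_mono) auto
      also have "\<dots> = real (((n - j) + 1 - r) ^ r)" by simp
      also have "\<dots> \<le> real (fact r * ((n - j) choose r))" by (simp only: of_nat_le_iff binomial_fact_ge)
      finally show ?thesis by simp
    qed
    ultimately show "(1 - real (j + r) / real n) ^ r / fact r \<le> real ((n - j) choose r) / real n ^ r"
      using n by (simp add: divide_simps mult_ac)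
  qed
  show "\<forall>\<^sub>F n in sequentially. real ((n - j) choose r) / real n ^ r \<le> 1 / fact r"
  proof (rule eventually_mono[OF eventually_ge_at_top[of 1]])
    fix n :: nat assume n: "1 \<le> n"
    have "((n - j) choose r) * fact r \<le> (n - j) ^ r" by (rule binomial_fact_pow)
    also have "\<dots> \<le> n ^ r" by (intro power_mono) auto
    finally have "real (((n - j) choose r) * fact r) \<le> real (n ^ r)" by (simp only: of_nat_le_iff)
    then show "real ((n - j) choose r) / real n ^ r \<le> 1 / fact r" using n by (simp add: divide_simps)
  qed
qed

lemma binomial_eventually_ge:
  assumes "a < 1 / fact r"
  shows "\<forall>\<^sub>F n in sequentially. a * real n ^ r \<le> real ((n - j) choose r)"
  using eventually_conj[OF order_tendstoD(1)[OF binomial_asymp[of j r] assms] eventually_gt_at_top[of 0]]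
  by (rule eventually_mono) (auto simp: field_simps less_imp_le)

lemma power_eventually_le:
  assumes "a > 0" "p < q"
  shows "\<forall>\<^sub>F n in sequentially. C * real n ^ p \<le> a * real n ^ q"
  using eventually_ge_at_top[of "nat \<lceil>max 1 (C / a)\<rceil>"]
proof (rule eventually_mono)
  fix n assume "nat \<lceil>max 1 (C / a)\<rceil> \<le> n"
  then have n: "real n \<ge> 1" "C / a \<le> real n" by linarith+
  then have "C \<le> a * real n" using assms by (simp add: field_simps)
  then have "C * real n ^ p \<le> a * real n * real n ^ p" by (intro mult_right_mono) auto
  also have "\<dots> = a * real n ^ Suc p" by simp
  also have "\<dots> \<le> a * real n ^ q" using assms n by (intro mult_left_mono power_increasing) auto
  finally show "C * real n ^ p \<le> a * real n ^ q" .
qed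

section \<open>Families without singleton intersections\<close>

text \<open>Read $q(x)$ as the elements that $x$ adds to a set containing $x$. The assumption says that no subset
  missing three elements of $e$ regrows to $e$.\<close>

lemma mutual_pair:
  assumes e: "finite e" "card e \<ge> 5"
    and q: "\<And>x. x \<in> e \<Longrightarrow> q x \<noteq> {} \<and> q x \<subseteq> e \<and> x \<notin> q x"
    and no: "\<And>u1 u2 u3 x1 x2 x3. x1 \<in> e \<Longrightarrow> x2 \<in> e \<Longrightarrow> x3 \<in> e \<Longrightarrow> u1 \<noteq> u2 \<Longrightarrow> u1 \<noteq> u3 \<Longrightarrow> u2 \<noteq> u3 \<Longrightarrow>
      x1 \<notin> {u1, u2, u3} \<Longrightarrow> x2 \<notin> {u2, u3} \<Longrightarrow> x3 \<noteq> u3 \<Longrightarrow> u1 \<in> q x1 \<Longrightarrow> u2 \<in> q x2 \<Longrightarrow> u3 \<in> q x3 \<Longrightarrow> False"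
  shows "\<exists>y\<in>e. \<exists>z\<in>e. y \<noteq> z \<and> q y = {z} \<and> q z = {y} \<and> (\<forall>w\<in>e. w \<noteq> y \<longrightarrow> w \<noteq> z \<longrightarrow> q w \<subseteq> {y, z})"
proof -
  define g where "g x = (SOME u. u \<in> q x)" for x
  have g: "g x \<in> q x" "g x \<in> e" "g x \<noteq> x" if "x \<in> e" for x
  proof -
    show "g x \<in> q x" using q[OF that] some_in_eq[of "q x"] by (simp add: g_def)
    then show "g x \<in> e" "g x \<noteq> x" using q[OF that] by auto
  qed
  have pick: "\<exists>x\<in>e. x \<notin> S" if "card S \<le> 4" "finite S" for S
  proof (rule ccontr)
    assume "\<not> ?thesis"
    then have "card e \<le> card S" using that(2) by (intro card_mono) auto
    then show False using that e by simp
  qed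
  \<comment> \<open>The selection g cannot be a permutation of e. A cycle of length at least four
    lets three successive elements be removed and regrown; a shorter one is combined with elements
    of other cycles, for which the five elements leave room.\<close>
  have "\<exists>w\<in>e. \<forall>x\<in>e. g x \<noteq> w"
  proof (rule ccontr)
    assume nl: "\<not> ?thesis"
    have "e \<subseteq> g ` e"
    proof
      fix w assume "w \<in> e"
      then obtain x where "x \<in> e" "g x = w" using nl by blast
      then show "w \<in> g ` e" by blast
    qed
    moreover have "g ` e \<subseteq> e" using g by auto
    ultimately have "g ` e = e" by blast
    then have inj: "inj_on g e" using e(1) by (simp add: eq_card_imp_inj_on)
    have gi: "g x = g y \<longleftrightarrow> x = y" if "x \<in> e" "y \<in> e" for x y using inj_on_eq_iff[OF inj that] .
    obtain x where x: "x \<in> e" using pick[of "{}"] by auto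
    define a where "a = g x"
    define b where "b = g a"
    have a: "a \<in> e" "a \<noteq> x" "b \<in> e" "b \<noteq> a" "a \<in> q x" "b \<in> q a" using g x by (auto simp: a_def b_def)
    show False
    proof (cases "b = x")
      case False
      define c where "c = g b"
      have c: "c \<in> e" "c \<noteq> b" "c \<in> q b" using g a by (auto simp: c_def)
      have ca: "c \<noteq> a" using gi[of b x] a x False by (auto simp: c_def a_def)
      show False
      proof (cases "c = x")
        case False
        then show False using no[of x a b a b c] x a c ca \<open>b \<noteq> x\<close> by auto
      next
        case True
        have "card {x, a, b} \<le> 4" by (simp add: card_insert_if)
        then obtain y where y: "y \<in> e" "y \<notin> {x, a, b}" using pick[of "{x, a, b}"] by auto
        have u: "g y \<noteq> x" "g y \<noteq> a" "g y \<noteq> b"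
          using gi[of y b] gi[of y x] gi[of y a] y x a True by (auto simp: a_def b_def c_def)
        show False using no[of x a y a b "g y"] x a y g[OF y(1)] u \<open>b \<noteq> x\<close> by auto
      qed
    next
      case True
      have "card {x, a} \<le> 4" by (simp add: card_insert_if)
      then obtain y where y: "y \<in> e" "y \<notin> {x, a}" using pick[of "{x, a}"] by auto
      define c where "c = g y"
      define d where "d = g c"
      have c: "c \<in> e" "c \<noteq> y" "c \<in> q y" "d \<in> e" "d \<noteq> c" "d \<in> q c" using g y by (auto simp: c_def d_def)
      have cx: "c \<noteq> x" "c \<noteq> a" using gi[of y a] gi[of y x] y x a True by (auto simp: a_def b_def c_def)
      have dx: "d \<noteq> x" "d \<noteq> a" using gi[of c a] gi[of c x] c x a True cx by (auto simp: a_def b_def d_def)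
      show False
      proof (cases "d = y")
        case False
        then show False using no[of x y c a c d] x a y c cx dx by auto
      next
        case True2: True
        have "card {x, a, y, c} \<le> 4" by (simp add: card_insert_if)
        then obtain w where w: "w \<in> e" "w \<notin> {x, a, y, c}" using pick[of "{x, a, y, c}"] by auto
        have v: "g w \<noteq> x" "g w \<noteq> a" "g w \<noteq> y" "g w \<noteq> c"
          using gi[of w a] gi[of w x] gi[of w c] gi[of w y] w x a y c True True2 by (auto simp: a_def b_def c_def d_def)
        show False using no[of x y w a c "g w"] x a y c cx w g[OF w(1)] v by auto
      qed
    qed
  qed
  \<comment> \<open>Not being an image, \<open>w\<close> is never among the removed elements, so
    regrowth can always start from it.\<close>
  then obtain w where w: "w \<in> e" "\<And>x. x \<in> e \<Longrightarrow> g x \<noteq> w" by blast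
  define y where "y = g w"
  define z where "z = g y"
  have yz: "y \<in> e" "z \<in> e" "y \<noteq> z" "y \<noteq> w" "z \<noteq> w" "y \<in> q w" "z \<in> q y"
  proof -
    show y: "y \<in> e" "y \<noteq> w" "y \<in> q w" using g[OF w(1)] by (auto simp: y_def)
    show "z \<in> e" "z \<in> q y" "y \<noteq> z" using g[OF y(1)] by (auto simp: z_def)
    show "z \<noteq> w" using w(2)[OF y(1)] by (simp add: z_def)
  qed
  have gz: "g z = y"
  proof (rule ccontr)
    assume "g z \<noteq> y"
    then show False using no[of w y z y z "g z"] yz w g[OF yz(2)] by auto
  qed
  have yz': "y \<in> q z" using gz g(1)[OF yz(2)] by simp
  have gx: "g x \<in> {y, z}" if "x \<in> e" "x \<noteq> y" "x \<noteq> z" for x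
  proof (rule ccontr)
    assume "g x \<notin> {y, z}"
    then show False using no[of w y x y z "g x"] yz w(1) w(2)[OF that(1)] g[OF that(1)] that by auto
  qed
  have ex: "\<exists>w\<in>e. w \<notin> {y, z, u}" for u
  proof -
    have "card {y, z, u} \<le> 4" by (simp add: card_insert_if)
    then show ?thesis using pick[of "{y, z, u}"] by simp
  qed
  have qy: "q y = {z}"
  proof (rule ccontr)
    assume "q y \<noteq> {z}"
    then obtain u where u: "u \<in> q y" "u \<noteq> z" using yz by blast
    then have uy: "u \<noteq> y" using q[OF yz(1)] by auto
    obtain v where v: "v \<in> e" "v \<notin> {y, z, u}" using ex by blast
    then have "g v = y \<or> g v = z" using gx[of v] by auto
    then show False
    proof
      assume "g v = y"
      then show False using no[of v y y y u z] v u uy yz g(1)[OF v(1)] by auto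
    next
      assume "g v = z"
      then show False using no[of v z y z y u] v u uy yz yz' g(1)[OF v(1)] by auto
    qed
  qed
  have qz: "q z = {y}"
  proof (rule ccontr)
    assume "q z \<noteq> {y}"
    then obtain u where u: "u \<in> q z" "u \<noteq> y" using yz' by blast
    then have uz: "u \<noteq> z" using q[OF yz(2)] by auto
    obtain v where v: "v \<in> e" "v \<notin> {y, z, u}" using ex by blast
    then have "g v = y \<or> g v = z" using gx[of v] by auto
    then show False
    proof
      assume "g v = y"
      then show False using no[of v y z y z u] v u uz yz g(1)[OF v(1)] by auto
    next
      assume "g v = z"
      then show False using no[of v z z z u y] v u uz yz yz' g(1)[OF v(1)] by auto
    qed
  qed
  have "q x \<subseteq> {y, z}" if x: "x \<in> e" "x \<noteq> y" "x \<noteq> z" for x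
  proof (rule ccontr)
    assume "\<not> ?thesis"
    then obtain u where u: "u \<in> q x" "u \<noteq> y" "u \<noteq> z" by blast
    then have ux: "u \<noteq> x" using q[OF x(1)] by auto
    have "g x = y \<or> g x = z" using gx[OF x] by auto
    then show False
    proof
      assume "g x = y"
      then show False using no[of x y x y z u] x u ux yz g(1)[OF x(1)] by auto
    next
      assume "g x = z"
      then show False using no[of x z x z y u] x u ux yz yz' g(1)[OF x(1)] by auto
    qed
  qed
  then show ?thesis using yz(1,2,3) qy qz by blast
qed

section \<open>Local covers and dominating pairs\<close>

lemma other_common_element:
  assumes "x \<in> e \<inter> e'" "card (e \<inter> e') \<noteq> 1" obtains y where "y \<in> e" "y \<in> e'" "y \<noteq> x"
proof -
  have "e \<inter> e' \<noteq> {x}" using assms(2) by auto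
  then show thesis using that assms(1) by blast
qed

text \<open>Suppose that the edges at x have no second vertex in common. As intersections are never
  singletons, an edge at x contains a vertex y of \<open>e0\<close> and a vertex z of an edge at x
  avoiding y. If {y, z} misses some edge at x, then an edge over x, y, z must meet that one in a
  fourth vertex, which leaves n^(k-4) choices. The remaining pairs form \<open>Q\<close>.\<close>

lemma local_covers:
  fixes F :: "'v set set"
  assumes V: "finite V" and F: "\<And>e. e \<in> F \<Longrightarrow> e \<subseteq> V \<and> card e = k"
    and sing: "\<And>e e'. e \<in> F \<Longrightarrow> e' \<in> F \<Longrightarrow> card (e \<inter> e') \<noteq> 1" and k: "k \<ge> 4"
  shows "\<exists>Q. finite Q \<and> card Q \<le> k\<^sup>2 \<and> (\<forall>q\<in>Q. q \<noteq> {} \<and> finite q \<and> card q \<le> 2 \<and> x \<notin> q \<and> (\<forall>e\<in>F. x \<in> e \<longrightarrow> q \<inter> e \<noteq> {})) \<and>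
    card {e \<in> F. x \<in> e \<and> (\<forall>q\<in>Q. \<not> q \<subseteq> e)} \<le> k ^ 3 * card V ^ (k - 4)"
proof -
  consider "\<forall>e\<in>F. x \<notin> e" | y where "y \<noteq> x" "\<forall>e\<in>F. x \<in> e \<longrightarrow> y \<in> e"
    | (big) e0 where "e0 \<in> F" "x \<in> e0" "\<forall>y. y \<noteq> x \<longrightarrow> (\<exists>e\<in>F. x \<in> e \<and> y \<notin> e)" by blast
  then show ?thesis
  proof cases
    case 1
    then have "{e \<in> F. x \<in> e \<and> (\<forall>q\<in>{}. \<not> q \<subseteq> e)} = {}" by auto
    then show ?thesis by (intro exI[of _ "{}"]) (simp only: card.empty, simp)
  next
    case (2 y)
    then have "{e \<in> F. x \<in> e \<and> (\<forall>q\<in>{{y}}. \<not> q \<subseteq> e)} = {}" by auto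
    moreover have "card {{y}} \<le> k\<^sup>2" using k by simp
    ultimately show ?thesis using 2 by (intro exI[of _ "{{y}}"] conjI) (simp_all only: card.empty, auto)
  next
    case big
    have fe: "finite e" "card e = k" if "e \<in> F" for e using F[OF that] V finite_subset by auto
    obtain h where h: "\<And>y. y \<noteq> x \<Longrightarrow> h y \<in> F" "\<And>y. y \<noteq> x \<Longrightarrow> x \<in> h y" "\<And>y. y \<noteq> x \<Longrightarrow> y \<notin> h y" using big(3) by metis
    define S where "S = (SIGMA y:e0 - {x}. h y - {x})"
    have fS: "finite S" using fe[OF big(1)] fe(1)[OF h(1)] by (auto simp: S_def)
    have "card S = (\<Sum>y\<in>e0 - {x}. card (h y - {x}))" unfolding S_def using fe[OF big(1)] fe(1)[OF h(1)] by (subst card_SigmaI) auto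
    also have "\<dots> \<le> (\<Sum>y\<in>e0 - {x}. k)" using fe[OF h(1)] card_Diff1_le[of _ x] by (intro sum_mono) (metis DiffD2 singletonI)
    also have "\<dots> \<le> k * k" using fe[OF big(1)] card_Diff1_le[of e0 x] by simp
    finally have cS: "card S \<le> k\<^sup>2" by (simp add: power2_eq_square)
    define R where "R = (\<lambda>(y, z). {y, z}) ` S"
    have fR: "finite R" "card R \<le> k\<^sup>2" using fS cS card_image_le[OF fS, of "\<lambda>(y, z). {y, z}"] by (auto simp: R_def)
    have Rq: "card q = 2" "x \<notin> q" "finite q" "q \<noteq> {}" if q: "q \<in> R" for q
    proof -
      obtain y z where yz: "y \<in> e0 - {x}" "z \<in> h y - {x}" "q = {y, z}" using q by (auto simp: R_def S_def)
      then have "y \<noteq> z" using h(3)[of y] by auto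
      then show "card q = 2" "x \<notin> q" "finite q" "q \<noteq> {}" using yz by auto
    qed
    have Rcov: "\<exists>q\<in>R. q \<subseteq> e" if e: "e \<in> F" "x \<in> e" for e
    proof -
      obtain y where y: "y \<in> e" "y \<in> e0" "y \<noteq> x" using other_common_element[of x e e0] sing[OF e(1) big(1)] e big(2) by blast
      obtain z where z: "z \<in> e" "z \<in> h y" "z \<noteq> x" using other_common_element[of x e "h y"] sing[OF e(1) h(1)[OF y(3)]] e h(2)[OF y(3)] by blast
      have "(y, z) \<in> S" using y z by (simp add: S_def)
      then have "{y, z} \<in> R" by (auto simp: R_def)
      then show ?thesis using y z by (intro bexI[of _ "{y, z}"]) auto
    qed
    define Q where "Q = {q \<in> R. \<forall>e\<in>F. x \<in> e \<longrightarrow> q \<inter> e \<noteq> {}}"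
    have cQ: "finite Q" "card Q \<le> k\<^sup>2" using fR card_mono[OF fR(1), of Q] by (auto simp: Q_def)
    have "\<forall>q\<in>R - Q. \<exists>e\<in>F. x \<in> e \<and> q \<inter> e = {}" by (auto simp: Q_def)
    then obtain m where m: "\<forall>q\<in>R - Q. m q \<in> F \<and> x \<in> m q \<and> q \<inter> m q = {}" by (metis bchoice)
    define X where "X q u = {e. e \<subseteq> V \<and> card e = k \<and> insert x (insert u q) \<subseteq> e}" for q u
    have "{e \<in> F. x \<in> e \<and> (\<forall>q\<in>Q. \<not> q \<subseteq> e)} \<subseteq> (\<Union>q\<in>R - Q. \<Union>u\<in>m q - {x}. X q u)"
    proof
      fix e assume "e \<in> {e \<in> F. x \<in> e \<and> (\<forall>q\<in>Q. \<not> q \<subseteq> e)}"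
      then have e: "e \<in> F" "x \<in> e" "\<forall>q\<in>Q. \<not> q \<subseteq> e" by auto
      obtain q where q: "q \<in> R" "q \<subseteq> e" using Rcov[OF e(1,2)] by blast
      then have q': "q \<in> R - Q" using e(3) by blast
      then have mq: "m q \<in> F" "x \<in> m q" using m by auto
      obtain u where u: "u \<in> e" "u \<in> m q" "u \<noteq> x" using other_common_element[of x e "m q"] sing[OF e(1) mq(1)] e mq by blast
      then have "e \<in> X q u" using F[OF e(1)] e q by (auto simp: X_def)
      then show "e \<in> (\<Union>q\<in>R - Q. \<Union>u\<in>m q - {x}. X q u)" using q' u by blast
    qed
    moreover have Xle: "card (X q u) \<le> card V ^ (k - 4)" if "q \<in> R - Q" "u \<in> m q - {x}" for q u
    proof -
      have "u \<notin> q" using m that by auto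
      have qR: "q \<in> R" using that by simp
      have "card (insert u q) = 3" using Rq[OF qR] \<open>u \<notin> q\<close> by (subst card_insert_disjoint) auto
      moreover have "x \<notin> insert u q" using Rq[OF qR] that by auto
      ultimately have "card (insert x (insert u q)) = 4" using Rq[OF qR] by (subst card_insert_disjoint) auto
      then show ?thesis using card_supersets_le[OF V, of "insert x (insert u q)" k] k by (simp add: X_def)
    qed
    moreover have fX: "finite (X q u)" for q u using V by (simp add: X_def finite_uniform)
    moreover have fm: "finite (m q)" "card (m q) = k" if "q \<in> R - Q" for q using m fe that by auto
    ultimately have "card {e \<in> F. x \<in> e \<and> (\<forall>q\<in>Q. \<not> q \<subseteq> e)} \<le> card (\<Union>q\<in>R - Q. \<Union>u\<in>m q - {x}. X q u)"
      using fR(1) by (intro card_mono) auto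
    also have "\<dots> \<le> (\<Sum>q\<in>R - Q. card (\<Union>u\<in>m q - {x}. X q u))" using fR(1) by (intro card_UN_le) auto
    also have "\<dots> \<le> (\<Sum>q\<in>R - Q. k * card V ^ (k - 4))"
    proof (rule sum_mono)
      fix q assume q: "q \<in> R - Q"
      have "card (\<Union>u\<in>m q - {x}. X q u) \<le> (\<Sum>u\<in>m q - {x}. card (X q u))" using fm[OF q] by (intro card_UN_le) auto
      also have "\<dots> \<le> (\<Sum>u\<in>m q - {x}. card V ^ (k - 4))" using Xle[OF q] by (intro sum_mono) auto
      also have "\<dots> \<le> k * card V ^ (k - 4)" using fm[OF q] card_Diff1_le[of "m q" x] by simp
      finally show "card (\<Union>u\<in>m q - {x}. X q u) \<le> k * card V ^ (k - 4)" .
    qed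
    also have "\<dots> \<le> k\<^sup>2 * (k * card V ^ (k - 4))" using fR card_mono[OF fR(1), of "R - Q"] by simp
    also have "\<dots> = k ^ 3 * card V ^ (k - 4)" by (simp add: power2_eq_square power3_eq_cube)
    finally have "card {e \<in> F. x \<in> e \<and> (\<forall>q\<in>Q. \<not> q \<subseteq> e)} \<le> k ^ 3 * card V ^ (k - 4)" .
    moreover have "\<forall>q\<in>Q. q \<noteq> {} \<and> finite q \<and> card q \<le> 2 \<and> x \<notin> q \<and> (\<forall>e\<in>F. x \<in> e \<longrightarrow> q \<inter> e \<noteq> {})"
      using Rq by (fastforce simp: Q_def)
    ultimately show ?thesis using cQ by blast
  qed
qed

text \<open>In the extremal family, all k-sets over a fixed pair, that pair dominates every
  edge.\<close>

definition dominating_pair :: "'v set set \<Rightarrow> 'v set \<Rightarrow> 'v set \<Rightarrow> bool" where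
  "dominating_pair F e P \<longleftrightarrow> card P = 2 \<and> P \<subseteq> e \<and> (\<forall>e'\<in>F. e' \<inter> e \<noteq> {} \<longrightarrow> P \<subseteq> e')"

definition dominated :: "'v set set \<Rightarrow> 'v set set" where
  "dominated F = {e \<in> F. \<exists>P. dominating_pair F e P}"

text \<open>The first summand comes from the exceptional edges of \<open>local_covers\<close>, the
  second from three regrowth steps with at most (k + 2)^3 choices each.\<close>

definition singleton_free_const :: "nat \<Rightarrow> nat" where
  "singleton_free_const k = k ^ 3 + ((k + 2) ^ 3) ^ 3"

text \<open>Let every vertex x of e have a cover \<open>q x\<close> inside e. Either e regrows from
  k - 3 of its vertices, which happens for O(n^(k-3)) edges, or \<open>mutual_pair\<close> gives y
  and z that are the covers of each other. Every edge meeting e then contains y or z, and hence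
  both.\<close>

lemma card_not_dominated:
  fixes F :: "'v set set"
  assumes V: "finite V" and F: "\<And>e. e \<in> F \<Longrightarrow> e \<subseteq> V \<and> card e = k"
    and sing: "\<And>e e'. e \<in> F \<Longrightarrow> e' \<in> F \<Longrightarrow> card (e \<inter> e') \<noteq> 1" and k: "k \<ge> 5"
  shows "card (F - dominated F) \<le> singleton_free_const k * card V ^ (k - 3)"
proof -
  define n where "n = card V"
  have fF: "finite F" using V F by (intro finite_subset[of F "Pow V"]) auto
  have fe: "finite e" "card e = k" "e \<subseteq> V" if "e \<in> F" for e using F[OF that] V finite_subset by auto
  define good where "good x Q \<longleftrightarrow> finite Q \<and> card Q \<le> k\<^sup>2 \<and> (\<forall>q\<in>Q. q \<noteq> {} \<and> finite q \<and> card q \<le> 2 \<and> x \<notin> q \<and> (\<forall>e\<in>F. x \<in> e \<longrightarrow> q \<inter> e \<noteq> {})) \<and>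
    card {e \<in> F. x \<in> e \<and> (\<forall>q\<in>Q. \<not> q \<subseteq> e)} \<le> k ^ 3 * n ^ (k - 4)" for x Q
  have "\<exists>Q. good x Q" for x
    unfolding good_def n_def by (rule local_covers[OF V F sing]) (use k in auto)
  then obtain Q where Q: "\<And>x. good x (Q x)" by metis
  have Q1: "finite (Q x)" "card (Q x) \<le> k\<^sup>2" "card {e \<in> F. x \<in> e \<and> (\<forall>q\<in>Q x. \<not> q \<subseteq> e)} \<le> k ^ 3 * n ^ (k - 4)" for x
    using Q[of x] by (auto simp: good_def)
  have Q2: "q \<noteq> {}" "finite q" "card q \<le> 2" "x \<notin> q" "\<And>e. e \<in> F \<Longrightarrow> x \<in> e \<Longrightarrow> q \<inter> e \<noteq> {}" if "q \<in> Q x" for x q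
    using Q[of x] that by (auto simp: good_def)
  define bad where "bad = (\<Union>x\<in>V. {e \<in> F. x \<in> e \<and> (\<forall>q\<in>Q x. \<not> q \<subseteq> e)})"
  have "card bad \<le> (\<Sum>x\<in>V. card {e \<in> F. x \<in> e \<and> (\<forall>q\<in>Q x. \<not> q \<subseteq> e)})" unfolding bad_def by (rule card_UN_le[OF V])
  also have "\<dots> \<le> (\<Sum>x\<in>V. k ^ 3 * n ^ (k - 4))" by (intro sum_mono Q1)
  also have "\<dots> = k ^ 3 * (n * n ^ (k - 4))" by (simp add: n_def)
  also have "n * n ^ (k - 4) = n ^ Suc (k - 4)" by simp
  also have "Suc (k - 4) = k - 3" using k by simp
  finally have cbad: "card bad \<le> k ^ 3 * n ^ (k - 3)" .
  \<comment> \<open>One regrowth step adds a cover of one element. Covers have at most two elements,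
    so the sizes start from k - 3, k - 1 and at most k + 1; with at most k^2 covers per element a
    step has at most (k + 2)^3 results.\<close>
  define step where "step S = (\<lambda>(x, q). S \<union> q) ` (SIGMA x:S. Q x)" for S
  define M where "M = (k + 2) ^ 3"
  have step: "finite (step S)" "card (step S) \<le> M" if "finite S" "card S \<le> k + 2" for S
  proof -
    have "finite (SIGMA x:S. Q x)" using that Q1 by auto
    then show "finite (step S)" by (simp add: step_def)
    have "card (step S) \<le> card (SIGMA x:S. Q x)" unfolding step_def using that Q1 by (intro card_image_le) auto
    also have "\<dots> = (\<Sum>x\<in>S. card (Q x))" using that Q1 by simp
    also have "\<dots> \<le> (\<Sum>x\<in>S. k\<^sup>2)" by (intro sum_mono Q1)
    also have "\<dots> = card S * k\<^sup>2" by simp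
    also have "\<dots> \<le> (k + 2) * (k + 2)\<^sup>2" using that(2) by (intro mult_le_mono power_mono) auto
    also have "\<dots> = M" by (simp only: M_def power2_eq_square power3_eq_cube mult.assoc)
    finally show "card (step S) \<le> M" .
  qed
  have step_size: "finite S' \<and> card S' \<le> card S + 2" if S': "S' \<in> step S" "finite S" for S S'
  proof -
    obtain x q where x: "x \<in> S" "q \<in> Q x" "S' = S \<union> q" using S'(1) by (auto simp: step_def)
    then show ?thesis using Q2(2,3)[OF x(2)] S'(2) card_Un_le[of S q] by auto
  qed
  define reach where "reach S = (\<Union>S1\<in>step S. \<Union>S2\<in>step S1. step S2)" for S
  have cUN: "finite (\<Union>x\<in>A. f x) \<and> card (\<Union>x\<in>A. f x) \<le> a * b"
    if "finite A" "card A \<le> a" "\<And>x. x \<in> A \<Longrightarrow> finite (f x) \<and> card (f x) \<le> b" for A a b and f :: "'z \<Rightarrow> 'u set"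
  proof -
    have "card (\<Union>x\<in>A. f x) \<le> (\<Sum>x\<in>A. card (f x))" by (rule card_UN_le[OF that(1)])
    also have "\<dots> \<le> (\<Sum>x\<in>A. b)" using that(3) by (intro sum_mono) auto
    also have "\<dots> \<le> a * b" using that(2) by simp
    finally show ?thesis using that by auto
  qed
  have reach: "finite (reach S) \<and> card (reach S) \<le> M * (M * M)" if S: "finite S" "card S = k - 3" for S
    unfolding reach_def
  proof (rule cUN)
    show "finite (step S)" "card (step S) \<le> M" using step[of S] S by auto
    fix S1 assume S1: "S1 \<in> step S"
    have s1: "finite S1" "card S1 \<le> k - 1" using step_size[OF S1 S(1)] S k by auto
    show "finite (\<Union>S2\<in>step S1. step S2) \<and> card (\<Union>S2\<in>step S1. step S2) \<le> M * M"
    proof (rule cUN)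
      show "finite (step S1)" "card (step S1) \<le> M" using step[of S1] s1 by auto
      fix S2 assume S2: "S2 \<in> step S1"
      have "finite S2" "card S2 \<le> k + 1" using step_size[OF S2 s1(1)] s1 k by auto
      then show "finite (step S2) \<and> card (step S2) \<le> M" using step[of S2] by auto
    qed
  qed
  define gen where "gen = (\<Union>S\<in>{B. B \<subseteq> V \<and> card B = k - 3}. reach S)"
  have "finite gen \<and> card gen \<le> n ^ (k - 3) * (M * (M * M))"
    unfolding gen_def
  proof (rule cUN)
    show "finite {B. B \<subseteq> V \<and> card B = k - 3}" using V by (rule finite_uniform)
    show "card {B. B \<subseteq> V \<and> card B = k - 3} \<le> n ^ (k - 3)" using V by (simp add: n_subsets binomial_le_power n_def)
    fix S assume "S \<in> {B. B \<subseteq> V \<and> card B = k - 3}"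
    then show "finite (reach S) \<and> card (reach S) \<le> M * (M * M)" using reach[of S] V finite_subset by auto
  qed
  then have cgen: "finite gen" "card gen \<le> n ^ (k - 3) * (M * (M * M))" by auto
  have "F - dominated F \<subseteq> bad \<union> gen"
  proof
    fix e assume "e \<in> F - dominated F"
    then have e: "e \<in> F" "\<not> (\<exists>P. dominating_pair F e P)" by (auto simp: dominated_def)
    show "e \<in> bad \<union> gen"
    proof (rule ccontr)
      assume n: "e \<notin> bad \<union> gen"
      have "\<exists>q\<in>Q x. q \<subseteq> e" if "x \<in> e" for x
      proof (rule ccontr)
        assume "\<not> ?thesis"
        then have "e \<in> bad" using that e fe[OF e(1)] by (auto simp: bad_def)
        then show False using n by simp
      qed
      then have "\<forall>x\<in>e. \<exists>q. q \<in> Q x \<and> q \<subseteq> e" by blast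
      from bchoice[OF this] obtain q where q: "\<forall>x\<in>e. q x \<in> Q x \<and> q x \<subseteq> e" by (elim exE)
      have no: False if u: "x1 \<in> e" "x2 \<in> e" "x3 \<in> e" "u1 \<noteq> u2" "u1 \<noteq> u3" "u2 \<noteq> u3"
        "x1 \<notin> {u1, u2, u3}" "x2 \<notin> {u2, u3}" "x3 \<noteq> u3" "u1 \<in> q x1" "u2 \<in> q x2" "u3 \<in> q x3" for u1 u2 u3 x1 x2 x3
      proof -
        have qe: "q x1 \<subseteq> e" "q x2 \<subseteq> e" "q x3 \<subseteq> e" "q x1 \<in> Q x1" "q x2 \<in> Q x2" "q x3 \<in> Q x3" using q u by auto
        then have ue: "u1 \<in> e" "u2 \<in> e" "u3 \<in> e" using u by auto
        define S where "S = e - {u1, u2, u3}"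
        have "card {u1, u2, u3} = 3" using u by simp
        then have "card S = k - 3" unfolding S_def using fe[OF e(1)] ue by (subst card_Diff_subset) auto
        moreover have "S \<subseteq> V" using fe[OF e(1)] by (auto simp: S_def)
        moreover have "e \<in> reach S"
        proof -
          have "S \<union> q x1 \<in> step S" unfolding step_def using u qe by (intro image_eqI[of _ _ "(x1, q x1)"]) (auto simp: S_def)
          moreover have "(S \<union> q x1) \<union> q x2 \<in> step (S \<union> q x1)" unfolding step_def using u qe by (intro image_eqI[of _ _ "(x2, q x2)"]) (auto simp: S_def)
          moreover have "((S \<union> q x1) \<union> q x2) \<union> q x3 \<in> step ((S \<union> q x1) \<union> q x2)"
            unfolding step_def using u qe by (intro image_eqI[of _ _ "(x3, q x3)"]) (auto simp: S_def)
          moreover have "((S \<union> q x1) \<union> q x2) \<union> q x3 = e" using qe u by (auto simp: S_def)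
          ultimately show ?thesis unfolding reach_def by auto
        qed
        ultimately have "e \<in> gen" by (auto simp: gen_def)
        then show False using n by simp
      qed
      have qq: "q x \<noteq> {} \<and> q x \<subseteq> e \<and> x \<notin> q x" if "x \<in> e" for x using q Q2(1,4)[of "q x" x] that by blast
      have ce: "finite e" "card e \<ge> 5" using fe[OF e(1)] k by auto
      have "\<exists>y\<in>e. \<exists>z\<in>e. y \<noteq> z \<and> q y = {z} \<and> q z = {y} \<and> (\<forall>w\<in>e. w \<noteq> y \<longrightarrow> w \<noteq> z \<longrightarrow> q w \<subseteq> {y, z})"
        by (rule mutual_pair[OF ce, of q], fact qq, fact no)
      then obtain y z where yz: "y \<in> e" "z \<in> e" "y \<noteq> z" "q y = {z}" "q z = {y}"
        and rest: "\<forall>w\<in>e. w \<noteq> y \<longrightarrow> w \<noteq> z \<longrightarrow> q w \<subseteq> {y, z}"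
        by (elim bexE conjE)
      have cov: "q x \<inter> e' \<noteq> {}" if "x \<in> e" "e' \<in> F" "x \<in> e'" for x e'
        using q Q2(5)[of "q x" x e'] that by blast
      have yz': "y \<in> e' \<longleftrightarrow> z \<in> e'" if "e' \<in> F" for e' using cov[of y e'] cov[of z e'] yz that by auto
      have "{y, z} \<subseteq> e'" if e': "e' \<in> F" "e' \<inter> e \<noteq> {}" for e'
      proof -
        obtain w where w: "w \<in> e" "w \<in> e'" using e'(2) by blast
        show ?thesis
        proof (cases "w = y \<or> w = z")
          case True
          then show ?thesis using w yz'[OF e'(1)] by auto
        next
          case False
          then have "q w \<subseteq> {y, z}" using rest w by simp
          then show ?thesis using cov[OF w(1) e'(1) w(2)] yz'[OF e'(1)] by blast
        qed
      qed
      then have "dominating_pair F e {y, z}" using yz by (auto simp: dominating_pair_def)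
      then show False using e(2) by blast
    qed
  qed
  moreover have "finite bad" using V fF by (auto simp: bad_def)
  ultimately have "card (F - dominated F) \<le> card (bad \<union> gen)" using cgen(1) by (intro card_mono) auto
  also have "\<dots> \<le> card bad + card gen" by (rule card_Un_le)
  also have "\<dots> \<le> k ^ 3 * n ^ (k - 3) + n ^ (k - 3) * (M * (M * M))" using cbad cgen(2) by linarith
  also have "\<dots> = singleton_free_const k * n ^ (k - 3)"
  proof -
    have c: "singleton_free_const k = k ^ 3 + M * (M * M)"
      unfolding singleton_free_const_def M_def[symmetric] by (simp only: power3_eq_cube[of M] mult.assoc)
    show ?thesis unfolding c by (simp only: add_mult_distrib mult.commute[of "n ^ (k - 3)"])
  qed
  finally show ?thesis by (simp add: n_def)
qed

lemma dominating_pairs_intersect: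
  assumes "dominating_pair F e P" "dominating_pair F e' P'" "e \<in> F" "e' \<in> F" "e \<inter> e' \<noteq> {}" "f \<in> F" "f \<inter> e' \<noteq> {}"
  shows "f \<inter> e \<noteq> {}"
proof -
  have "P' \<subseteq> f" "P' \<subseteq> e" "P' \<noteq> {}" using assms by (auto simp: dominating_pair_def Int_commute)
  then show ?thesis by blast
qed

text \<open>Meeting is an equivalence relation on dominated edges, and all edges of a class contain a common
  pair; the count follows by choosing that pair consistently.\<close>

lemma card_dominated:
  fixes F :: "'v set set"
  assumes V: "finite V" and F: "\<And>e. e \<in> F \<Longrightarrow> e \<subseteq> V \<and> card e = k" and k: "k \<ge> 3"
    and m: "\<And>e. e \<in> dominated F \<Longrightarrow> card (\<Union> {e' \<in> dominated F. e' \<inter> e \<noteq> {}}) \<le> m"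
  shows "(k - 2) * card (dominated F) \<le> card V * (m choose (k - 3))"
proof -
  define D where "D = dominated F"
  have fF: "finite F" using V F by (intro finite_subset[of F "Pow V"]) auto
  have DF: "D \<subseteq> F" by (auto simp: D_def dominated_def)
  have fD: "finite D" using DF fF finite_subset by blast
  have fe: "finite e" "card e = k" "e \<subseteq> V" "e \<noteq> {}" if e: "e \<in> D" for e
  proof -
    have "e \<in> F" using e DF by auto
    then have "e \<subseteq> V" "card e = k" using F by auto
    then show "finite e" "card e = k" "e \<subseteq> V" "e \<noteq> {}" using V finite_subset[of e V] k by auto
  qed
  define cl where "cl e = {e' \<in> D. e' \<inter> e \<noteq> {}}" for e
  \<comment> \<open>The choice depends on \<open>e\<close> only through its class
    \<open>cl e\<close>, so edges that meet get the same pair.\<close>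
  define P where "P e = (SOME P. \<exists>r\<in>cl e. dominating_pair F r P)" for e
  have cl_eq: "cl e = cl e'" if e: "e \<in> D" "e' \<in> D" "e \<inter> e' \<noteq> {}" for e e'
  proof -
    obtain Q Q' where Q: "dominating_pair F e Q" "dominating_pair F e' Q'" using e by (auto simp: D_def dominated_def)
    have eF: "e \<in> F" "e' \<in> F" "e' \<inter> e \<noteq> {}" using e DF by auto
    show ?thesis
      unfolding cl_def using dominating_pairs_intersect[OF Q eF(1,2) e(3)] dominating_pairs_intersect[OF Q(2,1) eF(2,1,3)] DF by blast
  qed
  have P: "card (P e) = 2 \<and> P e \<subseteq> e" if e: "e \<in> D" for e
  proof -
    obtain Q where "dominating_pair F e Q" using e by (auto simp: D_def dominated_def)
    then have "\<exists>P. \<exists>r\<in>cl e. dominating_pair F r P" using e fe(4)[OF e] by (auto simp: cl_def)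
    then have "\<exists>r\<in>cl e. dominating_pair F r (P e)" unfolding P_def by (rule someI_ex)
    then obtain r where r: "r \<in> D" "r \<inter> e \<noteq> {}" "dominating_pair F r (P e)" by (auto simp: cl_def)
    then show ?thesis using e DF by (auto simp: dominating_pair_def Int_commute)
  qed
  \<comment> \<open>The edges in question all contain \<open>x\<close>, hence lie in one class; they
    contain its pair and \<open>x\<close> as a third vertex, and stay inside a set of at most m
    vertices.\<close>
  have per: "card {e \<in> D. x \<in> e - P e} \<le> m choose (k - 3)" for x
  proof (cases "{e \<in> D. x \<in> e - P e} = {}")
    case True
    then show ?thesis by (simp only: card.empty)
  next
    case False
    then obtain e1 where e1: "e1 \<in> D" "x \<in> e1" "x \<notin> P e1" by auto
    define W where "W = \<Union> (cl e1)"
    have "W \<subseteq> V" using fe(3) by (auto simp: W_def cl_def)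
    then have fW: "finite W" using V finite_subset by blast
    have cW: "card W \<le> m" using m[of e1] e1 by (simp add: W_def cl_def D_def)
    have P1: "card (P e1) = 2" "P e1 \<subseteq> e1" "e1 \<in> cl e1" using P[OF e1(1)] e1 by (auto simp: cl_def)
    then have fP: "finite (P e1)" using fe(1)[OF e1(1)] finite_subset by blast
    have ins: "insert x (P e1) \<subseteq> W" "card (insert x (P e1)) = 3" using P1 e1 fP by (auto simp: W_def)
    have "{e \<in> D. x \<in> e - P e} \<subseteq> {e. e \<subseteq> W \<and> card e = k \<and> insert x (P e1) \<subseteq> e}"
    proof
      fix e assume "e \<in> {e \<in> D. x \<in> e - P e}"
      then have e: "e \<in> D" "x \<in> e" by auto
      then have "cl e = cl e1" using e1 by (intro cl_eq) auto
      moreover from this have "P e = P e1" by (simp add: P_def)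
      moreover have "e \<in> cl e" using e by (auto simp: cl_def)
      ultimately show "e \<in> {e. e \<subseteq> W \<and> card e = k \<and> insert x (P e1) \<subseteq> e}"
        using P[OF e(1)] fe(2)[OF e(1)] e by (auto simp: W_def)
    qed
    then have "card {e \<in> D. x \<in> e - P e} \<le> card {e. e \<subseteq> W \<and> card e = k \<and> insert x (P e1) \<subseteq> e}"
      using fW by (intro card_mono finite_uniform) auto
    also have "\<dots> = (card W - 3) choose (k - 3)" using card_supersets[OF fW ins(1), of k] ins(2) k by simp
    also have "\<dots> \<le> m choose (k - 3)" using cW by (intro binomial_right_mono) auto
    finally show ?thesis .
  qed
  have "(k - 2) * card D = (\<Sum>e\<in>D. card {x \<in> V. x \<in> e - P e})"
  proof -
    have "card {x \<in> V. x \<in> e - P e} = k - 2" if "e \<in> D" for e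
    proof -
      have "{x \<in> V. x \<in> e - P e} = e - P e" using fe(3)[OF that] by auto
      then show ?thesis using P[OF that] fe[OF that] finite_subset[of "P e" e] by (simp add: card_Diff_subset)
    qed
    then show ?thesis by simp
  qed
  also have "\<dots> = (\<Sum>x\<in>V. card {e \<in> D. x \<in> e - P e})"
    by (rule sum_multicount_gen[OF fD V]) simp
  also have "\<dots> \<le> (\<Sum>x\<in>V. m choose (k - 3))" by (intro sum_mono per)
  finally show ?thesis by (simp add: D_def)
qed

text \<open>A crude bound of the right order. It will be applied to a small set of vertices, where
  the constant does not matter.\<close>

lemma singleton_free_upper:
  fixes F :: "'v set set"
  assumes V: "finite V" and F: "\<And>e. e \<in> F \<Longrightarrow> e \<subseteq> V \<and> card e = k"
    and sing: "\<And>e e'. e \<in> F \<Longrightarrow> e' \<in> F \<Longrightarrow> card (e \<inter> e') \<noteq> 1" and k: "k \<ge> 5"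
  shows "card F \<le> (singleton_free_const k + 1) * card V ^ (k - 2)"
proof (cases "V = {}")
  case True
  then have "F = {}" using F k by fastforce
  then show ?thesis by simp
next
  case False
  then have n: "card V \<ge> 1" using V by (simp add: Suc_le_eq card_gt_0_iff)
  have fF: "finite F" using V F by (intro finite_subset[of F "Pow V"]) auto
  have DF: "dominated F \<subseteq> F" by (auto simp: dominated_def)
  have "card (\<Union> {e' \<in> dominated F. e' \<inter> e \<noteq> {}}) \<le> card V" for e
    using V F DF by (intro card_mono) auto
  then have "(k - 2) * card (dominated F) \<le> card V * (card V choose (k - 3))"
    using card_dominated[OF V F] k by simp
  also have "\<dots> \<le> card V * card V ^ (k - 3)" by (intro mult_le_mono2 binomial_le_power)
  also have "\<dots> = card V ^ Suc (k - 3)" by simp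
  also have "Suc (k - 3) = k - 2" using k by simp
  finally have 1: "(k - 2) * card (dominated F) \<le> card V ^ (k - 2)" .
  have "1 * card (dominated F) \<le> (k - 2) * card (dominated F)" using k by (intro mult_le_mono1) auto
  then have 1: "card (dominated F) \<le> card V ^ (k - 2)" using 1 by linarith
  have "card (F - dominated F) \<le> singleton_free_const k * card V ^ (k - 3)"
    by (rule card_not_dominated[OF V F sing k])
  also have "\<dots> \<le> singleton_free_const k * card V ^ (k - 2)" using n k by (intro mult_le_mono2 power_increasing) auto
  finally have 2: "card (F - dominated F) \<le> singleton_free_const k * card V ^ (k - 2)" .
  have "card F = card (dominated F) + card (F - dominated F)"
    using DF fF by (metis card_Diff_subset card_mono finite_subset le_add_diff_inverse)
  then show ?thesis using 1 2 by simp
qed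

text \<open>If every class of dominated edges spans at most (1 - \<eta>) n vertices,
  \<open>card_dominated\<close> gains a factor (1 - \<eta>)^(k-3) and the family is too small.
  Otherwise a pair \<open>P\<close> dominates a class spanning more. Edges without \<open>P\<close>
  are then confined to fewer than \<eta> n vertices, and they are outnumbered by the sets over
  \<open>P\<close> whose absence they enforce.\<close>

lemma singleton_free_bound_if_large:
  fixes F :: "'v set set" and \<eta> :: real
  assumes V: "finite V" and F: "\<And>e. e \<in> F \<Longrightarrow> e \<subseteq> V \<and> card e = k"
    and sing: "\<And>e e'. e \<in> F \<Longrightarrow> e' \<in> F \<Longrightarrow> card (e \<inter> e') \<noteq> 1" and k: "k \<ge> 5"
    and eta: "0 < \<eta>" "\<eta> < 1"
    and n1: "real (card V) ^ (k - 2) * (1 - \<eta>) ^ (k - 3) / fact (k - 2) + real (singleton_free_const k) * real (card V) ^ (k - 3)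
      < real ((card V - 2) choose (k - 2))"
    and n2: "(real (singleton_free_const k) + 1) * real k * \<eta> * real (card V) ^ (k - 3) \<le> real ((card V - (k + 2)) choose (k - 3))"
  shows "card F \<le> (card V - 2) choose (k - 2)"
proof (rule ccontr)
  assume big: "\<not> ?thesis"
  define n where "n = card V"
  define D where "D = dominated F"
  have fF: "finite F" using V F by (intro finite_subset[of F "Pow V"]) auto
  have DF: "D \<subseteq> F" by (auto simp: D_def dominated_def)
  have cF: "card F = card D + card (F - D)"
    using DF fF by (metis card_Diff_subset card_mono finite_subset le_add_diff_inverse)
  have "\<exists>e0\<in>D. real (card (\<Union> {e' \<in> D. e' \<inter> e0 \<noteq> {}})) > (1 - \<eta>) * real n"
  proof (rule ccontr)
    assume "\<not> ?thesis"
    then have le: "real (card (\<Union> {e' \<in> D. e' \<inter> e \<noteq> {}})) \<le> (1 - \<eta>) * real n" if "e \<in> D" for e using that by (auto simp: not_less)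
    define m where "m = nat \<lfloor>(1 - \<eta>) * real n\<rfloor>"
    have m: "real m \<le> (1 - \<eta>) * real n" using eta by (simp add: m_def)
    have "(k - 2) * card D \<le> n * (m choose (k - 3))"
      unfolding D_def n_def
    proof (rule card_dominated[OF V F])
      fix e assume "e \<in> dominated F"
      then have "real (card (\<Union> {e' \<in> D. e' \<inter> e \<noteq> {}})) \<le> (1 - \<eta>) * real n" using le by (simp add: D_def)
      then show "card (\<Union> {e' \<in> dominated F. e' \<inter> e \<noteq> {}}) \<le> m"
        unfolding m_def D_def by (simp add: le_nat_iff le_floor_iff)
    qed (use k in auto)
    then have "fact (k - 3) * ((k - 2) * card D) \<le> fact (k - 3) * (n * (m choose (k - 3)))" by (rule mult_le_mono2)
    also have "\<dots> = n * ((m choose (k - 3)) * fact (k - 3))" by simp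
    also have "\<dots> \<le> n * m ^ (k - 3)" by (intro mult_le_mono2 binomial_fact_pow)
    also have "fact (k - 3) * ((k - 2) * card D) = fact (k - 2) * card D"
    proof -
      have "k - 2 = Suc (k - 3)" using k by simp
      then show ?thesis unfolding \<open>k - 2 = Suc (k - 3)\<close> fact_Suc of_nat_id by (simp only: mult_ac)
    qed
    finally have "real (fact (k - 2) * card D) \<le> real (n * m ^ (k - 3))" by (simp only: of_nat_le_iff)
    also have "\<dots> \<le> real n * ((1 - \<eta>) * real n) ^ (k - 3)"
      using m by (simp add: mult_left_mono power_mono)
    also have "\<dots> = real n ^ Suc (k - 3) * (1 - \<eta>) ^ (k - 3)" by (simp add: power_mult_distrib)
    also have "Suc (k - 3) = k - 2" using k by simp
    finally have "real (card D) \<le> real n ^ (k - 2) * (1 - \<eta>) ^ (k - 3) / fact (k - 2)" by (simp add: field_simps)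
    moreover have "real (card (F - D)) \<le> real (singleton_free_const k * n ^ (k - 3))"
      using card_not_dominated[OF V F sing k] unfolding D_def n_def by (simp only: of_nat_le_iff)
    ultimately have "real (card F) < real ((n - 2) choose (k - 2))" using n1 cF by (simp add: n_def)
    then show False using big by (simp add: n_def)
  qed
  then obtain e0 where e0: "e0 \<in> D" "real (card (\<Union> {e' \<in> D. e' \<inter> e0 \<noteq> {}})) > (1 - \<eta>) * real n" by blast
  define W where "W = \<Union> {e' \<in> D. e' \<inter> e0 \<noteq> {}}"
  obtain P where P: "dominating_pair F e0 P" using e0(1) by (auto simp: D_def dominated_def)
  have e0F: "e0 \<in> F" "e0 \<subseteq> V" "card e0 = k" using e0 DF F by auto
  have PV: "card P = 2" "P \<subseteq> e0" "P \<subseteq> V" "finite P" using P e0F V finite_subset[of P V] by (auto simp: dominating_pair_def)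
  have WV: "W \<subseteq> V" using DF F by (auto simp: W_def)
  have fW: "finite W" using WV V finite_subset by blast
  have "e0 \<noteq> {}" using e0F k by auto
  then have e0W: "e0 \<subseteq> W" using e0 by (auto simp: W_def)
  have meetW: "P \<subseteq> f" if f: "f \<in> F" "f \<inter> W \<noteq> {}" for f
  proof -
    obtain e' where e': "e' \<in> D" "e' \<inter> e0 \<noteq> {}" "f \<inter> e' \<noteq> {}" using f(2) by (auto simp: W_def)
    obtain P' where P': "dominating_pair F e' P'" using e' by (auto simp: D_def dominated_def)
    have "f \<inter> e0 \<noteq> {}"
      using dominating_pairs_intersect[OF P P' e0F(1) _ _ f(1) e'(3)] e' DF by (auto simp: Int_commute)
    then show ?thesis using P f(1) by (auto simp: dominating_pair_def)
  qed
  define F' where "F' = {f \<in> F. \<not> P \<subseteq> f}"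
  define B where "B = \<Union> F'"
  have BW: "B \<subseteq> V - W" using meetW F by (auto simp: B_def F'_def) blast
  have fB: "finite B" using BW V finite_subset[of B V] by auto
  have cB: "real (card B) \<le> \<eta> * real n"
  proof -
    have "card B \<le> card (V - W)" using BW V by (intro card_mono) auto
    also have "\<dots> = n - card W" using WV fW by (simp add: card_Diff_subset n_def)
    finally have "card B + card W \<le> n" using card_mono[OF V WV] by (simp add: n_def)
    then have "real (card B) + real (card W) \<le> real n" by (simp only: of_nat_add[symmetric] of_nat_le_iff)
    then show ?thesis using e0(2) by (simp add: W_def algebra_simps)
  qed
  have cF': "card F' \<le> (singleton_free_const k + 1) * card B ^ (k - 2)"
  proof (rule singleton_free_upper[OF fB _ _ k])
    show "e \<subseteq> B \<and> card e = k" if "e \<in> F'" for e using that F by (auto simp: B_def F'_def)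
    show "card (e \<inter> e') \<noteq> 1" if "e \<in> F'" "e' \<in> F'" for e e' using that sing by (auto simp: F'_def)
  qed
  define X where "X = {e. e \<subseteq> V \<and> card e = k \<and> P \<subseteq> e}"
  define Mi where "Mi = X - F"
  have fX: "finite X" using V by (simp add: X_def finite_uniform)
  have cX: "card X = (n - 2) choose (k - 2)" unfolding X_def using card_supersets[OF V PV(3), of k] PV k by (simp add: n_def)
  have XF: "X \<inter> F = {f \<in> F. P \<subseteq> f}" using F by (auto simp: X_def)
  have c1: "card Mi + card (X \<inter> F) = (n - 2) choose (k - 2)"
    using fX cX card_Diff_subset_Int[of X F] card_mono[OF fX, of "X \<inter> F"] by (auto simp: Mi_def)
  have "F = F' \<union> (X \<inter> F)" "F' \<inter> (X \<inter> F) = {}" unfolding XF F'_def by auto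
  then have c2: "card F = card F' + card (X \<inter> F)" using fF by (metis card_Un_disjoint finite_Un)
  \<comment> \<open>A k-set that contains \<open>P\<close> and \<open>z\<close> and otherwise avoids
    \<open>f\<close> meets \<open>f\<close> in \<open>z\<close> alone, so it is missing from
    \<open>F\<close>.\<close>
  have perB: "(n - (k + 2)) choose (k - 3) \<le> card {e \<in> Mi. z \<in> e}" if zB: "z \<in> B" for z
  proof -
    obtain f where f: "f \<in> F" "\<not> P \<subseteq> f" "z \<in> f" using zB by (auto simp: B_def F'_def)
    have fV: "f \<subseteq> V" "card f = k" "finite f" using F[OF f(1)] V finite_subset by auto
    have "f \<inter> W = {}" using meetW[OF f(1)] f(2) by blast
    then have Pf: "P \<inter> f = {}" using PV(2) e0W by blast
    define Y where "Y = insert z (V - f)"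
    have fY: "finite Y" "card Y = n - k + 1" using V fV f(3) by (auto simp: Y_def card_Diff_subset n_def)
    have PY: "insert z P \<subseteq> Y" "card (insert z P) = 3" using PV Pf f(3) by (auto simp: Y_def card_insert_if)
    have "{e. e \<subseteq> Y \<and> card e = k \<and> insert z P \<subseteq> e} \<subseteq> {e \<in> Mi. z \<in> e}"
    proof
      fix e assume "e \<in> {e. e \<subseteq> Y \<and> card e = k \<and> insert z P \<subseteq> e}"
      then have e: "e \<subseteq> Y" "card e = k" "z \<in> e" "P \<subseteq> e" by auto
      have "e \<inter> f = {z}" using e f(3) by (auto simp: Y_def)
      then have "e \<notin> F" using sing[OF _ f(1), of e] by auto
      moreover have "e \<subseteq> V" using e(1) fV f(3) by (auto simp: Y_def)
      ultimately show "e \<in> {e \<in> Mi. z \<in> e}" using e by (auto simp: Mi_def X_def)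
    qed
    then have "card {e. e \<subseteq> Y \<and> card e = k \<and> insert z P \<subseteq> e} \<le> card {e \<in> Mi. z \<in> e}"
      using fX by (intro card_mono) (auto simp: Mi_def)
    moreover have "card {e. e \<subseteq> Y \<and> card e = k \<and> insert z P \<subseteq> e} = (card Y - 3) choose (k - 3)"
      using card_supersets[OF fY(1) PY(1), of k] PY(2) k by simp
    moreover have "card Y - 3 = n - (k + 2)" using fY(2) k by simp
    ultimately show ?thesis by simp
  qed
  have "card B * ((n - (k + 2)) choose (k - 3)) = (\<Sum>z\<in>B. (n - (k + 2)) choose (k - 3))" by simp
  also have "\<dots> \<le> (\<Sum>z\<in>B. card {e \<in> Mi. z \<in> e})" by (intro sum_mono perB)
  also have "\<dots> = (\<Sum>e\<in>Mi. card {z \<in> B. z \<in> e})"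
    using fX by (intro sum_multicount_gen[OF fB]) (auto simp: Mi_def)
  also have "\<dots> \<le> (\<Sum>e\<in>Mi. k)"
  proof (rule sum_mono)
    fix e assume "e \<in> Mi"
    then have "e \<subseteq> V" "card e = k" by (auto simp: Mi_def X_def)
    then have "card {z \<in> B. z \<in> e} \<le> card e" using V by (intro card_mono) (auto intro: finite_subset)
    then show "card {z \<in> B. z \<in> e} \<le> k" using \<open>card e = k\<close> by simp
  qed
  finally have c3: "card B * ((n - (k + 2)) choose (k - 3)) \<le> k * card Mi" by (simp add: mult.commute)
  \<comment> \<open>Per vertex of \<open>B\<close> the crude bound gives order (\<eta> n)^(k-3)
    edges, against order n^(k-3) missing sets with a constant independent of \<eta>.\<close>
  have "card F' \<le> card Mi"
  proof -
    let ?C = "real (singleton_free_const k) + 1"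
    have kk: "k - 2 = Suc (k - 3)" "k - 3 = Suc (k - 4)" using k by auto
    have "\<eta> ^ (k - 4) \<le> 1" using eta by (intro power_le_one) auto
    then have ek: "\<eta> ^ (k - 3) \<le> \<eta>" using eta by (simp add: kk(2) mult_left_le)
    have "real (card F') \<le> ?C * real (card B) ^ (k - 2)"
    proof -
      have "real (card F') \<le> real ((singleton_free_const k + 1) * card B ^ (k - 2))" using cF' by (simp only: of_nat_le_iff)
      then show ?thesis by (simp add: algebra_simps)
    qed
    also have "\<dots> = ?C * (real (card B) * real (card B) ^ (k - 3))" by (simp add: kk(1))
    also have "\<dots> \<le> ?C * (real (card B) * (\<eta> * real n ^ (k - 3)))"
    proof (intro mult_left_mono)
      have "real (card B) ^ (k - 3) \<le> (\<eta> * real n) ^ (k - 3)" using cB by (intro power_mono) auto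
      also have "\<dots> = \<eta> ^ (k - 3) * real n ^ (k - 3)" by (rule power_mult_distrib)
      also have "\<dots> \<le> \<eta> * real n ^ (k - 3)" using ek by (intro mult_right_mono) auto
      finally show "real (card B) ^ (k - 3) \<le> \<eta> * real n ^ (k - 3)" .
    qed auto
    finally have "real k * real (card F') \<le> real k * (?C * (real (card B) * (\<eta> * real n ^ (k - 3))))" by (intro mult_left_mono) auto
    also have "\<dots> = real (card B) * (?C * real k * \<eta> * real n ^ (k - 3))" by (simp add: mult_ac)
    also have "\<dots> \<le> real (card B) * real ((n - (k + 2)) choose (k - 3))" using n2 by (intro mult_left_mono) (auto simp: n_def)
    also have "\<dots> = real (card B * ((n - (k + 2)) choose (k - 3)))" by simp
    also have "\<dots> \<le> real (k * card Mi)" using c3 by (simp only: of_nat_le_iff)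
    finally have "real k * real (card F') \<le> real k * real (card Mi)" by simp
    then show ?thesis using k by simp
  qed
  then show False using big c1 c2 by (simp add: n_def)
qed

theorem singleton_free_bound:
  assumes k: "k \<ge> 5"
  shows "\<exists>n0. \<forall>(V :: 'v set) F. finite V \<longrightarrow> card V \<ge> n0 \<longrightarrow> (\<forall>e\<in>F. e \<subseteq> V \<and> card e = k) \<longrightarrow>
    (\<forall>e\<in>F. \<forall>e'\<in>F. card (e \<inter> e') \<noteq> 1) \<longrightarrow> card F \<le> (card V - 2) choose (k - 2)"
proof -
  define C where "C = real (singleton_free_const k)"
  \<comment> \<open>Makes the coefficient on the left of \<open>n2\<close> half of the limit 1 /
    (k-3)! on the right.\<close>
  define \<eta> where "\<eta> = 1 / (2 * (C + 1) * real k * fact (k - 3))"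
  have C0: "C \<ge> 0" by (simp add: C_def)
  have "2 * (C + 1) * real k * fact (k - 3) > 1"
  proof -
    have "1 \<le> (C + 1) * real k" using C0 k mult_mono[of 1 "C + 1" 1 "real k"] by simp
    then have "1 * 1 \<le> ((C + 1) * real k) * fact (k - 3)" by (intro mult_mono) auto
    moreover have "2 * (C + 1) * real k * fact (k - 3) = 2 * (((C + 1) * real k) * fact (k - 3))" by (simp only: mult.assoc)
    ultimately show ?thesis by linarith
  qed
  then have eta: "0 < \<eta>" "\<eta> < 1" by (auto simp: \<eta>_def)
  define y where "y = (C + 1) * real k"
  have "y > 0" using C0 k by (simp add: y_def)
  moreover have "\<eta> = 1 / (2 * y * fact (k - 3))" by (simp add: \<eta>_def y_def mult.assoc)
  ultimately have "(C + 1) * real k * \<eta> = 1 / (2 * fact (k - 3))" unfolding y_def[symmetric] by simp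
  also have "\<dots> < 1 / fact (k - 3)" by (simp add: field_simps)
  finally have e2: "\<forall>\<^sub>F n in sequentially. ((C + 1) * real k * \<eta>) * real n ^ (k - 3) \<le> real ((n - (k + 2)) choose (k - 3))"
    by (rule binomial_eventually_ge)
  define a where "a = (1 - \<eta>) ^ (k - 3)"
  have a: "a < 1" using eta k by (auto simp: a_def power_Suc_less_one power_less_one_iff)
  \<comment> \<open>Any number strictly between \<open>a\<close> and 1 leaves room on both sides:
    for the lower order term and for the binomial asymptotics.\<close>
  define b where "b = (1 + a) / 2"
  have "b / fact (k - 2) < 1 / fact (k - 2)" using a by (intro divide_strict_right_mono) (simp_all add: b_def)
  then have e1: "\<forall>\<^sub>F n in sequentially. (b / fact (k - 2)) * real n ^ (k - 2) \<le> real ((n - 2) choose (k - 2))"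
    by (rule binomial_eventually_ge)
  have "(b - a) / (2 * fact (k - 2)) > 0" using a by (simp add: b_def)
  then have e3: "\<forall>\<^sub>F n in sequentially. C * real n ^ (k - 3) \<le> (b - a) / (2 * fact (k - 2)) * real n ^ (k - 2)"
    by (rule power_eventually_le) (use k in auto)
  have "\<forall>\<^sub>F n in sequentially. real n ^ (k - 2) * (1 - \<eta>) ^ (k - 3) / fact (k - 2) + C * real n ^ (k - 3) < real ((n - 2) choose (k - 2)) \<and>
     (C + 1) * real k * \<eta> * real n ^ (k - 3) \<le> real ((n - (k + 2)) choose (k - 3))"
    using e1 e2 e3 eventually_gt_at_top[of 0]
  proof eventually_elim
    case (elim n)
    have "(b - a) / (2 * fact (k - 2)) * real n ^ (k - 2) < (b - a) / fact (k - 2) * real n ^ (k - 2)"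
      using elim(4) a by (intro mult_strict_right_mono) (auto simp: b_def field_simps)
    then have "a / fact (k - 2) * real n ^ (k - 2) + C * real n ^ (k - 3) < b / fact (k - 2) * real n ^ (k - 2)"
      using elim(3) by (simp add: diff_divide_distrib left_diff_distrib)
    then show ?case using elim(1,2) by (simp add: a_def mult.commute)
  qed
  then obtain n0 where n0: "\<And>n. n \<ge> n0 \<Longrightarrow> real n ^ (k - 2) * (1 - \<eta>) ^ (k - 3) / fact (k - 2) + C * real n ^ (k - 3) < real ((n - 2) choose (k - 2)) \<and>
     (C + 1) * real k * \<eta> * real n ^ (k - 3) \<le> real ((n - (k + 2)) choose (k - 3))"
    unfolding eventually_sequentially by blast
  show ?thesis
  proof (intro exI[of _ n0] allI impI)
    fix V :: "'v set" and F assume a: "finite V" "n0 \<le> card V" "\<forall>e\<in>F. e \<subseteq> V \<and> card e = k" "\<forall>e\<in>F. \<forall>e'\<in>F. card (e \<inter> e') \<noteq> 1"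
    show "card F \<le> (card V - 2) choose (k - 2)"
      by (rule singleton_free_bound_if_large[OF a(1) _ _ k eta]) (use a n0[OF a(2)] in \<open>auto simp: C_def\<close>)
  qed
qed

section \<open>Stability\<close>

text \<open>Lists with repetitions are used in place of sets because every window of a uniformly
  random list is again uniformly random.\<close>

abbreviation lists_of :: "'v set \<Rightarrow> nat \<Rightarrow> 'v list set" where
  "lists_of V m \<equiv> {xs. set xs \<subseteq> V \<and> length xs = m}"

lemma card_lists_window:
  fixes V :: "'v set"
  assumes V: "finite V" and B: "B \<subseteq> lists_of V j" and ij: "i + j \<le> m"
  shows "card {zs \<in> lists_of V m. take j (drop i zs) \<in> B} \<le> card B * card V ^ (m - j)"
proof -
  define \<phi> where "\<phi> zs = (take j (drop i zs), take i zs @ drop (i + j) zs)" for zs :: "'v list"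
  have "inj_on \<phi> {zs \<in> lists_of V m. take j (drop i zs) \<in> B}"
  proof (rule inj_onI)
    fix zs zs' assume a: "zs \<in> {zs \<in> lists_of V m. take j (drop i zs) \<in> B}" "zs' \<in> {zs \<in> lists_of V m. take j (drop i zs) \<in> B}" "\<phi> zs = \<phi> zs'"
    have dec: "ys = take i ys @ take j (drop i ys) @ drop (i + j) ys" for ys :: "'v list"
      by (metis append_take_drop_id drop_drop add.commute)
    have "length (take i zs) = length (take i zs')" using a by simp
    then have "take i zs = take i zs'" "drop (i + j) zs = drop (i + j) zs'" "take j (drop i zs) = take j (drop i zs')"
      using a(3) by (simp_all add: \<phi>_def)
    then show "zs = zs'" using dec[of zs] dec[of zs'] by simp
  qed
  moreover have "\<phi> ` {zs \<in> lists_of V m. take j (drop i zs) \<in> B} \<subseteq> B \<times> lists_of V (m - j)"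
    using ij by (auto simp: \<phi>_def dest!: in_set_takeD in_set_dropD)
  moreover have "finite (B \<times> lists_of V (m - j))"
    using V B finite_lists_length_eq[OF V] finite_subset by blast
  ultimately have "card {zs \<in> lists_of V m. take j (drop i zs) \<in> B} \<le> card (B \<times> lists_of V (m - j))"
    by (rule card_inj_on_le)
  then show ?thesis using V by (simp add: card_cartesian_product card_lists_length_eq)
qed

text \<open>Two random $p$-element lists are joined by a chain of windows of their concatenation, consecutive
  windows differing in one element; so a colouring that rarely changes under such a step is almost constant.\<close>

lemma almost_constant_colouring:
  fixes c :: "'v set \<Rightarrow> 'c"
  assumes V: "finite V" "card V \<ge> 1" and p: "p \<ge> 1"
    and A1: "A1 = {u \<in> lists_of V p. set u \<notin> Typ}"
    and A2: "A2 = {w \<in> lists_of V (Suc p). set (take p w) \<in> Typ \<and> set (tl w) \<in> Typ \<and> c (set (take p w)) \<noteq> c (set (tl w))}"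
    and b: "b = (p + 1) * card A1 * card V ^ p + p * card A2 * card V ^ (p - 1)"
    and lt: "b < card V ^ (2 * p)"
  shows "\<exists>f0 \<in> Typ. card {u \<in> lists_of V p. \<not> (set u \<in> Typ \<and> c (set u) = c f0)} * card V ^ p \<le> b"
proof -
  define n where "n = card V"
  have fin: "finite (lists_of V m)" "card (lists_of V m) = n ^ m" for m
    using V finite_lists_length_eq[OF V(1)] card_lists_length_eq[OF V(1)] by (auto simp: n_def)
  define b1 where "b1 i = {zs \<in> lists_of V (2 * p). take p (drop i zs) \<in> A1}" for i
  define b2 where "b2 i = {zs \<in> lists_of V (2 * p). take (Suc p) (drop i zs) \<in> A2}" for i
  define Bad where "Bad = (\<Union>i\<in>{..p}. b1 i) \<union> (\<Union>i\<in>{..<p}. b2 i)"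
  have "card (\<Union>i\<in>{..p}. b1 i) \<le> (\<Sum>i\<in>{..p}. card (b1 i))" by (rule card_UN_le) simp
  also have "\<dots> \<le> (\<Sum>i\<in>{..p}. card A1 * n ^ (2 * p - p))"
    unfolding b1_def n_def by (intro sum_mono card_lists_window[OF V(1)]) (auto simp: A1)
  finally have c1: "card (\<Union>i\<in>{..p}. b1 i) \<le> (p + 1) * card A1 * n ^ p" by (simp add: algebra_simps)
  have "card (\<Union>i\<in>{..<p}. b2 i) \<le> (\<Sum>i\<in>{..<p}. card (b2 i))" by (rule card_UN_le) simp
  also have "\<dots> \<le> (\<Sum>i\<in>{..<p}. card A2 * n ^ (2 * p - Suc p))"
    unfolding b2_def n_def by (intro sum_mono card_lists_window[OF V(1)]) (auto simp: A2)
  also have "2 * p - Suc p = p - 1" by simp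
  finally have c2: "card (\<Union>i\<in>{..<p}. b2 i) \<le> p * card A2 * n ^ (p - 1)" by (simp add: mult.assoc)
  have cBad: "card Bad \<le> b" unfolding Bad_def b using c1 c2 card_Un_le[of "\<Union>i\<in>{..p}. b1 i" "\<Union>i\<in>{..<p}. b2 i"] by (simp add: n_def)
  have "Bad \<subseteq> lists_of V (2 * p)" by (auto simp: Bad_def b1_def b2_def)
  then have fBad: "finite Bad" using fin(1) finite_subset by blast
  define bad where "bad xs = {ys \<in> lists_of V p. xs @ ys \<in> Bad}" for xs
  have fbad: "finite (bad xs)" for xs by (rule finite_subset[OF _ fin(1)[of p]]) (auto simp: bad_def)
  \<comment> \<open>Averaging over the first half: some \<open>xs\<close> has at most the average
    number of continuations that make the concatenation bad.\<close>
  have "\<exists>xs \<in> lists_of V p. card (bad xs) * n ^ p \<le> card Bad"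
  proof (rule ccontr)
    assume "\<not> ?thesis"
    then have gt: "card Bad < card (bad xs) * n ^ p" if "xs \<in> lists_of V p" for xs using that by (auto simp: not_le)
    have ne: "lists_of V p \<noteq> {}"
    proof
      assume "lists_of V p = {}"
      then have "n ^ p = 0" using fin(2)[of p] by (simp only: card.empty)
      then show False using V(2) by (simp add: n_def)
    qed
    have "inj_on (\<lambda>(xs, ys). xs @ ys) (SIGMA xs:lists_of V p. bad xs)" by (auto simp: inj_on_def)
    moreover have "(\<lambda>(xs, ys). xs @ ys) ` (SIGMA xs:lists_of V p. bad xs) \<subseteq> Bad" by (auto simp: bad_def)
    ultimately have "card (SIGMA xs:lists_of V p. bad xs) \<le> card Bad" using fBad by (rule card_inj_on_le)
    then have le: "(\<Sum>xs\<in>lists_of V p. card (bad xs)) \<le> card Bad" using card_SigmaI[OF fin(1)[of p], of bad] fbad by simp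
    have "card Bad * n ^ p = (\<Sum>xs\<in>lists_of V p. card Bad)" using fin(2)[of p] by simp
    also have "\<dots> < (\<Sum>xs\<in>lists_of V p. card (bad xs) * n ^ p)" using gt ne fin(1) by (intro sum_strict_mono) auto
    also have "\<dots> = (\<Sum>xs\<in>lists_of V p. card (bad xs)) * n ^ p" by (simp add: sum_distrib_right)
    also have "\<dots> \<le> card Bad * n ^ p" using le by simp
    finally show False by simp
  qed
  then obtain xs where xs: "xs \<in> lists_of V p" "card (bad xs) * n ^ p \<le> card Bad" by blast
  have good: "set xs \<in> Typ \<and> set ys \<in> Typ \<and> c (set ys) = c (set xs)" if ys: "ys \<in> lists_of V p" "ys \<notin> bad xs" for ys
  proof -
    define zs where "zs = xs @ ys"
    have zs: "zs \<in> lists_of V (2 * p)" "zs \<notin> Bad" using xs ys by (auto simp: zs_def bad_def)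
    \<comment> \<open>The windows lead from \<open>xs\<close> at 0 to \<open>ys\<close> at
      \<open>p\<close>; two consecutive ones are the initial part and the tail of a window of length
      p + 1.\<close>
    define u where "u i = take p (drop i zs)" for i
    have uL: "u i \<in> lists_of V p" if "i \<le> p" for i
      using zs(1) that by (auto simp: u_def dest: in_set_takeD in_set_dropD)
    have ut: "set (u i) \<in> Typ" if "i \<le> p" for i
    proof (rule ccontr)
      assume "set (u i) \<notin> Typ"
      then have "u i \<in> A1" using uL[OF that] by (simp add: A1)
      then show False using zs that by (auto simp: Bad_def b1_def u_def)
    qed
    have uc: "c (set (u (Suc i))) = c (set (u i))" if i: "i < p" for i
    proof (rule ccontr)
      assume n: "\<not> ?thesis"
      let ?w = "take (Suc p) (drop i zs)"
      have w1: "take p ?w = u i" by (simp add: u_def)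
      have w2: "tl ?w = u (Suc i)" by (simp add: u_def tl_take tl_drop drop_Suc)
      have "?w \<in> lists_of V (Suc p)" using zs(1) i by (auto dest: in_set_takeD in_set_dropD)
      moreover have "set (take p ?w) \<in> Typ \<and> set (tl ?w) \<in> Typ \<and> c (set (take p ?w)) \<noteq> c (set (tl ?w))"
        unfolding w1 w2 using ut[of i] ut[of "Suc i"] i n by auto
      ultimately have "?w \<in> A2" unfolding A2 by blast
      then show False using zs i by (auto simp: Bad_def b2_def)
    qed
    have "c (set (u i)) = c (set (u 0))" if "i \<le> p" for i
      using that by (induction i) (use uc in auto)
    from this[of p] ut[of 0] ut[of p] show ?thesis using xs ys by (simp add: u_def zs_def)
  qed
  have "card (bad xs) * n ^ p < n ^ p * n ^ p"
    using xs(2) cBad lt by (simp add: n_def power_add[symmetric] mult_2)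
  then have "card (bad xs) < card (lists_of V p)" using fin(2)[of p] by simp
  then have "\<not> lists_of V p \<subseteq> bad xs" using card_mono[OF fbad, of "lists_of V p" xs] by linarith
  then have sx: "set xs \<in> Typ" using good by blast
  have "{u \<in> lists_of V p. \<not> (set u \<in> Typ \<and> c (set u) = c (set xs))} \<subseteq> bad xs" (is "?S \<subseteq> _") using good by blast
  then have "card ?S \<le> card (bad xs)" by (rule card_mono[OF fbad])
  then have "card ?S * n ^ p \<le> card (bad xs) * n ^ p" by (rule mult_le_mono1)
  then have "card ?S * card V ^ p \<le> b" using xs(2) cBad unfolding n_def by linarith
  with sx show ?thesis by blast
qed

text \<open>\<open>s i\<close> is the least number of vertices meeting all edges of a linear cycle
  of length \<open>l i\<close>. The factor 2 in \<open>N\<close> makes room in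
  \<open>star_cycles\<close> for a closing set of up to 2k vertices.\<close>

locale cycle_lengths =
  fixes k :: nat and I :: "'i set" and l s :: "'i \<Rightarrow> nat" and t N :: nat
  assumes k: "k \<ge> 5" and I: "finite I" "I \<noteq> {}" and l: "\<And>i. i \<in> I \<Longrightarrow> l i \<ge> 3"
    and s: "\<And>i. s i = (l i + 1) div 2" and t: "t + 1 = sum s I" and N: "N = 2 * k * sum l I"
begin

lemma N_bounds: "N \<ge> k * sum l I" "N \<ge> 2 * k" "c \<le> 2 * k \<Longrightarrow> N \<ge> c + 3 * sum l I" "N \<ge> 1"
proof -
  obtain i where i: "i \<in> I" using I by blast
  have L3: "sum l I \<ge> 3" using member_le_sum[OF i, of l] l[OF i] I by simp
  show "N \<ge> k * sum l I" by (simp add: N)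
  have "k * 3 \<le> k * sum l I" using L3 by (rule mult_le_mono2)
  moreover have "5 * sum l I \<le> k * sum l I" using k by (rule mult_le_mono1)
  moreover have "N = k * sum l I + k * sum l I" by (simp add: N)
  ultimately show "N \<ge> 2 * k" "c \<le> 2 * k \<Longrightarrow> N \<ge> c + 3 * sum l I" "N \<ge> 1" using k by linarith+
qed

lemma t_ge_1: "t \<ge> 1"
proof -
  obtain i where i: "i \<in> I" using I by blast
  have "s i \<ge> 2" using l[OF i] by (simp add: s)
  then show ?thesis using member_le_sum[OF i, of s] I t by simp
qed

text \<open>With t + 1 centres none has to be saved: a centre \<open>w\<close> closes cycle
  \<open>i0\<close> just like the others, and t centres remain.\<close>

lemma many_centres:
  fixes E :: "'v set set"
  assumes E: "\<And>e. e \<in> E \<Longrightarrow> finite e \<and> card e = k"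
    and U: "finite U" "card U \<ge> t + 1"
    and PP: "\<And>Z. finite Z \<Longrightarrow> card Z \<le> N \<Longrightarrow> \<exists>p q. (p, q) \<in> PP \<and> p \<notin> Z \<and> q \<notin> Z"
    and PP1: "\<And>p q. (p, q) \<in> PP \<Longrightarrow> p \<noteq> q \<and> p \<notin> U \<and> q \<notin> U"
    and PP2: "\<And>p q w. (p, q) \<in> PP \<Longrightarrow> w \<in> U \<Longrightarrow> rich E N {p, q, w} \<and> rich E N {p, w} \<and> rich E N {q, w}"
  shows "cycle_system k I l E"
proof -
  obtain i0 where i0: "i0 \<in> I" using I by blast
  obtain p q where pq: "(p, q) \<in> PP" using PP[of "{}"] by auto
  have "U \<noteq> {}" using U(2) by auto
  then obtain w where w: "w \<in> U" by blast
  have ne: "p \<noteq> q" "p \<noteq> w" "q \<noteq> w" using PP1[OF pq] w by auto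
  have r: "rich E N {p, q, w}" "rich E N {p, w}" "rich E N {w, q}" using PP2[OF pq w] by (auto simp: insert_commute)
  have "\<exists>Q Q' z. {p, q, w} = Q \<union> Q' \<and> Q \<inter> Q' = {z} \<and> p \<in> Q \<and> q \<in> Q' \<and> p \<noteq> z \<and> q \<noteq> z \<and> rich E N Q \<and> rich E N Q'"
  proof -
    have "{p, q, w} = {p, w} \<union> {w, q} \<and> {p, w} \<inter> {w, q} = {w} \<and> p \<in> {p, w} \<and> q \<in> {w, q} \<and> p \<noteq> w \<and> q \<noteq> w \<and>
      rich E N {p, w} \<and> rich E N {w, q}" using ne r by auto
    then show ?thesis by (intro exI)
  qed
  then have cl: "closer E N (l i0) {p, q, w} p q" using ne r by (simp add: closer_def)
  have "U - {p, q, w} = U - {w}" using PP1[OF pq] by auto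
  then have cU: "card (U - {p, q, w}) + 1 \<ge> sum s I" using U w t by simp
  have c3: "card {p, q, w} \<le> 2 * k" using k by (simp add: card_insert_if)
  show ?thesis
    by (rule star_cycles[OF I(1) i0 l E s N_bounds(1) N_bounds(3)[OF c3] cl _ U(1) cU])
      (use PP PP1 PP2 pq in auto)
qed

text \<open>In a full subfamily of common links any two vertices of a link form, with every centre
  of \<open>U\<close>, a rich triple. So \<open>many_centres\<close> applies, and (k-1)-sets joined
  to more than t common centres number only O(n^(k-2)).\<close>

lemma few_common_links:
  fixes E :: "'v set set"
  assumes E: "\<And>e. e \<in> E \<Longrightarrow> finite e \<and> card e = k" and no: "\<not> cycle_system k I l E"
    and U: "finite U" "card U \<ge> t + 1"
    and H0: "finite H0" "\<And>f. f \<in> H0 \<Longrightarrow> finite f \<and> card f = k - 1 \<and> f \<inter> U = {}"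
      "\<And>f v. f \<in> H0 \<Longrightarrow> v \<in> U \<Longrightarrow> insert v f \<in> E"
  shows "card H0 \<le> N * card (shadow H0)"
proof (rule ccontr)
  assume "\<not> ?thesis"
  then have big: "card H0 > N * card (shadow H0)" by simp
  obtain H where H: "H \<subseteq> H0" "H \<noteq> {}" "\<And>e x. e \<in> H \<Longrightarrow> x \<in> e \<Longrightarrow> card {e' \<in> H. e - {x} \<subseteq> e'} > N"
    by (rule full_subfamily[OF H0(1) _ big]) (use H0(2) in blast)+
  have Hf: "finite f \<and> card f = k - 1" "f \<inter> U = {}" if "f \<in> H" for f using H0(2) H(1) that by blast+
  have rH: "rich H N S" if "f \<in> H" "S \<subseteq> f" for f S
    using full_rich[of H "k - 1" N f S] Hf H(3) that by blast
  have rE: "rich E N (insert w S)" if fSw: "f \<in> H" "S \<subseteq> f" "w \<in> U" for f S w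
    unfolding rich_def
  proof (intro allI impI)
    fix Z assume Z: "finite Z" "card Z \<le> N" "Z \<inter> insert w S = {}"
    obtain f' where f': "f' \<in> H" "S \<subseteq> f'" "f' \<inter> Z = {}" by (rule richD[OF rH[OF fSw(1,2)] Z(1,2)]) (use Z(3) in auto)
    then have "insert w f' \<in> E" using H0(3) H(1) fSw(3) by blast
    then show "\<exists>e\<in>E. insert w S \<subseteq> e \<and> e \<inter> Z = {}" using f' Z(3) by (intro bexI[of _ "insert w f'"]) auto
  qed
  define PP where "PP = {(p, q). p \<noteq> q \<and> (\<exists>f\<in>H. p \<in> f \<and> q \<in> f)}"
  have "cycle_system k I l E"
  proof (rule many_centres[OF E U, where PP = PP])
    fix Z :: "'v set" assume Z: "finite Z" "card Z \<le> N"
    obtain f0 where "f0 \<in> H" using H(2) by blast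
    then have "rich H N {}" using rH by blast
    from this Z obtain f where f: "f \<in> H" "f \<inter> Z = {}" by (rule richD) simp
    have "card f \<ge> 2" using Hf[OF f(1)] k by simp
    then obtain p q where "p \<in> f" "q \<in> f" "p \<noteq> q" by (rule two_elements)
    then have "(p, q) \<in> PP" "p \<notin> Z" "q \<notin> Z" using f by (auto simp: PP_def)
    then show "\<exists>p q. (p, q) \<in> PP \<and> p \<notin> Z \<and> q \<notin> Z" by blast
  next
    fix p q assume "(p, q) \<in> PP"
    then show "p \<noteq> q \<and> p \<notin> U \<and> q \<notin> U" using Hf by (auto simp: PP_def)
  next
    fix p q w assume pq: "(p, q) \<in> PP" "w \<in> U"
    then obtain f where f: "f \<in> H" "p \<in> f" "q \<in> f" by (auto simp: PP_def)
    have "rich E N (insert w {p, q})" "rich E N (insert w {p})" "rich E N (insert w {q})"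
      using rE[OF f(1) _ pq(2)] f by simp_all
    then show "rich E N {p, q, w} \<and> rich E N {p, w} \<and> rich E N {q, w}" by (simp add: insert_commute)
  qed
  then show False using no by simp
qed

text \<open>Both links in \<open>W\<close> contain the vertices whose colours differ from
  \<open>a\<close> and \<open>b\<close>. Hence two such vertices are richly joined to every centre,
  no matter whether it belongs to \<open>X\<close> or to \<open>Y\<close>, and the t + 1 centres
  need not share a single link.\<close>

lemma few_crossings_coloured:
  fixes E :: "'v set set"
  assumes E: "\<And>e. e \<in> E \<Longrightarrow> finite e \<and> card e = k" and no: "\<not> cycle_system k I l E"
    and U: "finite (X \<union> Y)" "card (X \<union> Y) \<ge> t + 1"
    and H0: "finite H0" "\<And>W. W \<in> H0 \<Longrightarrow> finite W \<and> card W = k \<and> W \<inter> (X \<union> Y) = {}"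
    and \<chi>: "\<And>W. W \<in> H0 \<Longrightarrow> bij_betw \<chi> W {..<k}"
    and X: "\<And>W v. W \<in> H0 \<Longrightarrow> v \<in> X \<Longrightarrow> insert v (restr \<chi> W ({..<k} - {a})) \<in> E"
    and Y: "\<And>W v. W \<in> H0 \<Longrightarrow> v \<in> Y \<Longrightarrow> insert v (restr \<chi> W ({..<k} - {b})) \<in> E"
  shows "card H0 \<le> N * card (shadow H0)"
proof (rule ccontr)
  assume "\<not> ?thesis"
  then have big: "card H0 > N * card (shadow H0)" by simp
  obtain H where H: "H \<subseteq> H0" "H \<noteq> {}" "\<And>e x. e \<in> H \<Longrightarrow> x \<in> e \<Longrightarrow> card {e' \<in> H. e - {x} \<subseteq> e'} > N"
    by (rule full_subfamily[OF H0(1) _ big]) (use H0(2) in blast)+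
  have Hf: "finite f \<and> card f = k" "f \<inter> (X \<union> Y) = {}" if "f \<in> H" for f using H0(2) H(1) that by blast+
  have rH: "rich H N S" if "f \<in> H" "S \<subseteq> f" for f S
    using full_rich[of H k N f S] Hf H(3) that by blast
  have rE: "rich E N (insert w S)" if W: "W \<in> H" "S \<subseteq> W" "\<chi> ` S \<subseteq> {..<k} - {a, b}" "w \<in> X \<union> Y" for W S w
    unfolding rich_def
  proof (intro allI impI)
    fix Z assume Z: "finite Z" "card Z \<le> N" "Z \<inter> insert w S = {}"
    obtain W' where W': "W' \<in> H" "S \<subseteq> W'" "W' \<inter> Z = {}" by (rule richD[OF rH[OF W(1,2)] Z(1,2)]) (use Z(3) in auto)
    have WH0: "W' \<in> H0" using W' H(1) by blast
    obtain d where d: "d = a \<or> d = b" "insert w (restr \<chi> W' ({..<k} - {d})) \<in> E" using X[OF WH0] Y[OF WH0] W(4) by blast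
    have "S \<subseteq> restr \<chi> W' ({..<k} - {d})" using W(3) W'(2) d(1) by (auto simp: restr_def)
    then show "\<exists>e\<in>E. insert w S \<subseteq> e \<and> e \<inter> Z = {}"
      using d(2) W'(3) Z(3) restr_subset[of \<chi> W' "{..<k} - {d}"] by (intro bexI[OF _ d(2)]) auto
  qed
  have "card ({..<k} - {a, b}) \<ge> 2" using k diff_card_le_card_Diff[of "{a, b}" "{..<k}"] card_insert_le_m1[of 2 "{b}" a] by simp
  then obtain c d where cd: "c \<in> {..<k} - {a, b}" "d \<in> {..<k} - {a, b}" "c \<noteq> d" by (rule two_elements)
  define PP where "PP = {(p, q). \<chi> p = c \<and> \<chi> q = d \<and> (\<exists>W\<in>H. p \<in> W \<and> q \<in> W)}"
  have "cycle_system k I l E"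
  proof (rule many_centres[OF E U, where PP = PP])
    fix Z :: "'v set" assume Z: "finite Z" "card Z \<le> N"
    obtain f0 where "f0 \<in> H" using H(2) by blast
    then have "rich H N {}" using rH by blast
    from this Z obtain W where W: "W \<in> H" "W \<inter> Z = {}" by (rule richD) simp
    have "\<chi> ` W = {..<k}" using \<chi>[of W] W(1) H(1) by (auto simp: bij_betw_def)
    then have "c \<in> \<chi> ` W" "d \<in> \<chi> ` W" using cd by auto
    then obtain p q where "p \<in> W" "\<chi> p = c" "q \<in> W" "\<chi> q = d" by auto
    then have "(p, q) \<in> PP" "p \<notin> Z" "q \<notin> Z" using W by (auto simp: PP_def)
    then show "\<exists>p q. (p, q) \<in> PP \<and> p \<notin> Z \<and> q \<notin> Z" by blast
  next
    fix p q assume "(p, q) \<in> PP"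
    then obtain W where "W \<in> H" "p \<in> W" "q \<in> W" "\<chi> p = c" "\<chi> q = d" by (auto simp: PP_def)
    then show "p \<noteq> q \<and> p \<notin> X \<union> Y \<and> q \<notin> X \<union> Y" using Hf(2)[of W] cd(3) by blast
  next
    fix p q w assume pq: "(p, q) \<in> PP" "w \<in> X \<union> Y"
    then obtain W where W: "W \<in> H" "p \<in> W" "q \<in> W" "\<chi> p = c" "\<chi> q = d" by (auto simp: PP_def)
    have "rich E N (insert w {p, q})" "rich E N (insert w {p})" "rich E N (insert w {q})"
      using rE[OF W(1) _ _ pq(2)] W cd by simp_all
    then show "rich E N {p, q, w} \<and> rich E N {p, w} \<and> rich E N {q, w}" by (simp add: insert_commute)
  qed
  then show False using no by simp
qed

text \<open>Fixing the colours of the two omitted vertices reduces to the coloured version. The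
  rainbow colouring costs k^k and the choice of the two colours k^2.\<close>

lemma few_crossings:
  fixes E :: "'v set set"
  assumes V: "finite V" and E: "\<And>e. e \<in> E \<Longrightarrow> finite e \<and> card e = k" and no: "\<not> cycle_system k I l E"
    and U: "finite (X \<union> Y)" "card (X \<union> Y) \<ge> t + 1"
    and H0: "\<And>W. W \<in> H0 \<Longrightarrow> W \<subseteq> V \<and> card W = k \<and> W \<inter> (X \<union> Y) = {}"
    and XY: "\<And>W. W \<in> H0 \<Longrightarrow> \<exists>x\<in>W. \<exists>y\<in>W. (\<forall>v\<in>X. insert v (W - {x}) \<in> E) \<and> (\<forall>v\<in>Y. insert v (W - {y}) \<in> E)"
  shows "card H0 \<le> k ^ (k + 2) * N * card V ^ (k - 1)"
proof -
  have fH0: "finite H0" using V H0 by (intro finite_subset[of H0 "Pow V"]) auto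
  obtain \<chi> :: "'v \<Rightarrow> nat" where \<chi>: "card H0 \<le> k ^ k * card {W \<in> H0. bij_betw \<chi> W {..<k}}"
    using rainbow_colouring[OF V, of H0 k] H0 k by fastforce
  define H where "H a b = {W \<in> H0. bij_betw \<chi> W {..<k} \<and> (\<forall>v\<in>X. insert v (restr \<chi> W ({..<k} - {a})) \<in> E) \<and>
      (\<forall>v\<in>Y. insert v (restr \<chi> W ({..<k} - {b})) \<in> E)}" for a b
  have sub: "{W \<in> H0. bij_betw \<chi> W {..<k}} \<subseteq> (\<Union>(a, b)\<in>{..<k} \<times> {..<k}. H a b)"
  proof
    fix W assume "W \<in> {W \<in> H0. bij_betw \<chi> W {..<k}}"
    then have W: "W \<in> H0" "bij_betw \<chi> W {..<k}" by auto
    obtain x y where xy: "x \<in> W" "y \<in> W" "\<forall>v\<in>X. insert v (W - {x}) \<in> E" "\<forall>v\<in>Y. insert v (W - {y}) \<in> E"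
      using XY[OF W(1)] by blast
    have r: "restr \<chi> W ({..<k} - {\<chi> z}) = W - {z}" if "z \<in> W" for z
      using that bij_betwE[OF W(2)] bij_betw_imp_inj_on[OF W(2)] by (auto simp: restr_def dest: inj_onD)
    have "W \<in> H (\<chi> x) (\<chi> y)" unfolding H_def using W xy r[OF xy(1)] r[OF xy(2)] by simp
    then show "W \<in> (\<Union>(a, b)\<in>{..<k} \<times> {..<k}. H a b)" using bij_betwE[OF W(2)] xy by blast
  qed
  have each: "card (H a b) \<le> N * card V ^ (k - 1)" for a b
  proof -
    have "card (H a b) \<le> N * card (shadow (H a b))"
    proof (rule few_crossings_coloured[OF E no U, where a = a and b = b and \<chi> = \<chi>])
      show "finite (H a b)" using fH0 by (simp add: H_def)
      show "finite W \<and> card W = k \<and> W \<inter> (X \<union> Y) = {}" if "W \<in> H a b" for W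
        using that H0[of W] V finite_subset[of W V] by (auto simp: H_def)
    qed (auto simp: H_def)
    also have "\<dots> \<le> N * card V ^ (k - 1)"
      using H0 by (intro mult_le_mono2 card_shadow_le[OF V]) (auto simp: H_def)
    finally show ?thesis .
  qed
  have "card {W \<in> H0. bij_betw \<chi> W {..<k}} \<le> card (\<Union>(a, b)\<in>{..<k} \<times> {..<k}. H a b)"
    using sub fH0 by (intro card_mono) (auto simp: H_def)
  also have "\<dots> \<le> (\<Sum>(a, b)\<in>{..<k} \<times> {..<k}. card (H a b))"
    using card_UN_le[of "{..<k} \<times> {..<k}" "\<lambda>(a, b). H a b"] by (simp add: case_prod_beta)
  also have "\<dots> \<le> (\<Sum>(a, b)\<in>{..<k} \<times> {..<k}. N * card V ^ (k - 1))" using each by (intro sum_mono) auto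
  also have "\<dots> = k\<^sup>2 * (N * card V ^ (k - 1))" by (simp add: power2_eq_square)
  finally have "k ^ k * card {W \<in> H0. bij_betw \<chi> W {..<k}} \<le> k ^ k * (k\<^sup>2 * (N * card V ^ (k - 1)))" by (rule mult_le_mono2)
  then have "card H0 \<le> k ^ k * (k\<^sup>2 * (N * card V ^ (k - 1)))" using \<chi> by linarith
  then show ?thesis by (simp only: power_add mult.assoc)
qed

lemma card_le_of_no_cycles:
  fixes E :: "'v set set"
  assumes V: "finite V" and E: "\<And>e. e \<in> E \<Longrightarrow> e \<subseteq> V \<and> card e = k" and no: "\<not> cycle_system k I l E"
  shows "card E \<le> N * card (shadow E)"
proof (rule ccontr)
  assume "\<not> ?thesis"
  then have "card E > N * card (shadow E)" by simp
  moreover have "finite E" using V E by (intro finite_subset[of E "Pow V"]) auto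
  moreover have "finite e \<and> card e = k" if "e \<in> E" for e using E[OF that] V finite_subset by auto
  ultimately have "cycle_system k I l E" using full_cycles[OF I(1) l, where E = E and k = k and N = N] N_bounds(1) k by auto
  then show False using no by simp
qed

end

lemma card_lists_set_eq:
  assumes "finite f" shows "card {u. set u = f \<and> length u = card f} = fact (card f)"
proof -
  have "{u. set u = f \<and> length u = card f} = {xs. length xs = card f \<and> distinct xs \<and> set xs \<subseteq> f}"
  proof (intro equalityI subsetI)
    fix u assume "u \<in> {u. set u = f \<and> length u = card f}"
    then show "u \<in> {xs. length xs = card f \<and> distinct xs \<and> set xs \<subseteq> f}" using card_distinct[of u] by simp
  next
    fix u assume "u \<in> {xs. length xs = card f \<and> distinct xs \<and> set xs \<subseteq> f}"
    then show "u \<in> {u. set u = f \<and> length u = card f}"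
      using distinct_card[of u] card_subset_eq[OF assms, of "set u"] by simp
  qed
  then have "card {u. set u = f \<and> length u = card f} = \<Prod> {card f - card f + 1..card f}"
    using card_lists_distinct_length_eq[OF assms, of "card f"] by simp
  then show ?thesis by (simp add: fact_prod)
qed

text \<open>Pascal's rule applied t times. It shows that a family as large as the construction has
  on average almost t edges per (k-1)-set.\<close>

lemma choose_diff_ge: "t \<le> n \<Longrightarrow> t * ((n - t) choose p) + ((n - t) choose Suc p) \<le> n choose Suc p"
proof (induction t)
  case (Suc t)
  then have e: "n - t = Suc (n - Suc t)" by simp
  have "Suc t * ((n - Suc t) choose p) + ((n - Suc t) choose Suc p) = t * ((n - Suc t) choose p) + ((n - t) choose Suc p)"
    by (simp add: e)
  also have "\<dots> \<le> t * ((n - t) choose p) + ((n - t) choose Suc p)"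
    by (intro add_right_mono mult_le_mono2 binomial_right_mono) simp
  finally show ?case using Suc by simp
qed simp

context cycle_lengths
begin

section \<open>Counting edges by their links outside a set of centres\<close>

context
  fixes V :: "'v set" and E :: "'v set set" and L :: "'v set" and m :: nat
  assumes V: "finite V" "card V \<ge> 1" and E: "\<And>e. e \<in> E \<Longrightarrow> e \<subseteq> V \<and> card e = k" and no: "\<not> cycle_system k I l E"
    and L: "L \<subseteq> V" "card L \<le> m"
begin

text \<open>$L$ will be a bounded set of centres that few edges avoid.\<close>

definition neighbours :: "'v set \<Rightarrow> 'v set" where "neighbours f = {v \<in> L. insert v f \<in> E}"
definition outer :: "'v set set" where "outer = {f. f \<subseteq> V - L \<and> card f = k - 1}"
definition heavy :: "'v set set" where "heavy = {f \<in> outer. card (neighbours f) > t}"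
definition light :: "'v set set" where "light = {f \<in> outer. card (neighbours f) < t}"
definition typical :: "'v set set" where "typical = {f \<in> outer. card (neighbours f) = t}"

lemma fin: "finite L" "finite E" "finite outer" "finite heavy" "finite light" "finite typical" "finite (neighbours f)"
proof -
  show "finite L" using V L finite_subset by blast
  then show "finite (neighbours f)" by (simp add: neighbours_def)
  show "finite E" using V E by (intro finite_subset[of E "Pow V"]) auto
  show "finite outer" using V by (simp add: outer_def finite_uniform)
  then show "finite heavy" "finite light" "finite typical" by (auto simp: heavy_def light_def typical_def)
qed

lemma edge_finite: "e \<in> E \<Longrightarrow> finite e \<and> card e = k" using E[of e] V(1) finite_subset[of e V] by auto

lemma outerD: "f \<in> outer \<Longrightarrow> finite f \<and> card f = k - 1 \<and> f \<subseteq> V \<and> f \<inter> L = {}"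
  using V finite_subset[of f V] by (auto simp: outer_def)

lemma neighbours_subset: "neighbours f \<subseteq> L" "card (neighbours f) \<le> m"
  using card_mono[OF fin(1), of "neighbours f"] L by (auto simp: neighbours_def)

lemma card_Pow_L: "card (Pow L) \<le> 2 ^ m"
  using fin(1) L(2) by (simp add: card_Pow power_increasing)

lemma card_heavy: "card heavy \<le> 2 ^ m * N * card V ^ (k - 2)"
proof -
  define H where "H U = {f \<in> outer. U \<subseteq> neighbours f}" for U
  define \<U> where "\<U> = {U \<in> Pow L. card U = t + 1}"
  have f\<U>: "finite \<U>" "card \<U> \<le> 2 ^ m"
  proof -
    have sub: "\<U> \<subseteq> Pow L" by (auto simp: \<U>_def)
    have fp: "finite (Pow L)" using fin(1) by simp
    show "finite \<U>" by (rule finite_subset[OF sub fp])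
    show "card \<U> \<le> 2 ^ m" using card_mono[OF fp sub] card_Pow_L by linarith
  qed
  have "heavy \<subseteq> (\<Union>U\<in>\<U>. H U)"
  proof
    fix f assume f: "f \<in> heavy"
    then have "t + 1 \<le> card (neighbours f)" by (simp add: heavy_def)
    then obtain U where U: "U \<subseteq> neighbours f" "card U = t + 1" by (meson obtain_subset_with_card_n)
    then show "f \<in> (\<Union>U\<in>\<U>. H U)" using f neighbours_subset(1) by (auto simp: \<U>_def H_def heavy_def)
  qed
  then have "card heavy \<le> card (\<Union>U\<in>\<U>. H U)" using f\<U> fin by (intro card_mono) (auto simp: H_def)
  also have "\<dots> \<le> (\<Sum>U\<in>\<U>. card (H U))" by (rule card_UN_le[OF f\<U>(1)])
  also have "\<dots> \<le> (\<Sum>U\<in>\<U>. N * card V ^ (k - 2))"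
  proof (rule sum_mono)
    fix U assume U: "U \<in> \<U>"
    have "card (H U) \<le> N * card (shadow (H U))"
    proof (rule few_common_links[OF edge_finite no])
      show "finite U" "card U \<ge> t + 1" using U fin(1) finite_subset by (auto simp: \<U>_def)
      show "finite (H U)" using fin by (simp add: H_def)
      show "finite f \<and> card f = k - 1 \<and> f \<inter> U = {}" if "f \<in> H U" for f
        using outerD[of f] that U by (auto simp: H_def \<U>_def)
      show "insert v f \<in> E" if "f \<in> H U" "v \<in> U" for f v using that by (auto simp: H_def neighbours_def)
    qed
    also have "card (shadow (H U)) \<le> card V ^ (k - 1 - 1)"
      using outerD by (intro card_shadow_le[OF V(1)]) (auto simp: H_def)
    also have "k - 1 - 1 = k - 2" by simp
    finally show "card (H U) \<le> N * card V ^ (k - 2)" by simp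
  qed
  also have "\<dots> \<le> 2 ^ m * (N * card V ^ (k - 2))" using f\<U>(2) by simp
  finally show ?thesis by (simp add: mult.assoc)
qed

text \<open>An edge that meets \<open>L\<close> but not \<open>T\<close> either has two vertices in
  \<open>L\<close>, which costs only n^(k-2), or is an outer set together with a neighbour outside
  \<open>T\<close>.\<close>

lemma edges_avoiding:
  assumes T: "T \<subseteq> L" and S: "S = {f \<in> outer. \<not> neighbours f \<subseteq> T}"
  shows "card {e \<in> E. e \<inter> T = {}} \<le> card {e \<in> E. e \<inter> L = {}} + m\<^sup>2 * card V ^ (k - 2) + (\<Sum>f\<in>S. card (neighbours f))"
proof -
  define X where "X = (\<lambda>(u, v). {e. e \<subseteq> V \<and> card e = k \<and> {u, v} \<subseteq> e})"
  define P where "P = {(u, v) \<in> L \<times> L. u \<noteq> v}"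
  have fP: "finite P" "card P \<le> m\<^sup>2"
  proof -
    have "P \<subseteq> L \<times> L" by (auto simp: P_def)
    then show "finite P" using fin(1) finite_subset by blast
    have "card P \<le> card (L \<times> L)" using \<open>P \<subseteq> L \<times> L\<close> fin(1) by (intro card_mono) auto
    also have "\<dots> \<le> m * m" using L(2) by (simp add: card_cartesian_product mult_le_mono)
    finally show "card P \<le> m\<^sup>2" by (simp add: power2_eq_square)
  qed
  have fS: "finite S" using fin by (simp add: S)
  have fX: "finite (X p)" for p using V by (cases p) (simp add: X_def finite_uniform)
  define Y where "Y = (\<lambda>(f, v). insert v f) ` (SIGMA f:S. neighbours f)"
  have fY: "finite Y" using fS fin by (auto simp: Y_def)
  have "card Y \<le> card (SIGMA f:S. neighbours f)" unfolding Y_def using fS fin by (intro card_image_le) auto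
  then have cY: "card Y \<le> (\<Sum>f\<in>S. card (neighbours f))" using fS fin by simp
  have "{e \<in> E. e \<inter> T = {}} \<subseteq> {e \<in> E. e \<inter> L = {}} \<union> (\<Union>p\<in>P. X p) \<union> Y"
  proof
    fix e assume "e \<in> {e \<in> E. e \<inter> T = {}}"
    then have e: "e \<in> E" "e \<inter> T = {}" by auto
    show "e \<in> {e \<in> E. e \<inter> L = {}} \<union> (\<Union>p\<in>P. X p) \<union> Y"
    proof (cases "e \<inter> L = {} \<or> (\<exists>u\<in>e \<inter> L. \<exists>v\<in>e \<inter> L. u \<noteq> v)")
      case True
      then show ?thesis
      proof
        assume "\<exists>u\<in>e \<inter> L. \<exists>v\<in>e \<inter> L. u \<noteq> v"
        then obtain u v where "u \<in> e \<inter> L" "v \<in> e \<inter> L" "u \<noteq> v" by blast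
        then have "(u, v) \<in> P" "e \<in> X (u, v)" using E[OF e(1)] by (auto simp: P_def X_def)
        then show ?thesis by blast
      qed (use e in blast)
    next
      case False
      then obtain v where v: "e \<inter> L = {v}" by blast
      define f where "f = e - {v}"
      have ve: "v \<in> e" "v \<in> L" using v by auto
      have eq: "insert v f = e" using ve by (auto simp: f_def)
      have "f \<in> outer" using E[OF e(1)] edge_finite[OF e(1)] v ve by (auto simp: f_def outer_def)
      moreover have "v \<in> neighbours f" using ve eq e(1) by (simp add: neighbours_def)
      moreover have "v \<notin> T" using ve e(2) by auto
      ultimately have "f \<in> S" "v \<in> neighbours f" by (auto simp: S)
      then have "insert v f \<in> Y" unfolding Y_def by (intro image_eqI[of _ _ "(f, v)"]) auto
      then show ?thesis using eq by simp
    qed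
  qed
  then have "card {e \<in> E. e \<inter> T = {}} \<le> card ({e \<in> E. e \<inter> L = {}} \<union> (\<Union>p\<in>P. X p) \<union> Y)"
    using fin fP fX fY by (intro card_mono) auto
  also have "\<dots> \<le> card {e \<in> E. e \<inter> L = {}} + card (\<Union>p\<in>P. X p) + card Y"
    by (meson add_mono_thms_linordered_semiring(1) card_Un_le le_trans order_refl)
  also have "card (\<Union>p\<in>P. X p) \<le> (\<Sum>p\<in>P. card (X p))" by (rule card_UN_le[OF fP(1)])
  also have "(\<Sum>p\<in>P. card (X p)) \<le> (\<Sum>p\<in>P. card V ^ (k - 2))"
  proof (rule sum_mono)
    fix p assume "p \<in> P"
    then obtain u v where p: "p = (u, v)" "u \<noteq> v" by (auto simp: P_def)
    then show "card (X p) \<le> card V ^ (k - 2)"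
      using card_supersets_le[OF V(1), of "{u, v}" k] k by (simp add: X_def numeral_2_eq_2)
  qed
  also have "(\<Sum>p\<in>P. card V ^ (k - 2)) \<le> m\<^sup>2 * card V ^ (k - 2)" using fP(2) by simp
  finally show ?thesis using cY by linarith
qed

lemma card_outer: "card outer \<le> card V choose (k - 1)" "(card V - m) choose (k - 1) \<le> card outer"
  "card typical + card light + card heavy = card outer"
proof -
  have c: "card outer = (card V - card L) choose (k - 1)"
    unfolding outer_def using V L fin(1) by (simp add: n_subsets card_Diff_subset)
  show "card outer \<le> card V choose (k - 1)" unfolding c by (rule binomial_right_mono) simp
  show "(card V - m) choose (k - 1) \<le> card outer" unfolding c using L(2) by (intro binomial_right_mono) simp
  have "outer = typical \<union> light \<union> heavy" "typical \<inter> light = {}" "(typical \<union> light) \<inter> heavy = {}" by (auto simp: typical_def light_def heavy_def)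
  then show "card typical + card light + card heavy = card outer" using fin by (simp add: card_Un_disjoint)
qed

text \<open>Edges are counted through their links: at most t for an outer set, at least one less for
  a light one, up to m for a heavy one. Compared with a lower bound for \<open>card E\<close> this
  limits the light sets.\<close>

lemma card_light:
  "card E + card light \<le> t * (card V choose (k - 1)) + m * card heavy + card {e \<in> E. e \<inter> L = {}} + m\<^sup>2 * card V ^ (k - 2)"
proof -
  define S where "S = {f \<in> outer. \<not> neighbours f \<subseteq> {}}"
  have "card {e \<in> E. e \<inter> {} = {}} \<le> card {e \<in> E. e \<inter> L = {}} + m\<^sup>2 * card V ^ (k - 2) + (\<Sum>f\<in>S. card (neighbours f))"
    by (rule edges_avoiding[OF _ S_def]) simp
  then have 1: "card E \<le> card {e \<in> E. e \<inter> L = {}} + m\<^sup>2 * card V ^ (k - 2) + (\<Sum>f\<in>S. card (neighbours f))" by simp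
  have "(\<Sum>f\<in>S. card (neighbours f)) \<le> (\<Sum>f\<in>outer. card (neighbours f))" using fin by (intro sum_mono2) (auto simp: S_def)
  moreover have "(\<Sum>f\<in>outer. card (neighbours f)) + card light \<le> t * card outer + m * card heavy"
  proof -
    have "(\<Sum>f\<in>outer. card (neighbours f)) + (\<Sum>f\<in>outer. if f \<in> light then 1 else 0) = (\<Sum>f\<in>outer. card (neighbours f) + (if f \<in> light then 1 else 0))"
      by (simp add: sum.distrib)
    also have "\<dots> \<le> (\<Sum>f\<in>outer. t + (if f \<in> heavy then m else 0))"
    proof (rule sum_mono)
      fix f assume f: "f \<in> outer"
      show "card (neighbours f) + (if f \<in> light then 1 else 0) \<le> t + (if f \<in> heavy then m else 0)"
        using neighbours_subset(2)[of f] f by (auto simp: light_def heavy_def)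
    qed
    also have "\<dots> = t * card outer + (\<Sum>f\<in>outer. if f \<in> heavy then m else 0)" by (simp add: sum.distrib)
    also have "(\<Sum>f\<in>outer. if f \<in> heavy then m else 0) = (\<Sum>f\<in>heavy. m)"
    proof -
      have "outer \<inter> heavy = heavy" by (auto simp: heavy_def)
      then show ?thesis using sum.inter_restrict[OF fin(3), of "\<lambda>_. m" heavy] by simp
    qed
    also have "(\<Sum>f\<in>outer. if f \<in> light then 1 else 0) = (\<Sum>f\<in>light. 1::nat)"
    proof -
      have "outer \<inter> light = light" by (auto simp: light_def)
      then show ?thesis using sum.inter_restrict[OF fin(3), of "\<lambda>_. 1::nat" light] by simp
    qed
    finally show ?thesis by (simp add: mult.commute)
  qed
  moreover have "t * card outer \<le> t * (card V choose (k - 1))" using card_outer(1) by (rule mult_le_mono2)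
  ultimately show ?thesis using 1 by linarith
qed

text \<open>Lists with a repeated entry are included, since typical sets have k - 1
  elements.\<close>

definition atypical_lists :: "'v list set" where "atypical_lists = {u \<in> lists_of V (k - 1). set u \<notin> typical}"
definition jumps :: "'v list set" where
  "jumps = {w \<in> lists_of V (Suc (k - 1)). set (take (k - 1) w) \<in> typical \<and> set (tl w) \<in> typical \<and> neighbours (set (take (k - 1) w)) \<noteq> neighbours (set (tl w))}"

lemma card_atypical_lists: "card atypical_lists + fact (k - 1) * card typical \<le> card V ^ (k - 1)"
proof -
  define G where "G f = {u. set u = f \<and> length u = card f}" for f :: "'v set"
  have "card (\<Union>f\<in>typical. G f) = (\<Sum>f\<in>typical. card (G f))"
  proof (rule card_UN_disjoint[OF fin(6)])
    show "\<forall>f\<in>typical. finite (G f)" using outerD finite_lists_length_eq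
      by (auto simp: G_def typical_def intro: finite_subset[OF _ finite_lists_length_eq[OF V(1)]])
    show "\<forall>f\<in>typical. \<forall>g\<in>typical. f \<noteq> g \<longrightarrow> G f \<inter> G g = {}" by (auto simp: G_def)
  qed
  also have "\<dots> = (\<Sum>f\<in>typical. fact (k - 1))"
  proof (rule sum.cong[OF refl])
    fix f assume "f \<in> typical"
    then have "finite f" "card f = k - 1" using outerD[of f] by (auto simp: typical_def)
    then show "card (G f) = fact (k - 1)" using card_lists_set_eq[of f] by (simp add: G_def)
  qed
  finally have 1: "card (\<Union>f\<in>typical. G f) = fact (k - 1) * card typical" by simp
  have sub: "atypical_lists \<union> (\<Union>f\<in>typical. G f) \<subseteq> lists_of V (k - 1)" 
  proof (rule Un_least)
    show "atypical_lists \<subseteq> lists_of V (k - 1)" by (auto simp: atypical_lists_def)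
    show "(\<Union>f\<in>typical. G f) \<subseteq> lists_of V (k - 1)"
    proof
      fix u assume "u \<in> (\<Union>f\<in>typical. G f)"
      then obtain f where f: "f \<in> outer" "u \<in> G f" by (auto simp: typical_def)
      then show "u \<in> lists_of V (k - 1)" using outerD[OF f(1)] by (simp add: G_def)
    qed
  qed
  have fL: "finite (lists_of V (k - 1))" by (rule finite_lists_length_eq[OF V(1)])
  have "card (atypical_lists \<union> (\<Union>f\<in>typical. G f)) = card atypical_lists + card (\<Union>f\<in>typical. G f)"
    using finite_subset[OF sub fL] by (intro card_Un_disjoint) (auto simp: atypical_lists_def G_def)
  moreover have "card (atypical_lists \<union> (\<Union>f\<in>typical. G f)) \<le> card V ^ (k - 1)"
    using card_mono[OF fL sub] card_lists_length_eq[OF V(1)] by simp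
  ultimately show ?thesis using 1 by simp
qed

text \<open>The set of a jump is a k-set with two links whose t-element neighbourhoods
  \<open>X\<close> and \<open>Y\<close> differ. Their union has more than t centres, so
  \<open>few_crossings\<close> applies. The other factors count the choices of \<open>(X, Y)\<close>
  and the lists over one k-set.\<close>

lemma card_jumps: "card jumps \<le> 2 ^ m * 2 ^ m * (k ^ (k + 2) * N * card V ^ (k - 1)) * k ^ k"
proof -
  define H where "H = (\<lambda>(X, Y). {W. W \<subseteq> V - L \<and> card W = k \<and>
      (\<exists>x\<in>W. \<exists>y\<in>W. (\<forall>v\<in>X. insert v (W - {x}) \<in> E) \<and> (\<forall>v\<in>Y. insert v (W - {y}) \<in> E))})"
  define Q where "Q = {(X, Y) \<in> Pow L \<times> Pow L. card (X \<union> Y) \<ge> t + 1}"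
  have fQ: "finite Q" "card Q \<le> 2 ^ m * 2 ^ m"
  proof -
    have sub: "Q \<subseteq> Pow L \<times> Pow L" by (auto simp: Q_def)
    have fp: "finite (Pow L \<times> Pow L)" using fin(1) by simp
    show "finite Q" by (rule finite_subset[OF sub fp])
    have "card Q \<le> card (Pow L \<times> Pow L)" by (rule card_mono[OF fp sub])
    also have "\<dots> = card (Pow L) * card (Pow L)" by (rule card_cartesian_product)
    also have "\<dots> \<le> 2 ^ m * 2 ^ m" using card_Pow_L by (intro mult_le_mono)
    finally show "card Q \<le> 2 ^ m * 2 ^ m" .
  qed
  have fH: "finite (H p)" for p using V finite_uniform[of V] by (cases p) (auto simp: H_def intro!: finite_subset[OF _ finite_Pow_iff[THEN iffD2, OF V(1)]])
  define G where "G p = (\<Union>W\<in>H p. {w. set w \<subseteq> W \<and> length w = k})" for p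
  have Wf: "finite W" "card W = k" if "W \<in> H p" for W p
    using that V finite_subset[of W V] by (cases p, auto simp: H_def)+
  have cH: "card (H p) \<le> k ^ (k + 2) * N * card V ^ (k - 1)" if p: "p \<in> Q" for p
  proof -
    obtain X Y where XY: "p = (X, Y)" "X \<subseteq> L" "Y \<subseteq> L" "card (X \<union> Y) \<ge> t + 1" using p by (auto simp: Q_def)
    show ?thesis
    proof (rule few_crossings[OF V(1) edge_finite no _ XY(4)])
      show "finite (X \<union> Y)" using XY fin(1) finite_subset by blast
      show "W \<subseteq> V \<and> card W = k \<and> W \<inter> (X \<union> Y) = {}" if "W \<in> H p" for W using that XY by (auto simp: H_def)
      show "\<exists>x\<in>W. \<exists>y\<in>W. (\<forall>v\<in>X. insert v (W - {x}) \<in> E) \<and> (\<forall>v\<in>Y. insert v (W - {y}) \<in> E)" if "W \<in> H p" for W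
        using that XY by (auto simp: H_def)
    qed
  qed
  have cG: "finite (G p) \<and> card (G p) \<le> (k ^ (k + 2) * N * card V ^ (k - 1)) * k ^ k" if p: "p \<in> Q" for p
  proof
    show "finite (G p)" unfolding G_def using fH Wf finite_lists_length_eq by blast
    have "card (G p) \<le> (\<Sum>W\<in>H p. card {w. set w \<subseteq> W \<and> length w = k})" unfolding G_def by (rule card_UN_le[OF fH])
    also have "\<dots> = (\<Sum>W\<in>H p. k ^ k)" using Wf by (intro sum.cong) (auto simp: card_lists_length_eq)
    also have "\<dots> \<le> (k ^ (k + 2) * N * card V ^ (k - 1)) * k ^ k" using cH[OF p] by simp
    finally show "card (G p) \<le> (k ^ (k + 2) * N * card V ^ (k - 1)) * k ^ k" .
  qed
  have "jumps \<subseteq> (\<Union>p\<in>Q. G p)"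
  proof
    fix w assume "w \<in> jumps"
    then have w: "set w \<subseteq> V" "length w = k" "set (take (k - 1) w) \<in> typical" "set (tl w) \<in> typical"
      "neighbours (set (take (k - 1) w)) \<noteq> neighbours (set (tl w))" using k by (auto simp: jumps_def)
    define f g where "f = set (take (k - 1) w)" and "g = set (tl w)"
    define X Y where "X = neighbours f" and "Y = neighbours g"
    have fg: "f \<in> outer" "g \<in> outer" "card X = t" "card Y = t" "X \<noteq> Y" using w by (auto simp: f_def g_def X_def Y_def typical_def)
    have cf: "card f = k - 1" "card g = k - 1" "finite f" "finite g" "f \<subseteq> V - L" "g \<subseteq> V - L"
      using outerD[OF fg(1)] outerD[OF fg(2)] by auto
    have "card (X \<union> Y) \<ge> t + 1"
    proof -
      have "X \<subset> X \<union> Y"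
      proof (rule ccontr)
        assume "\<not> ?thesis"
        then have "Y \<subseteq> X" by blast
        then show False using fg fin(7)[of f] card_subset_eq[of X Y] by (auto simp: X_def)
      qed
      then have "card X < card (X \<union> Y)" using fin(7) by (intro psubset_card_mono) (auto simp: X_def Y_def)
      then show ?thesis using fg by simp
    qed
    then have Q: "(X, Y) \<in> Q" using neighbours_subset(1) by (auto simp: Q_def X_def Y_def)
    define W where "W = set w"
    have "W = f \<union> g"
    proof -
      obtain a u where au: "w = a # u" using w(2) k by (cases w) auto
      have "take (k - 1) w = a # take (k - 2) u" using au k by (simp add: take_Cons' diff_diff_add numeral_2_eq_2)
      then have "a \<in> f" by (simp add: f_def)
      moreover have "g = set u" using au by (simp add: g_def)
      moreover have "f \<subseteq> W" using set_take_subset by (auto simp: f_def W_def dest: in_set_takeD)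
      ultimately show ?thesis using au by (auto simp: W_def)
    qed
    \<comment> \<open>Since the neighbourhoods differ, \<open>f\<close> and \<open>g\<close> are
      distinct sets of size k - 1; so \<open>w\<close> has k distinct entries, and each of the two
      sets omits one element of \<open>W\<close>.\<close>
    have "f \<noteq> g" using fg by (auto simp: X_def Y_def)
    have "card W \<le> k" using card_length[of w] w(2) by (simp add: W_def)
    have "f \<subset> W"
    proof (rule ccontr)
      assume "\<not> ?thesis"
      then have "g \<subseteq> f" using \<open>W = f \<union> g\<close> by blast
      then have "g = f" using cf by (intro card_subset_eq) auto
      then show False using \<open>f \<noteq> g\<close> by simp
    qed
    then have "card f < card W" using cf \<open>W = f \<union> g\<close> by (intro psubset_card_mono) auto
    then have cW: "card W = k" "finite W" using \<open>card W \<le> k\<close> cf \<open>W = f \<union> g\<close> by auto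
    have rem: "\<exists>x\<in>W. h = W - {x}" if h: "h \<subseteq> W" "card h = k - 1" for h
    proof -
      have "card (W - h) = 1" using h cW k finite_subset[OF h(1)] by (simp add: card_Diff_subset)
      then obtain x where "W - h = {x}" by (auto simp: card_1_singleton_iff)
      then show ?thesis using h by blast
    qed
    obtain x y where "x \<in> W" "f = W - {x}" "y \<in> W" "g = W - {y}"
      using rem[of f] rem[of g] cf \<open>W = f \<union> g\<close> by blast
    moreover have "\<forall>v\<in>X. insert v f \<in> E" "\<forall>v\<in>Y. insert v g \<in> E" by (auto simp: X_def Y_def neighbours_def)
    ultimately have "\<exists>x\<in>W. \<exists>y\<in>W. (\<forall>v\<in>X. insert v (W - {x}) \<in> E) \<and> (\<forall>v\<in>Y. insert v (W - {y}) \<in> E)" by blast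
    then have "W \<in> H (X, Y)" using cW cf \<open>W = f \<union> g\<close> by (auto simp: H_def)
    then have "w \<in> G (X, Y)" using w(2) by (auto simp: G_def W_def)
    then show "w \<in> (\<Union>p\<in>Q. G p)" using Q by blast
  qed
  then have "card jumps \<le> card (\<Union>p\<in>Q. G p)" using fQ(1) cG by (intro card_mono) auto
  also have "\<dots> \<le> (\<Sum>p\<in>Q. card (G p))" by (rule card_UN_le[OF fQ(1)])
  also have "\<dots> \<le> (\<Sum>p\<in>Q. (k ^ (k + 2) * N * card V ^ (k - 1)) * k ^ k)" using cG by (intro sum_mono) auto
  also have "\<dots> = card Q * ((k ^ (k + 2) * N * card V ^ (k - 1)) * k ^ k)" by simp
  also have "\<dots> \<le> (2 ^ m * 2 ^ m) * ((k ^ (k + 2) * N * card V ^ (k - 1)) * k ^ k)" using fQ(2) by (rule mult_le_mono1)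
  finally show ?thesis by (simp only: mult.assoc)
qed

text \<open>\<open>T\<close> is the neighbourhood shared by most typical sets, which exists by
  \<open>almost_constant_colouring\<close>. Each outer set joined to a centre outside
  \<open>T\<close> yields a different exceptional list, and it contributes at most t edges unless it
  is heavy.\<close>

lemma stability_core:
  assumes b: "b = k * card atypical_lists * card V ^ (k - 1) + (k - 1) * card jumps * card V ^ (k - 2)"
    and lt: "b < card V ^ (2 * (k - 1))"
  shows "\<exists>T \<subseteq> V. card T = t \<and> card {e \<in> E. e \<inter> T = {}} * card V ^ (k - 1) \<le>
    (card {e \<in> E. e \<inter> L = {}} + m\<^sup>2 * card V ^ (k - 2) + m * card heavy) * card V ^ (k - 1) + t * b"
proof -
  have kk: "k - 1 + 1 = k" "k - 1 - 1 = k - 2" using k by auto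
  have "\<exists>f0 \<in> typical. card {u \<in> lists_of V (k - 1). \<not> (set u \<in> typical \<and> neighbours (set u) = neighbours f0)} * card V ^ (k - 1) \<le> b"
  proof (rule almost_constant_colouring[OF V _ atypical_lists_def jumps_def _ lt])
    show "1 \<le> k - 1" using k by simp
    show "b = (k - 1 + 1) * card atypical_lists * card V ^ (k - 1) + (k - 1) * card jumps * card V ^ (k - 1 - 1)" by (simp only: kk b)
  qed
  then obtain f0 where f0: "f0 \<in> typical" "card {u \<in> lists_of V (k - 1). \<not> (set u \<in> typical \<and> neighbours (set u) = neighbours f0)} * card V ^ (k - 1) \<le> b" by blast
  define T where "T = neighbours f0"
  define S where "S = {f \<in> outer. \<not> neighbours f \<subseteq> T}"
  define B where "B = {u \<in> lists_of V (k - 1). \<not> (set u \<in> typical \<and> neighbours (set u) = neighbours f0)}"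
  have fS: "finite S" using fin by (simp add: S_def)
  have "card S \<le> card B"
  proof -
    have "\<exists>u. set u = f \<and> length u = k - 1" if "f \<in> S" for f
      using outerD[of f] that finite_distinct_list[of f] by (auto simp: S_def distinct_card)
    then obtain h where h: "\<And>f. f \<in> S \<Longrightarrow> set (h f) = f \<and> length (h f) = k - 1" by metis
    have "inj_on h S" using h by (metis inj_onI)
    moreover have "h ` S \<subseteq> B"
    proof
      fix u assume "u \<in> h ` S"
      then obtain f where f: "f \<in> S" "u = h f" by blast
      then show "u \<in> B" using h[OF f(1)] outerD[of f] by (auto simp: B_def S_def T_def)
    qed
    moreover have "finite B" by (rule finite_subset[OF _ finite_lists_length_eq[OF V(1), of "k - 1"]]) (auto simp: B_def)
    ultimately show ?thesis by (rule card_inj_on_le)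
  qed
  then have cS: "card S * card V ^ (k - 1) \<le> b" using f0(2) by (metis B_def le_trans mult_le_mono1)
  have "(\<Sum>f\<in>S. card (neighbours f)) \<le> (\<Sum>f\<in>S. t + (if f \<in> heavy then m else 0))"
  proof (rule sum_mono)
    fix f assume "f \<in> S"
    then show "card (neighbours f) \<le> t + (if f \<in> heavy then m else 0)"
      using neighbours_subset(2)[of f] by (cases "card (neighbours f) > t") (auto simp: S_def heavy_def)
  qed
  also have "\<dots> = t * card S + (\<Sum>f\<in>S. if f \<in> heavy then m else 0)" by (simp add: sum.distrib)
  also have "(\<Sum>f\<in>S. if f \<in> heavy then m else 0) = (\<Sum>f\<in>S \<inter> heavy. m)" using sum.inter_restrict[OF fS, of "\<lambda>_. m" heavy] by simp
  also have "\<dots> \<le> m * card heavy" using card_mono[OF fin(4), of "S \<inter> heavy"] by simp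
  finally have sS: "(\<Sum>f\<in>S. card (neighbours f)) \<le> t * card S + m * card heavy" by simp
  have TL: "T \<subseteq> L" "T \<subseteq> V" using neighbours_subset(1) L by (auto simp: T_def)
  have "card {e \<in> E. e \<inter> T = {}} \<le> (card {e \<in> E. e \<inter> L = {}} + m\<^sup>2 * card V ^ (k - 2) + m * card heavy) + t * card S"
    using edges_avoiding[OF TL(1) S_def] sS by linarith
  then have "card {e \<in> E. e \<inter> T = {}} * card V ^ (k - 1) \<le>
    ((card {e \<in> E. e \<inter> L = {}} + m\<^sup>2 * card V ^ (k - 2) + m * card heavy) + t * card S) * card V ^ (k - 1)" by (rule mult_le_mono1)
  also have "\<dots> = (card {e \<in> E. e \<inter> L = {}} + m\<^sup>2 * card V ^ (k - 2) + m * card heavy) * card V ^ (k - 1) + t * (card S * card V ^ (k - 1))"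
    by (simp only: add_mult_distrib mult.assoc)
  also have "\<dots> \<le> (card {e \<in> E. e \<inter> L = {}} + m\<^sup>2 * card V ^ (k - 2) + m * card heavy) * card V ^ (k - 1) + t * b"
    using cS by (intro add_left_mono mult_le_mono2)
  finally show ?thesis using TL f0(1) by (intro exI[of _ T]) (auto simp: T_def typical_def)
qed

text \<open>Bookkeeping in units of e0 q: there are at most 3 units of light sets, and the typical
  sets are at most 5 units short of q / (k-1)!. Hence atypical lists take at most 5 (k-1)! units.
  The jumps account for the summand 1 in \<open>c1\<close>, and c1 e0 <= 1/2 keeps \<open>b\<close>
  below q^2.\<close>

lemma stability_real:
  fixes e0 q c1 :: real
  assumes q: "q = real (card V) ^ (k - 1)" and e0: "e0 > 0"
    and E0: "real (card {e \<in> E. e \<inter> L = {}}) \<le> e0 * q"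
    and b1: "(1 / fact (k - 1) - e0 / real t) * q \<le> real ((card V - t) choose (k - 1))"
    and b2: "(1 / fact (k - 1) - e0) * q \<le> real ((card V - m) choose (k - 1))"
    and d: "real ((m + 1) * (2 ^ m * N) + m\<^sup>2) * real (card V) ^ (k - 2) \<le> e0 * q"
    and e: "real ((k - 1) * (2 ^ m * 2 ^ m * (k ^ (k + 2) * N) * k ^ k)) * real (card V) ^ (k - 2) \<le> e0 * q"
    and nt: "t \<le> card V" and big: "(card V choose k) - ((card V - t) choose k) \<le> card E"
    and c1: "c1 = 5 * real k * fact (k - 1) + 1" "c1 * e0 \<le> 1 / 2"
  shows "\<exists>T \<subseteq> V. card T = t \<and> real (card {e \<in> E. e \<inter> T = {}}) \<le> (2 + real t * c1) * e0 * q"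
proof -
  define n where "n = card V"
  define P where "P = (fact (k - 1) :: real)"
  define r where "r = real n ^ (k - 2)"
  have P: "P > 0" by (simp add: P_def)
  have q0: "q > 0" using V(2) by (simp add: q)
  have r0: "r \<ge> 0" by (simp add: r_def)
  have kk: "Suc (k - 1) = k" using k by simp
  have cM: "real (card heavy) \<le> real (2 ^ m * N) * r"
  proof -
    have "real (card heavy) \<le> real (2 ^ m * N * n ^ (k - 2))" using card_heavy unfolding n_def by (simp only: of_nat_le_iff)
    then show ?thesis by (simp add: r_def)
  qed
  have d': "real (card heavy) + (real m * real (card heavy) + (real m)\<^sup>2 * r) \<le> e0 * q"
  proof -
    have "real (card heavy) + (real m * real (card heavy) + (real m)\<^sup>2 * r) = (real m + 1) * real (card heavy) + (real m)\<^sup>2 * r" by (simp add: algebra_simps)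
    also have "\<dots> \<le> (real m + 1) * (real (2 ^ m * N) * r) + (real m)\<^sup>2 * r" using cM by (intro add_right_mono mult_left_mono) auto
    also have "\<dots> = real ((m + 1) * (2 ^ m * N) + m\<^sup>2) * r" by (simp add: algebra_simps)
    also have "\<dots> \<le> e0 * q" using d by (simp add: r_def n_def)
    finally show ?thesis .
  qed
  have m0: "real m * real (card heavy) \<ge> 0" "(real m)\<^sup>2 * r \<ge> 0" using r0 by auto
  have Cn: "real (n choose (k - 1)) \<le> q / P"
  proof -
    have "real ((n choose (k - 1)) * fact (k - 1)) \<le> real (n ^ (k - 1))" by (simp only: of_nat_le_iff binomial_fact_pow)
    then show ?thesis using P by (simp add: q P_def n_def field_simps)
  qed
  have bigE: "real t * real ((n - t) choose (k - 1)) \<le> real (card E)"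
  proof -
    have "t * ((n - t) choose (k - 1)) + ((n - t) choose Suc (k - 1)) \<le> n choose Suc (k - 1)"
      using choose_diff_ge[of t n "k - 1"] nt by (simp add: n_def)
    then have "t * ((n - t) choose (k - 1)) \<le> card E" using big unfolding kk n_def by linarith
    then have "real (t * ((n - t) choose (k - 1))) \<le> real (card E)" by (simp only: of_nat_le_iff)
    then show ?thesis by simp
  qed
  have cL: "real (card light) \<le> 3 * e0 * q"
  proof -
    have "real (card E + card light) \<le> real (t * (n choose (k - 1)) + m * card heavy + card {e \<in> E. e \<inter> L = {}} + m\<^sup>2 * n ^ (k - 2))"
      using card_light unfolding n_def by (simp only: of_nat_le_iff)
    then have "real (card E) + real (card light) \<le> real t * real (n choose (k - 1)) + real m * real (card heavy) + real (card {e \<in> E. e \<inter> L = {}}) + (real m)\<^sup>2 * r"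
      by (simp add: r_def)
    moreover have "real t * real (n choose (k - 1)) \<le> real t * (q / P)" using Cn by (intro mult_left_mono) auto
    moreover have "real t * ((1 / P - e0 / real t) * q) \<le> real t * real ((n - t) choose (k - 1))"
      using b1 by (intro mult_left_mono) (auto simp: P_def n_def)
    moreover have "real t * ((1 / P - e0 / real t) * q) = real t * (q / P) - e0 * q"
      using t_ge_1 by (simp add: field_simps)
    ultimately show ?thesis using bigE E0 d' by linarith
  qed
  have cT: "real (card typical) \<ge> (1 / P - 5 * e0) * q"
  proof -
    have "real (card typical) + real (card light) + real (card heavy) = real (card outer)" using card_outer(3) by linarith
    moreover have "real ((n - m) choose (k - 1)) \<le> real (card outer)" using card_outer(2) by (simp add: n_def)
    moreover have "(1 / P - 5 * e0) * q = (1 / P - e0) * q - 4 * e0 * q" by (simp add: algebra_simps)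
    ultimately show ?thesis using b2 cL d' m0 unfolding P_def n_def by linarith
  qed
  have cA1: "real (card atypical_lists) \<le> 5 * P * e0 * q"
  proof -
    have "real (card atypical_lists + fact (k - 1) * card typical) \<le> real (n ^ (k - 1))" using card_atypical_lists unfolding n_def by (simp only: of_nat_le_iff)
    then have "real (card atypical_lists) + P * real (card typical) \<le> q" by (simp add: P_def q n_def)
    moreover have "P * ((1 / P - 5 * e0) * q) \<le> P * real (card typical)" using cT P by (intro mult_left_mono) auto
    moreover have "P * ((1 / P - 5 * e0) * q) = q - 5 * P * e0 * q" using P by (simp add: algebra_simps)
    ultimately show ?thesis by linarith
  qed
  define b where "b = k * card atypical_lists * card V ^ (k - 1) + (k - 1) * card jumps * card V ^ (k - 2)"
  have cb: "real b \<le> c1 * e0 * q\<^sup>2"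
  proof -
    have 1: "real (k * card atypical_lists * card V ^ (k - 1)) \<le> 5 * real k * P * e0 * q\<^sup>2"
    proof -
      have "real k * real (card atypical_lists) * q \<le> real k * (5 * P * e0 * q) * q" using cA1 q0 by (intro mult_right_mono mult_left_mono) auto
      then show ?thesis by (simp add: q power2_eq_square mult_ac)
    qed
    have 2: "real ((k - 1) * card jumps * card V ^ (k - 2)) \<le> e0 * q\<^sup>2"
    proof -
      define X where "X = 2 ^ m * 2 ^ m * (k ^ (k + 2) * N) * k ^ k"
      have "card jumps \<le> X * n ^ (k - 1)" using card_jumps by (simp add: X_def n_def mult_ac)
      then have "(k - 1) * card jumps * n ^ (k - 2) \<le> (k - 1) * (X * n ^ (k - 1)) * n ^ (k - 2)" by (intro mult_le_mono) auto
      then have "real ((k - 1) * card jumps * n ^ (k - 2)) \<le> real ((k - 1) * (X * n ^ (k - 1)) * n ^ (k - 2))" by (simp only: of_nat_le_iff)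
      also have "\<dots> = (real ((k - 1) * X) * r) * q" by (simp add: q n_def r_def mult_ac)
      also have "\<dots> \<le> (e0 * q) * q" using e q0 by (intro mult_right_mono) (auto simp: X_def r_def n_def)
      finally show ?thesis by (simp add: n_def power2_eq_square mult_ac)
    qed
    have "real b = real (k * card atypical_lists * card V ^ (k - 1)) + real ((k - 1) * card jumps * card V ^ (k - 2))" by (simp add: b_def)
    also have "\<dots> \<le> 5 * real k * P * e0 * q\<^sup>2 + e0 * q\<^sup>2" using 1 2 by (rule add_mono)
    also have "\<dots> = c1 * e0 * q\<^sup>2" by (simp add: c1 P_def algebra_simps)
    finally show ?thesis .
  qed
  have "real b < q\<^sup>2"
  proof -
    have "c1 * e0 * q\<^sup>2 \<le> 1 / 2 * q\<^sup>2" using c1(2) by (intro mult_right_mono) auto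
    moreover have "1 / 2 * q\<^sup>2 < q\<^sup>2" using q0 by simp
    ultimately show ?thesis using cb by linarith
  qed
  also have "q\<^sup>2 = real (card V ^ (2 * (k - 1)))" by (simp add: q power_mult[symmetric] mult.commute)
  finally have lt: "b < card V ^ (2 * (k - 1))" by (simp only: of_nat_less_iff)
  obtain T where T: "T \<subseteq> V" "card T = t" "card {e \<in> E. e \<inter> T = {}} * card V ^ (k - 1) \<le>
    (card {e \<in> E. e \<inter> L = {}} + m\<^sup>2 * card V ^ (k - 2) + m * card heavy) * card V ^ (k - 1) + t * b"
    using stability_core[OF b_def lt] by blast
  have "real (card {e \<in> E. e \<inter> T = {}}) * q \<le> (real (card {e \<in> E. e \<inter> L = {}}) + (real m)\<^sup>2 * r + real m * real (card heavy)) * q + real t * real b"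
  proof -
    have "real (card {e \<in> E. e \<inter> T = {}} * card V ^ (k - 1)) \<le> real ((card {e \<in> E. e \<inter> L = {}} + m\<^sup>2 * card V ^ (k - 2) + m * card heavy) * card V ^ (k - 1) + t * b)"
      using T(3) by (simp only: of_nat_le_iff)
    then show ?thesis by (simp add: q r_def n_def)
  qed
  also have "\<dots> \<le> (2 * e0 * q) * q + real t * (c1 * e0 * q\<^sup>2)"
  proof (intro add_mono mult_right_mono mult_left_mono cb)
    show "real (card {e \<in> E. e \<inter> L = {}}) + (real m)\<^sup>2 * r + real m * real (card heavy) \<le> 2 * e0 * q" using E0 d' by linarith
  qed (use q0 in auto)
  also have "\<dots> = ((2 + real t * c1) * e0 * q) * q" by (simp add: power2_eq_square algebra_simps)
  finally have "real (card {e \<in> E. e \<inter> T = {}}) \<le> (2 + real t * c1) * e0 * q" using q0 by (simp only: mult_le_cancel_right_pos)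
  then show ?thesis using T by blast
qed

end

text \<open>The centres \<open>L\<close> are the vertices of degree at least \<delta> n^(k-1). As
  cycle-free families have O(n^(k-1)) edges, their number is bounded by a constant, while
  \<open>high_degree\<close> limits the edges that avoid them.\<close>

theorem stability:
  assumes eps: "\<epsilon> > 0"
  shows "\<exists>n0. \<forall>(V :: 'v set) E. finite V \<longrightarrow> card V \<ge> n0 \<longrightarrow> (\<forall>e\<in>E. e \<subseteq> V \<and> card e = k) \<longrightarrow> \<not> cycle_system k I l E \<longrightarrow>
    (card V choose k) - ((card V - t) choose k) \<le> card E \<longrightarrow>
    (\<exists>T \<subseteq> V. card T = t \<and> real (card {e \<in> E. e \<inter> T = {}}) \<le> \<epsilon> * real (card V) ^ (k - 1))"
proof -
  define c1 where "c1 = 5 * real k * fact (k - 1) + 1"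
  define e0 where "e0 = min (1 / (2 * c1)) (\<epsilon> / (2 + real t * c1))"
  have c1: "c1 > 0" by (simp add: c1_def add_nonneg_pos)
  then have e0: "e0 > 0" "c1 * e0 \<le> 1 / 2" "(2 + real t * c1) * e0 \<le> \<epsilon>"
  proof -
    have p: "2 + real t * c1 > 0" using c1 by (simp add: add_pos_nonneg)
    show "e0 > 0" using c1 p eps by (simp add: e0_def)
    have "c1 * e0 \<le> c1 * (1 / (2 * c1))" using c1 by (intro mult_left_mono) (auto simp: e0_def)
    then show "c1 * e0 \<le> 1 / 2" using c1 by simp
    have "(2 + real t * c1) * e0 \<le> (2 + real t * c1) * (\<epsilon> / (2 + real t * c1))" using p by (intro mult_left_mono) (auto simp: e0_def)
    then show "(2 + real t * c1) * e0 \<le> \<epsilon>" using p by simp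
  qed
  define C where "C = k ^ k * (2 ^ (k + 1) * N) ^ (2 ^ k)"
  have C: "C > 0" using k N_bounds(4) by (auto simp: C_def)
  \<comment> \<open>Chosen so that the bound C sqrt \<delta> q of \<open>high_degree\<close> becomes
    e0 q.\<close>
  define \<delta> where "\<delta> = (e0 / real C)\<^sup>2"
  have dl: "\<delta> > 0" using e0 C by (simp add: \<delta>_def)
  \<comment> \<open>The degrees add up to at most k N q, and each centre contributes at least
    \<delta> q.\<close>
  define m where "m = nat \<lceil>real k * real N / \<delta>\<rceil>"
  have kp: "k - 2 < k - 1" using k by simp
  have "1 / fact (k - 1) - e0 / real t < (1 / fact (k - 1) :: real)" using e0 t_ge_1 by simp
  then have v1: "\<forall>\<^sub>F n in sequentially. (1 / fact (k - 1) - e0 / real t) * real n ^ (k - 1) \<le> real ((n - t) choose (k - 1))"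
    by (rule binomial_eventually_ge)
  have "1 / fact (k - 1) - e0 < (1 / fact (k - 1) :: real)" using e0 by simp
  then have v2: "\<forall>\<^sub>F n in sequentially. (1 / fact (k - 1) - e0) * real n ^ (k - 1) \<le> real ((n - m) choose (k - 1))"
    by (rule binomial_eventually_ge)
  have v3: "\<forall>\<^sub>F n in sequentially. real C * real n ^ (k - 2) \<le> e0 * real n ^ (k - 1)"
    and v4: "\<forall>\<^sub>F n in sequentially. real ((m + 1) * (2 ^ m * N) + m\<^sup>2) * real n ^ (k - 2) \<le> e0 * real n ^ (k - 1)"
    and v5: "\<forall>\<^sub>F n in sequentially. real ((k - 1) * (2 ^ m * 2 ^ m * (k ^ (k + 2) * N) * k ^ k)) * real n ^ (k - 2) \<le> e0 * real n ^ (k - 1)"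
    by (rule power_eventually_le[OF e0(1) kp])+
  define good where "good n \<longleftrightarrow> (1 / fact (k - 1) - e0 / real t) * real n ^ (k - 1) \<le> real ((n - t) choose (k - 1)) \<and>
    (1 / fact (k - 1) - e0) * real n ^ (k - 1) \<le> real ((n - m) choose (k - 1)) \<and>
    real C * real n ^ (k - 2) \<le> e0 * real n ^ (k - 1) \<and>
    real ((m + 1) * (2 ^ m * N) + m\<^sup>2) * real n ^ (k - 2) \<le> e0 * real n ^ (k - 1) \<and>
    real ((k - 1) * (2 ^ m * 2 ^ m * (k ^ (k + 2) * N) * k ^ k)) * real n ^ (k - 2) \<le> e0 * real n ^ (k - 1) \<and> t \<le> n \<and> 1 \<le> n" for n
  have "\<forall>\<^sub>F n in sequentially. good n"
    unfolding good_def by (intro eventually_conj v1 v2 v3 v4 v5 eventually_ge_at_top)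
  then obtain n0 where n0: "\<And>n. n \<ge> n0 \<Longrightarrow> good n" unfolding eventually_sequentially by blast
  show ?thesis
  proof (intro exI[of _ n0] allI impI)
    fix V :: "'v set" and E
    assume V: "finite V" "n0 \<le> card V" and E: "\<forall>e\<in>E. e \<subseteq> V \<and> card e = k" and no: "\<not> cycle_system k I l E"
      and big: "(card V choose k) - ((card V - t) choose k) \<le> card E"
    define q where "q = real (card V) ^ (k - 1)"
    from n0[OF V(2)] have g: "(1 / fact (k - 1) - e0 / real t) * q \<le> real ((card V - t) choose (k - 1))"
      "(1 / fact (k - 1) - e0) * q \<le> real ((card V - m) choose (k - 1))"
      "real C * real (card V) ^ (k - 2) \<le> e0 * q"
      "real ((m + 1) * (2 ^ m * N) + m\<^sup>2) * real (card V) ^ (k - 2) \<le> e0 * q"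
      "real ((k - 1) * (2 ^ m * 2 ^ m * (k ^ (k + 2) * N) * k ^ k)) * real (card V) ^ (k - 2) \<le> e0 * q"
      "t \<le> card V" "1 \<le> card V"
      unfolding good_def q_def by blast+
    have q0: "q > 0" using g(7) by (simp add: q_def)
    have E': "e \<subseteq> V \<and> card e = k" if "e \<in> E" for e using E that by blast
    have fE: "finite E" using V(1) E' by (intro finite_subset[of E "Pow V"]) auto
    define L where "L = {v \<in> V. \<delta> * q \<le> real (card {e \<in> E. v \<in> e})}"
    have LV: "L \<subseteq> V" by (auto simp: L_def)
    have fL: "finite L" using LV V(1) finite_subset by blast
    have cL: "card L \<le> m"
    proof -
      have "card E \<le> N * card (shadow E)" by (rule card_le_of_no_cycles[OF V(1) E' no])
      also have "\<dots> \<le> N * card V ^ (k - 1)" using E' by (intro mult_le_mono2 card_shadow_le[OF V(1)])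
      finally have cE: "card E \<le> N * card V ^ (k - 1)" .
      have "real (card L) * (\<delta> * q) = (\<Sum>v\<in>L. \<delta> * q)" by simp
      also have "\<dots> \<le> (\<Sum>v\<in>L. real (card {e \<in> E. v \<in> e}))" by (intro sum_mono) (auto simp: L_def)
      also have "\<dots> = real (\<Sum>v\<in>L. card {e \<in> E. v \<in> e})" by simp
      also have "(\<Sum>v\<in>L. card {e \<in> E. v \<in> e}) = (\<Sum>e\<in>E. card {v \<in> L. v \<in> e})"
        by (rule sum_multicount_gen[OF fL fE]) simp
      also have "\<dots> \<le> (\<Sum>e\<in>E. k)"
      proof (rule sum_mono)
        fix e assume "e \<in> E"
        then have e: "e \<subseteq> V" "card e = k" using E' by auto
        then have "card {v \<in> L. v \<in> e} \<le> card e" using V(1) by (intro card_mono) (auto intro: finite_subset)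
        then show "card {v \<in> L. v \<in> e} \<le> k" using e by simp
      qed
      also have "(\<Sum>e\<in>E. k) \<le> N * card V ^ (k - 1) * k" using cE by simp
      finally have "real (card L) * (\<delta> * q) \<le> real (N * card V ^ (k - 1) * k)" by simp
      also have "\<dots> = real k * real N * q" by (simp add: q_def mult_ac)
      finally have "real (card L) * \<delta> \<le> real k * real N" using q0 by (simp add: mult.assoc[symmetric])
      then have "real (card L) \<le> real k * real N / \<delta>" using dl by (simp add: field_simps)
      then show ?thesis unfolding m_def by linarith
    qed
    define E0 where "E0 = {e \<in> E. e \<inter> L = {}}"
    have E0: "real (card E0) \<le> e0 * q"
    proof -
      define d where "d = nat \<lfloor>\<delta> * q\<rfloor>"
      have dq: "real d \<le> \<delta> * q" using dl q0 by (simp add: d_def)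
      have "card E0 \<le> C * card V ^ (k - 2) \<or> (card E0)\<^sup>2 \<le> C\<^sup>2 * (d * card V ^ (k - 1))"
      proof (rule high_degree[OF V(1) _ k N_bounds(2) I(1) l N_bounds(1) _ _ C_def])
        show "e \<subseteq> V \<and> card e = k" if "e \<in> E0" for e using that E' by (auto simp: E0_def)
        show "\<not> cycle_system k I l E0" using no cycle_system_mono[of k I l E0 E] by (auto simp: E0_def)
        fix v assume v: "v \<in> V"
        show "card {e \<in> E0. v \<in> e} \<le> d"
        proof (cases "v \<in> L")
          case True
          then have "{e \<in> E0. v \<in> e} = {}" by (auto simp: E0_def)
          then show ?thesis by (simp only: card.empty)
        next
          case False
          have "card {e \<in> E0. v \<in> e} \<le> card {e \<in> E. v \<in> e}" using fE by (intro card_mono) (auto simp: E0_def)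
          moreover have "real (card {e \<in> E. v \<in> e}) < \<delta> * q" using False v by (simp add: L_def)
          ultimately have "real (card {e \<in> E0. v \<in> e}) \<le> \<delta> * q" by linarith
          then show ?thesis unfolding d_def by (simp add: le_nat_iff le_floor_iff)
        qed
      qed
      then show ?thesis
      proof
        assume "card E0 \<le> C * card V ^ (k - 2)"
        then have "real (card E0) \<le> real (C * card V ^ (k - 2))" by (simp only: of_nat_le_iff)
        then show ?thesis using g(3) by simp
      next
        assume "(card E0)\<^sup>2 \<le> C\<^sup>2 * (d * card V ^ (k - 1))"
        then have "real ((card E0)\<^sup>2) \<le> real (C\<^sup>2 * (d * card V ^ (k - 1)))" by (simp only: of_nat_le_iff)
        then have "(real (card E0))\<^sup>2 \<le> (real C)\<^sup>2 * (real d * q)" by (simp add: q_def)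
        also have "\<dots> \<le> (real C)\<^sup>2 * ((\<delta> * q) * q)" using dq q0 by (intro mult_left_mono mult_right_mono) auto
        also have "\<dots> = (e0 * q)\<^sup>2" using C by (simp add: \<delta>_def power2_eq_square field_simps)
        finally show ?thesis by (rule power2_le_imp_le) (use e0 q0 in auto)
      qed
    qed
    have "\<exists>T \<subseteq> V. card T = t \<and> real (card {e \<in> E. e \<inter> T = {}}) \<le> (2 + real t * c1) * e0 * q"
      by (rule stability_real[OF V(1) g(7) E' no LV cL q_def e0(1) E0[unfolded E0_def] g(1,2,4,5,6) big c1_def e0(2)])
    then obtain T where T: "T \<subseteq> V" "card T = t" "real (card {e \<in> E. e \<inter> T = {}}) \<le> (2 + real t * c1) * e0 * q" by blast
    have "(2 + real t * c1) * e0 * q \<le> \<epsilon> * q" using e0(3) q0 by (intro mult_right_mono) auto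
    then show "\<exists>T \<subseteq> V. card T = t \<and> real (card {e \<in> E. e \<inter> T = {}}) \<le> \<epsilon> * real (card V) ^ (k - 1)"
      using T unfolding q_def by (intro exI[of _ T]) linarith
  qed
qed

end

section \<open>The exact bound\<close>

text \<open>Each forbidden vertex destroys at most n^(k - card K - 1) of the edges over
  \<open>K\<close>.\<close>

lemma rich_of_degree:
  assumes V: "finite V" and E: "\<And>e. e \<in> E \<Longrightarrow> e \<subseteq> V \<and> card e = k" and K: "finite K" "card K < k"
    and deg: "N * card V ^ (k - card K - 1) < card {e \<in> E. K \<subseteq> e}"
  shows "rich E N K"
  unfolding rich_def
proof (intro allI impI)
  fix Z assume Z: "finite Z" "card Z \<le> N" "Z \<inter> K = {}"
  define X where "X z = {e. e \<subseteq> V \<and> card e = k \<and> insert z K \<subseteq> e}" for z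
  have fX: "finite (X z)" for z using V by (simp add: X_def finite_uniform)
  show "\<exists>e\<in>E. K \<subseteq> e \<and> e \<inter> Z = {}"
  proof (rule ccontr)
    assume n: "\<not> ?thesis"
    have "{e \<in> E. K \<subseteq> e} \<subseteq> (\<Union>z\<in>Z. X z)"
    proof
      fix e assume e: "e \<in> {e \<in> E. K \<subseteq> e}"
      then obtain z where "z \<in> e" "z \<in> Z" using n by blast
      then show "e \<in> (\<Union>z\<in>Z. X z)" using e E[of e] by (auto simp: X_def)
    qed
    then have "card {e \<in> E. K \<subseteq> e} \<le> card (\<Union>z\<in>Z. X z)" using Z(1) fX by (intro card_mono) auto
    also have "\<dots> \<le> (\<Sum>z\<in>Z. card (X z))" by (rule card_UN_le[OF Z(1)])
    also have "\<dots> \<le> (\<Sum>z\<in>Z. card V ^ (k - card K - 1))"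
    proof (rule sum_mono)
      fix z assume "z \<in> Z"
      then have "card (insert z K) = Suc (card K)" using Z(3) K(1) by (subst card_insert_disjoint) auto
      then show "card (X z) \<le> card V ^ (k - card K - 1)"
        using card_supersets_le[OF V, of "insert z K" k] K(2) by (simp add: X_def)
    qed
    also have "\<dots> \<le> N * card V ^ (k - card K - 1)" using Z(2) by simp
    finally show False using deg by simp
  qed
qed

context cycle_lengths
begin

text \<open>\<open>B\<close> holds the vertices with many missing edges. Two vertices outside
  \<open>B\<close> can be linked through all centres of \<open>T\<close>, so an edge outside
  \<open>T\<close> with two vertices off \<open>B\<close> is dangerous: alone for an odd length, as
  one of two meeting in a single vertex otherwise. The edges almost inside \<open>B\<close> are paid
  for by the missing edges at \<open>B\<close>.\<close>

lemma card_avoiding_le_card_missing: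
  fixes V :: "'v set" and c c2 c3 \<epsilon> \<beta> :: real
  assumes V: "finite V" and E: "\<And>e. e \<in> E \<Longrightarrow> e \<subseteq> V \<and> card e = k" and no: "\<not> cycle_system k I l E"
    and T: "T \<subseteq> V" "card T = t" and F0: "F0 = {e \<in> E. e \<inter> T = {}}"
    and eps: "real (card F0) \<le> \<epsilon> * real (card V) ^ (k - 1)"
    and Mi: "Mi = {e. e \<subseteq> V \<and> card e = k \<and> e \<inter> T \<noteq> {} \<and> e \<notin> E}" and Mi_F0: "card Mi \<le> card F0"
    and c: "0 < c" "c \<le> c2 / 2" "8 * real k * c \<le> c3"
    and be: "\<beta> \<le> 1 / 4" "real k * real N * \<beta> \<le> c" "\<epsilon> = \<beta> * c / real k" "0 < \<beta>"
    and n1: "c2 * real (card V) ^ (k - 2) \<le> real ((card V - 2) choose (k - 2))"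
    and n2: "c3 * real (card V) ^ (k - 3) \<le> real ((card V - 3) choose (k - 3))"
    and n3: "real N * real (card V) ^ (k - 3) < c2 / 2 * real (card V) ^ (k - 2)"
    and n4: "real N * real (card V) ^ (k - 4) < c3 / 2 * real (card V) ^ (k - 3)"
    and n5: "real (card V) > 2 * (real t + real N + 1)"
    and Frankl: "\<And>F :: 'v set set. (\<forall>e\<in>F. e \<subseteq> V - T \<and> card e = k) \<Longrightarrow> (\<forall>e\<in>F. \<forall>e'\<in>F. card (e \<inter> e') \<noteq> 1) \<Longrightarrow>
        card F \<le> (card V - t - 2) choose (k - 2)"
  shows "card F0 \<le> card Mi + (if \<forall>i\<in>I. even (l i) then (card V - t - 2) choose (k - 2) else 0)"
proof -
  define n where "n = card V"
  have n5': "2 * real t + 2 * real N + 2 < real n" using n5 unfolding n_def by (simp add: algebra_simps)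
  then have npos: "real n > 0" by linarith
  have fE: "finite E" using V E by (intro finite_subset[of E "Pow V"]) auto
  have fT: "finite T" using T V finite_subset by blast
  have fMi: "finite Mi" using V by (simp add: Mi finite_uniform)
  have Ef: "finite e \<and> card e = k" if "e \<in> E" for e using E[OF that] V finite_subset[of e V] by auto
  define dg where "dg S = card {e \<in> Mi. S \<subseteq> e}" for S
  define B where "B = {x \<in> V - T. c * real n ^ (k - 2) \<le> real (dg {x})}"
  have fB: "finite B" using V by (simp add: B_def)
  have Mi_card: "card {y \<in> W. y \<in> e} \<le> k" if "e \<in> Mi" for e and W :: "'v set"
  proof -
    have e: "finite e" "card e = k" using that V finite_subset[of e V] by (auto simp: Mi)
    then have "card {y \<in> W. y \<in> e} \<le> card e" by (intro card_mono) auto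
    then show ?thesis using e by simp
  qed
  \<comment> \<open>Double counting used twice: with \<open>Mi_F0\<close> it shows that
    \<open>B\<close> is small, and later it bounds the missing edges from below in terms of
    \<open>card B\<close>.\<close>
  have B_Mi: "real (card B) * (c * real n ^ (k - 2)) \<le> real k * real (card Mi)"
  proof -
    have "real (card B) * (c * real n ^ (k - 2)) = (\<Sum>x\<in>B. c * real n ^ (k - 2))" by simp
    also have "\<dots> \<le> (\<Sum>x\<in>B. real (dg {x}))" by (intro sum_mono) (auto simp: B_def)
    also have "\<dots> = real (\<Sum>x\<in>B. card {e \<in> Mi. x \<in> e})" by (simp add: dg_def)
    also have "(\<Sum>x\<in>B. card {e \<in> Mi. x \<in> e}) = (\<Sum>e\<in>Mi. card {x \<in> B. x \<in> e})" by (rule sum_multicount_gen[OF fB fMi]) simp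
    also have "\<dots> \<le> (\<Sum>e\<in>Mi. k)" by (intro sum_mono Mi_card)
    finally show ?thesis by (simp add: mult.commute)
  qed
  have cB: "real (card B) \<le> \<beta> * real n"
  proof -
    have "real (card B) * (c * real n ^ (k - 2)) \<le> real k * (\<epsilon> * real n ^ (k - 1))"
    proof -
      have "real (card Mi) \<le> \<epsilon> * real n ^ (k - 1)" using eps Mi_F0 unfolding n_def by linarith
      then have "real k * real (card Mi) \<le> real k * (\<epsilon> * real n ^ (k - 1))" by (intro mult_left_mono) auto
      then show ?thesis using B_Mi by linarith
    qed
    also have "\<dots> = \<beta> * real n * (c * real n ^ (k - 2))"
    proof -
      have "k - 1 = Suc (k - 2)" using k by simp
      then show ?thesis using k by (simp add: be(3))
    qed
    finally have le: "real (card B) * (c * real n ^ (k - 2)) \<le> \<beta> * real n * (c * real n ^ (k - 2))" .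
    have "c * real n ^ (k - 2) > 0" using c(1) npos by simp
    then show ?thesis using le by (simp only: mult_le_cancel_right_pos)
  qed
  have supers: "real ((n - card S) choose (k - card S)) \<le> real (card {e \<in> E. S \<subseteq> e}) + real (card {e \<in> Mi. S \<subseteq> e})"
    if S: "S \<subseteq> V" "S \<inter> T \<noteq> {}" "card S \<le> k" for S
  proof -
    have "{e. e \<subseteq> V \<and> card e = k \<and> S \<subseteq> e} \<subseteq> {e \<in> E. S \<subseteq> e} \<union> {e \<in> Mi. S \<subseteq> e}" using S(2) by (auto simp: Mi)
    then have "card {e. e \<subseteq> V \<and> card e = k \<and> S \<subseteq> e} \<le> card ({e \<in> E. S \<subseteq> e} \<union> {e \<in> Mi. S \<subseteq> e})"
      using fE fMi by (intro card_mono) auto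
    also have "\<dots> \<le> card {e \<in> E. S \<subseteq> e} + card {e \<in> Mi. S \<subseteq> e}" by (rule card_Un_le)
    finally show ?thesis using card_supersets[OF V S(1,3)] unfolding n_def by linarith
  qed
  have Mi_mono: "card {e \<in> Mi. S \<subseteq> e} \<le> dg S'" if "S' \<subseteq> S" for S S'
    unfolding dg_def using that fMi by (intro card_mono) auto
  have rich2: "rich E N {x, v}" if x: "x \<in> V - T" "x \<notin> B" and v: "v \<in> T" for x v
  proof (rule rich_of_degree[OF V])
    show "e \<subseteq> V \<and> card e = k" if "e \<in> E" for e using that by (rule E)
    show "finite {x, v}" by simp
    have "x \<noteq> v" using x v by auto
    then have c2': "card {x, v} = 2" by simp
    then show "card {x, v} < k" using k by simp
    have "real ((n - 2) choose (k - 2)) \<le> real (card {e \<in> E. {x, v} \<subseteq> e}) + real (card {e \<in> Mi. {x, v} \<subseteq> e})"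
      using supers[of "{x, v}"] x v T k unfolding c2' by auto
    moreover have "real (card {e \<in> Mi. {x, v} \<subseteq> e}) \<le> real (dg {x})" using Mi_mono[of "{x}" "{x, v}"] by simp
    moreover have "real (dg {x}) < c * real n ^ (k - 2)" using x by (simp add: B_def)
    moreover have "c * real n ^ (k - 2) \<le> c2 / 2 * real n ^ (k - 2)" using c(2) by (intro mult_right_mono) auto
    moreover have "c2 * real n ^ (k - 2) = c2 / 2 * real n ^ (k - 2) + c2 / 2 * real n ^ (k - 2)" by simp
    ultimately have "real N * real n ^ (k - 3) < real (card {e \<in> E. {x, v} \<subseteq> e})" using n1 n3 unfolding n_def by linarith
    then have "real (N * n ^ (k - 3)) < real (card {e \<in> E. {x, v} \<subseteq> e})" by simp
    then have "N * n ^ (k - 3) < card {e \<in> E. {x, v} \<subseteq> e}" by (simp only: of_nat_less_iff)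
    moreover have "k - card {x, v} - 1 = k - 3" using c2' by simp
    ultimately show "N * card V ^ (k - card {x, v} - 1) < card {e \<in> E. {x, v} \<subseteq> e}" by (simp only: n_def)
  qed
  \<comment> \<open>The pair itself must have few missing edges over it, so that its triples with
    centres are rich. As \<open>p\<close> lies outside \<open>B\<close>, this rules out at most n /
    4 choices of \<open>q\<close>.\<close>
  define PP where "PP = {(p, q). p \<in> V - T \<and> p \<notin> B \<and> q \<in> V - T \<and> q \<notin> B \<and> p \<noteq> q \<and> real (dg {p, q}) < c3 / 2 * real n ^ (k - 3)}"
  have rich3: "rich E N {p, q, w}" if pq: "(p, q) \<in> PP" and w: "w \<in> T" for p q w
  proof (rule rich_of_degree[OF V])
    show "e \<subseteq> V \<and> card e = k" if "e \<in> E" for e using that by (rule E)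
    show "finite {p, q, w}" by simp
    have p: "p \<in> V - T" "q \<in> V - T" "p \<noteq> q" "real (dg {p, q}) < c3 / 2 * real n ^ (k - 3)" using pq by (auto simp: PP_def)
    have c3': "card {p, q, w} = 3" using p w by (auto simp: card_insert_if)
    then show "card {p, q, w} < k" using k by simp
    have "real ((n - 3) choose (k - 3)) \<le> real (card {e \<in> E. {p, q, w} \<subseteq> e}) + real (card {e \<in> Mi. {p, q, w} \<subseteq> e})"
      using supers[of "{p, q, w}"] p w T k unfolding c3' by auto
    moreover have "real (card {e \<in> Mi. {p, q, w} \<subseteq> e}) \<le> real (dg {p, q})" using Mi_mono[of "{p, q}" "{p, q, w}"] by simp
    moreover have "c3 * real n ^ (k - 3) = c3 / 2 * real n ^ (k - 3) + c3 / 2 * real n ^ (k - 3)" by simp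
    ultimately have "real N * real n ^ (k - 4) < real (card {e \<in> E. {p, q, w} \<subseteq> e})" using n2 n4 p(4) unfolding n_def by linarith
    then have "real (N * n ^ (k - 4)) < real (card {e \<in> E. {p, q, w} \<subseteq> e})" by simp
    then have "N * n ^ (k - 4) < card {e \<in> E. {p, q, w} \<subseteq> e}" by (simp only: of_nat_less_iff)
    moreover have "k - card {p, q, w} - 1 = k - 4" using c3' by simp
    ultimately show "N * card V ^ (k - card {p, q, w} - 1) < card {e \<in> E. {p, q, w} \<subseteq> e}" by (simp only: n_def)
  qed
  have outside: "\<exists>x \<in> V. x \<notin> W" if W: "finite W" "real (card W) < real n" for W :: "'v set"
  proof (rule ccontr)
    assume "\<not> ?thesis"
    then have "V \<subseteq> W" by blast
    then show False using W card_mono[of W V] by (simp add: n_def)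
  qed
  have PP_ex: "\<exists>p q. (p, q) \<in> PP \<and> p \<notin> Z \<and> q \<notin> Z" if Z: "finite Z" "card Z \<le> N" for Z
  proof -
    have cTBZ: "real (card (T \<union> B \<union> Z)) \<le> real t + 1 / 4 * real n + real N"
    proof -
      have "card (T \<union> B \<union> Z) \<le> card T + card B + card Z" using card_Un_le[of "T \<union> B" Z] card_Un_le[of T B] by linarith
      then have "real (card (T \<union> B \<union> Z)) \<le> real (card T + card B + card Z)" by (simp only: of_nat_le_iff)
      moreover have "\<beta> * real n \<le> 1 / 4 * real n" using be(1) by (intro mult_right_mono) auto
      ultimately show ?thesis using cB Z(2) T(2) by simp
    qed
    have "real (card (T \<union> B \<union> Z)) < real n" using cTBZ n5' npos by simp
    then obtain p where p: "p \<in> V" "p \<notin> T \<union> B \<union> Z" using outside[of "T \<union> B \<union> Z"] fT fB Z by blast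
    define R where "R = {q \<in> V - {p}. c3 / 2 * real n ^ (k - 3) \<le> real (dg {p, q})}"
    have fR: "finite R" using V by (simp add: R_def)
    have cR: "real (card R) \<le> 1 / 4 * real n"
    proof -
      have "real (card R) * (c3 / 2 * real n ^ (k - 3)) = (\<Sum>q\<in>R. c3 / 2 * real n ^ (k - 3))" by simp
      also have "\<dots> \<le> (\<Sum>q\<in>R. real (dg {p, q}))" by (intro sum_mono) (auto simp: R_def)
      also have "\<dots> = real (\<Sum>q\<in>R. card {e \<in> {e \<in> Mi. p \<in> e}. q \<in> e})" by (simp add: dg_def conj_assoc)
      also have "(\<Sum>q\<in>R. card {e \<in> {e \<in> Mi. p \<in> e}. q \<in> e}) = (\<Sum>e\<in>{e \<in> Mi. p \<in> e}. card {q \<in> R. q \<in> e})"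
        using fMi by (intro sum_multicount_gen[OF fR]) auto
      also have "\<dots> \<le> (\<Sum>e\<in>{e \<in> Mi. p \<in> e}. k)" by (intro sum_mono Mi_card) auto
      also have "\<dots> = k * dg {p}" by (simp add: dg_def)
      finally have "real (card R) * (c3 / 2 * real n ^ (k - 3)) \<le> real k * real (dg {p})" by simp
      also have "\<dots> \<le> real k * (c * real n ^ (k - 2))" using p by (intro mult_left_mono) (auto simp: B_def)
      also have "\<dots> = (8 * real k * c) * (1 / 8 * real n ^ (k - 2))" by simp
      also have "\<dots> \<le> c3 * (1 / 8 * real n ^ (k - 2))" using c(3) by (intro mult_right_mono) auto
      also have "\<dots> = (1 / 4 * real n) * (c3 / 2 * real n ^ (k - 3))"
      proof -
        have "k - 2 = Suc (k - 3)" using k by simp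
        then show ?thesis by simp
      qed
      finally have le: "real (card R) * (c3 / 2 * real n ^ (k - 3)) \<le> (1 / 4 * real n) * (c3 / 2 * real n ^ (k - 3))" .
      have "0 < 8 * real k * c" using k c(1) by simp
      then have "c3 / 2 > 0" using c(3) by linarith
      moreover have "real n ^ (k - 3) > 0" using npos by (rule zero_less_power)
      ultimately have "c3 / 2 * real n ^ (k - 3) > 0" by (rule mult_pos_pos)
      then show ?thesis using le by (simp only: mult_le_cancel_right_pos)
    qed
    have "card (T \<union> B \<union> Z \<union> R \<union> {p}) \<le> card (T \<union> B \<union> Z) + card R + 1"
      using card_Un_le[of "T \<union> B \<union> Z \<union> R" "{p}"] card_Un_le[of "T \<union> B \<union> Z" R] by simp
    then have "real (card (T \<union> B \<union> Z \<union> R \<union> {p})) \<le> real (card (T \<union> B \<union> Z) + card R + 1)" by (simp only: of_nat_le_iff)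
    then have "real (card (T \<union> B \<union> Z \<union> R \<union> {p})) < real n" using cTBZ cR n5' by simp
    then obtain q where q: "q \<in> V" "q \<notin> T \<union> B \<union> Z \<union> R \<union> {p}" using outside[of "T \<union> B \<union> Z \<union> R \<union> {p}"] fT fB Z fR by blast
    then have "(p, q) \<in> PP" using p by (auto simp: PP_def R_def)
    then show ?thesis using p q by blast
  qed
  have star: "cycle_system k I l E"
    if cl: "i0 \<in> I" "closer E N (l i0) C0 p0 q0" "finite C0" "card C0 \<le> 2 * k" "C0 \<inter> T = {}"
      "p0 \<in> V - T" "p0 \<notin> B" "q0 \<in> V - T" "q0 \<notin> B" for i0 C0 p0 q0
  proof (rule star_cycles[OF I(1) cl(1) l Ef s N_bounds(1) N_bounds(3)[OF cl(4)] cl(2,3) fT])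
    have "T - C0 = T" using cl(5) by auto
    then show "sum s I \<le> card (T - C0) + 1" using T(2) t by simp
    show "p \<noteq> q \<and> p \<notin> T \<and> q \<notin> T" if "(p, q) \<in> PP" for p q using that by (auto simp: PP_def)
    show "rich E N {p, q, w} \<and> rich E N {p, w} \<and> rich E N {q, w}" if "(p, q) \<in> PP" "w \<in> T" for p q w
      using rich3[OF that] rich2[of p w] rich2[of q w] that by (auto simp: PP_def)
    show "\<exists>p q. (p, q) \<in> PP \<and> p \<notin> Z \<and> q \<notin> Z" if "finite Z" "card Z \<le> N" for Z using PP_ex[OF that] .
  qed (use cl rich2 in auto)
  define Fa where "Fa = {e \<in> F0. card (e - B) \<le> 1}"
  define Fb where "Fb = {e \<in> F0. \<not> card (e - B) \<le> 1}"
  have FaE: "Fa \<subseteq> E" "Fb \<subseteq> E" by (auto simp: Fa_def Fb_def F0)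
  \<comment> \<open>A shadow set of \<open>Fa\<close> has k - 2 vertices in \<open>B\<close>, so
    \<open>Fa\<close> has at most N n card B^(k-2) edges, while at least c card B n^(k-2) / k sets
    are missing. As \<open>card B\<close> is at most \<beta> n, the latter number wins.\<close>
  have cFa: "card Fa \<le> card Mi"
  proof -
    have "shadow Fa \<subseteq> (\<lambda>(x, g). insert x g) ` (V \<times> {g. g \<subseteq> B \<and> card g = k - 2})"
    proof
      fix g assume "g \<in> shadow Fa"
      then obtain e y where e: "e \<in> Fa" "y \<in> e" "g = e - {y}" by (auto simp: shadow_def)
      have eE: "finite e" "card e = k" "e \<subseteq> V" using Ef[of e] E[of e] e(1) FaE by auto
      have g: "finite g" "card g = k - 1" "g \<subseteq> V" using eE e by auto
      have "card (g - B) \<le> card (e - B)" using eE e(3) by (intro card_mono) auto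
      then have "card (g - B) \<le> 1" using e(1) by (simp add: Fa_def)
      have "\<exists>x\<in>g. g - {x} \<subseteq> B"
      proof (cases "g - B = {}")
        case True
        have "g \<noteq> {}" using g k by auto
        then show ?thesis using True by blast
      next
        case False
        then have "card (g - B) = 1" using \<open>card (g - B) \<le> 1\<close> g(1) by (simp add: card_gt_0_iff le_antisym Suc_leI)
        then obtain x where "g - B = {x}" by (auto simp: card_1_singleton_iff)
        then show ?thesis by blast
      qed
      then obtain x where x: "x \<in> g" "g - {x} \<subseteq> B" by blast
      have "card (g - {x}) = k - 2" using g x by simp
      then have "(x, g - {x}) \<in> V \<times> {g. g \<subseteq> B \<and> card g = k - 2}" using x g by auto
      moreover have "g = insert x (g - {x})" using x by auto
      ultimately show "g \<in> (\<lambda>(x, g). insert x g) ` (V \<times> {g. g \<subseteq> B \<and> card g = k - 2})" by (intro image_eqI[of _ _ "(x, g - {x})"]) simp_all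
    qed
    then have "card (shadow Fa) \<le> card ((\<lambda>(x, g). insert x g) ` (V \<times> {g. g \<subseteq> B \<and> card g = k - 2}))"
      using V fB by (intro card_mono) (auto simp: finite_uniform)
    also have "\<dots> \<le> card (V \<times> {g. g \<subseteq> B \<and> card g = k - 2})" using V fB by (intro card_image_le) (auto simp: finite_uniform)
    also have "\<dots> = n * (card B choose (k - 2))" using fB by (simp add: card_cartesian_product n_subsets n_def)
    also have "\<dots> \<le> n * card B ^ (k - 2)" by (intro mult_le_mono2 binomial_le_power)
    finally have cs: "card (shadow Fa) \<le> n * card B ^ (k - 2)" .
    have "card Fa \<le> N * card (shadow Fa)"
    proof (rule card_le_of_no_cycles[OF V])
      show "e \<subseteq> V \<and> card e = k" if "e \<in> Fa" for e using E FaE that by blast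
      show "\<not> cycle_system k I l Fa" using no cycle_system_mono[OF _ FaE(1)] by blast
    qed
    also have "\<dots> \<le> N * (n * card B ^ (k - 2))" using cs by (rule mult_le_mono2)
    finally have "real (card Fa) \<le> real (N * (n * card B ^ (k - 2)))" by (simp only: of_nat_le_iff)
    also have "\<dots> = real N * (real n * (real (card B) * real (card B) ^ (k - 3)))"
    proof -
      have "k - 2 = Suc (k - 3)" using k by simp
      then show ?thesis by simp
    qed
    also have "\<dots> \<le> real N * (real n * (real (card B) * (\<beta> * real n ^ (k - 3))))"
    proof (intro mult_left_mono)
      have "real (card B) ^ (k - 3) \<le> (\<beta> * real n) ^ (k - 3)" using cB by (intro power_mono) auto
      also have "\<dots> = \<beta> ^ (k - 3) * real n ^ (k - 3)" by (rule power_mult_distrib)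
      also have "\<beta> ^ (k - 3) \<le> \<beta> ^ 1" using be(1,4) k by (intro power_decreasing) auto
      finally show "real (card B) ^ (k - 3) \<le> \<beta> * real n ^ (k - 3)" by (simp add: mult_right_mono)
    qed auto
    also have "\<dots> = real N * \<beta> * (real (card B) * real n ^ (k - 2))"
    proof -
      have "k - 2 = Suc (k - 3)" using k by simp
      then show ?thesis by simp
    qed
    finally have "real k * real (card Fa) \<le> real k * (real N * \<beta> * (real (card B) * real n ^ (k - 2)))" by (intro mult_left_mono) auto
    also have "\<dots> = (real k * real N * \<beta>) * (real (card B) * real n ^ (k - 2))" by (simp add: mult_ac)
    also have "\<dots> \<le> c * (real (card B) * real n ^ (k - 2))" using be(2) by (intro mult_right_mono) auto
    also have "\<dots> \<le> real k * real (card Mi)" using B_Mi by (simp add: mult_ac)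
    finally show ?thesis using k by simp
  qed
  have two: "\<exists>p\<in>e - B. p \<noteq> z" if "e \<in> Fb" for e z
  proof -
    have "card (e - B) \<ge> 2" using that by (simp add: Fb_def)
    then obtain a b where "a \<in> e - B" "b \<in> e - B" "a \<noteq> b" by (rule two_elements)
    then show ?thesis by metis
  qed
  have FbV: "e \<subseteq> V - T \<and> card e = k \<and> finite e \<and> e \<inter> T = {} \<and> e \<in> E" if "e \<in> Fb" for e
    using that E[of e] Ef[of e] by (auto simp: Fb_def F0)
  have cFb: "card Fb \<le> (if \<forall>i\<in>I. even (l i) then (card V - t - 2) choose (k - 2) else 0)"
  proof (cases "\<forall>i\<in>I. even (l i)")
    case False
    then obtain i0 where i0: "i0 \<in> I" "odd (l i0)" by blast
    \<comment> \<open>For an odd length a single edge of \<open>Fb\<close> closes the cycle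
      \<open>i0\<close>, with two of its vertices outside \<open>B\<close> as ends.\<close>
    have "Fb = {}"
    proof (rule ccontr)
      assume "Fb \<noteq> {}"
      then obtain e where e: "e \<in> Fb" by blast
      obtain p where p: "p \<in> e - B" using two[OF e] by blast
      obtain q where q: "q \<in> e - B" "q \<noteq> p" using two[OF e] by blast
      have "closer E N (l i0) e p q" using i0(2) p q rich_edge[of e E N] FbV[OF e] by (auto simp: closer_def)
      then have "cycle_system k I l E" using p q FbV[OF e] by (intro star[OF i0(1)]) auto
      then show False using no by simp
    qed
    then show ?thesis by simp
  next
    case True
    obtain i0 where i0: "i0 \<in> I" using I by blast
    \<comment> \<open>Two edges meeting in \<open>z\<close> alone close an even cycle, with ends
      outside \<open>B\<close> and different from \<open>z\<close>.\<close>
    have "card (e \<inter> e') \<noteq> 1" if e: "e \<in> Fb" "e' \<in> Fb" for e e'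
    proof
      assume "card (e \<inter> e') = 1"
      then obtain z where z: "e \<inter> e' = {z}" by (auto simp: card_1_singleton_iff)
      obtain p where p: "p \<in> e - B" "p \<noteq> z" using two[OF e(1)] by blast
      obtain q where q: "q \<in> e' - B" "q \<noteq> z" using two[OF e(2)] by blast
      have "p \<noteq> q" using p q z by blast
      moreover have "e \<union> e' = e \<union> e' \<and> e \<inter> e' = {z} \<and> p \<in> e \<and> q \<in> e' \<and> p \<noteq> z \<and> q \<noteq> z \<and> rich E N e \<and> rich E N e'"
        using p q z rich_edge[of e E N] rich_edge[of e' E N] FbV[OF e(1)] FbV[OF e(2)] by auto
      then have "\<exists>Q Q' z. e \<union> e' = Q \<union> Q' \<and> Q \<inter> Q' = {z} \<and> p \<in> Q \<and> q \<in> Q' \<and> p \<noteq> z \<and> q \<noteq> z \<and> rich E N Q \<and> rich E N Q'" by (intro exI)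
      ultimately have "closer E N (l i0) (e \<union> e') p q" using True i0 by (simp add: closer_def)
      moreover have "card (e \<union> e') \<le> 2 * k" using card_Un_le[of e e'] FbV[OF e(1)] FbV[OF e(2)] by simp
      ultimately have "cycle_system k I l E"
        using p q FbV[OF e(1)] FbV[OF e(2)] by (intro star[OF i0, of "e \<union> e'" p q]) auto
      then show False using no by simp
    qed
    then have "card Fb \<le> (card V - t - 2) choose (k - 2)" using FbV by (intro Frankl) auto
    then show ?thesis using True by simp
  qed
  have "F0 = Fa \<union> Fb" by (auto simp: Fa_def Fb_def)
  then have "card F0 \<le> card Fa + card Fb" using card_Un_le[of Fa Fb] by simp
  then show ?thesis using cFa cFb by linarith
qed

text \<open>Only families at least as large as the number of k-sets meeting T matter. For these,
  \<open>stability\<close> provides \<open>T\<close>, and the claim becomes a comparison between the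
  edges \<open>F0\<close> avoiding \<open>T\<close> and the missing sets \<open>Mi\<close> meeting
  \<open>T\<close>.\<close>

theorem upper_bound:
  "\<exists>n0. \<forall>(V :: 'v set) E. finite V \<longrightarrow> card V \<ge> n0 \<longrightarrow> (\<forall>e\<in>E. e \<subseteq> V \<and> card e = k) \<longrightarrow> \<not> cycle_system k I l E \<longrightarrow>
    card E \<le> (card V choose k) - ((card V - t) choose k) + (if \<forall>i\<in>I. even (l i) then (card V - t - 2) choose (k - 2) else 0)"
proof -
  \<comment> \<open>\<open>c2\<close> and \<open>c3\<close> are half the limits 1 / (k-2)! and 1 /
    (k-3)! of the normalised binomials. Then \<open>c\<close> is the missing-degree threshold
    defining the bad set, \<beta> its relative size, and \<epsilon> the precision of stability that
    enforces this size.\<close>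
  define c2 where "c2 = (1 / (2 * fact (k - 2)) :: real)"
  define c3 where "c3 = (1 / (2 * fact (k - 3)) :: real)"
  define c where "c = min (c2 / 2) (c3 / (8 * real k))"
  define \<beta> where "\<beta> = min (1 / 4) (c / (real k * real N))"
  define \<epsilon> where "\<epsilon> = \<beta> * c / real k"
  have pos: "c2 > 0" "c3 > 0" by (simp_all add: c2_def c3_def)
  have kN: "real k > 0" "real N > 0" using k N_bounds(4) by auto
  have c: "0 < c" "c \<le> c2 / 2" "8 * real k * c \<le> c3"
  proof -
    show "0 < c" "c \<le> c2 / 2" using pos kN by (auto simp: c_def)
    have "8 * real k * c \<le> 8 * real k * (c3 / (8 * real k))" using kN by (intro mult_left_mono) (auto simp: c_def)
    then show "8 * real k * c \<le> c3" using kN by simp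
  qed
  have be: "\<beta> \<le> 1 / 4" "real k * real N * \<beta> \<le> c" "0 < \<beta>"
  proof -
    show "\<beta> \<le> 1 / 4" unfolding \<beta>_def by (rule min.cobounded1)
    show "0 < \<beta>" using c kN by (simp add: \<beta>_def)
    have "real k * real N * \<beta> \<le> real k * real N * (c / (real k * real N))" using kN by (intro mult_left_mono) (auto simp: \<beta>_def)
    then show "real k * real N * \<beta> \<le> c" using kN by simp
  qed
  have "\<epsilon> > 0" using be c kN by (simp add: \<epsilon>_def)
  from stability[OF this] obtain n1 where n1: "\<forall>(V :: 'v set) E. finite V \<longrightarrow> card V \<ge> n1 \<longrightarrow> (\<forall>e\<in>E. e \<subseteq> V \<and> card e = k) \<longrightarrow> \<not> cycle_system k I l E \<longrightarrow>
    (card V choose k) - ((card V - t) choose k) \<le> card E \<longrightarrow>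
    (\<exists>T \<subseteq> V. card T = t \<and> real (card {e \<in> E. e \<inter> T = {}}) \<le> \<epsilon> * real (card V) ^ (k - 1))" by (elim exE)
  from singleton_free_bound[OF k] obtain n2 where n2: "\<forall>(V :: 'v set) F. finite V \<longrightarrow> card V \<ge> n2 \<longrightarrow> (\<forall>e\<in>F. e \<subseteq> V \<and> card e = k) \<longrightarrow>
    (\<forall>e\<in>F. \<forall>e'\<in>F. card (e \<inter> e') \<noteq> 1) \<longrightarrow> card F \<le> (card V - 2) choose (k - 2)" by (elim exE)
  have v1: "\<forall>\<^sub>F n in sequentially. c2 * real n ^ (k - 2) \<le> real ((n - 2) choose (k - 2))"
    and v2: "\<forall>\<^sub>F n in sequentially. c3 * real n ^ (k - 3) \<le> real ((n - 3) choose (k - 3))"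
    by (rule binomial_eventually_ge, simp add: c2_def c3_def field_simps)+
  have v3: "\<forall>\<^sub>F n in sequentially. real N * real n ^ (k - 3) \<le> c2 / 4 * real n ^ (k - 2)"
    by (rule power_eventually_le) (use pos k in auto)
  have v4: "\<forall>\<^sub>F n in sequentially. real N * real n ^ (k - 4) \<le> c3 / 4 * real n ^ (k - 3)"
    by (rule power_eventually_le) (use pos k in auto)
  define good where "good n \<longleftrightarrow> c2 * real n ^ (k - 2) \<le> real ((n - 2) choose (k - 2)) \<and>
    c3 * real n ^ (k - 3) \<le> real ((n - 3) choose (k - 3)) \<and>
    real N * real n ^ (k - 3) \<le> c2 / 4 * real n ^ (k - 2) \<and>
    real N * real n ^ (k - 4) \<le> c3 / 4 * real n ^ (k - 3) \<and>
    n \<ge> 2 * (t + N + 1) + 1 \<and> n \<ge> n1 \<and> n \<ge> n2 + t" for n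
  have "\<forall>\<^sub>F n in sequentially. good n"
    unfolding good_def by (intro eventually_conj v1 v2 v3 v4 eventually_ge_at_top)
  then obtain n0 where n0: "\<And>n. n \<ge> n0 \<Longrightarrow> good n" unfolding eventually_sequentially by blast
  show ?thesis
  proof (intro exI[of _ n0] allI impI)
    fix V :: "'v set" and E
    assume V: "finite V" "n0 \<le> card V" and E: "\<forall>e\<in>E. e \<subseteq> V \<and> card e = k" and no: "\<not> cycle_system k I l E"
    let ?J = "if \<forall>i\<in>I. even (l i) then (card V - t - 2) choose (k - 2) else 0"
    let ?b = "(card V choose k) - ((card V - t) choose k)"
    from n0[OF V(2)] have g: "c2 * real (card V) ^ (k - 2) \<le> real ((card V - 2) choose (k - 2))"
      "c3 * real (card V) ^ (k - 3) \<le> real ((card V - 3) choose (k - 3))"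
      "real N * real (card V) ^ (k - 3) \<le> c2 / 4 * real (card V) ^ (k - 2)"
      "real N * real (card V) ^ (k - 4) \<le> c3 / 4 * real (card V) ^ (k - 3)"
      "card V \<ge> 2 * (t + N + 1) + 1" "card V \<ge> n1" "card V \<ge> n2 + t"
      unfolding good_def by blast+
    have vpos: "real (card V) > 0" using g(5) by linarith
    have g3: "real N * real (card V) ^ (k - 3) < c2 / 2 * real (card V) ^ (k - 2)"
    proof -
      have "c2 / 4 * real (card V) ^ (k - 2) < c2 / 2 * real (card V) ^ (k - 2)"
        using pos vpos by (intro mult_strict_right_mono) auto
      then show ?thesis using g(3) by linarith
    qed
    have g4: "real N * real (card V) ^ (k - 4) < c3 / 2 * real (card V) ^ (k - 3)"
    proof -
      have "c3 / 4 * real (card V) ^ (k - 3) < c3 / 2 * real (card V) ^ (k - 3)"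
        using pos vpos by (intro mult_strict_right_mono) auto
      then show ?thesis using g(4) by linarith
    qed
    have "real (card V) \<ge> real (2 * (t + N + 1) + 1)" using g(5) by (simp only: of_nat_le_iff)
    then have g5: "real (card V) > 2 * (real t + real N + 1)" by simp
    show "card E \<le> ?b + ?J"
    proof (cases "?b \<le> card E")
      case False
      then show ?thesis by linarith
    next
      case True
      obtain T where T: "T \<subseteq> V" "card T = t" "real (card {e \<in> E. e \<inter> T = {}}) \<le> \<epsilon> * real (card V) ^ (k - 1)"
        using n1[rule_format, OF V(1) g(6) _ no True] E by blast
      have fE: "finite E" using V E by (intro finite_subset[of E "Pow V"]) auto
      have fT: "finite T" using T V finite_subset by blast
      define F0 where "F0 = {e \<in> E. e \<inter> T = {}}"
      define Mi where "Mi = {e. e \<subseteq> V \<and> card e = k \<and> e \<inter> T \<noteq> {} \<and> e \<notin> E}"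
      define X where "X = {e. e \<subseteq> V \<and> card e = k}"
      define Y where "Y = {e. e \<subseteq> V - T \<and> card e = k}"
      have fin: "finite X" "finite Y" "finite Mi" using V by (auto simp: X_def Y_def Mi_def finite_uniform)
      have YX: "Y \<subseteq> X" by (auto simp: X_def Y_def)
      have "card X = card V choose k" "card Y = (card V - t) choose k"
        using V T fT by (simp_all add: X_def Y_def n_subsets card_Diff_subset)
      then have "card (X - Y) = ?b" using fin YX by (simp add: card_Diff_subset)
      moreover have "X - Y = Mi \<union> (E - F0)" using E by (auto simp: X_def Y_def Mi_def F0_def)
      moreover have "Mi \<inter> (E - F0) = {}" by (auto simp: Mi_def)
      ultimately have "card Mi + card (E - F0) = ?b" using fin fE by (metis card_Un_disjoint finite_Diff)
      moreover have "card (E - F0) = card E - card F0" "card F0 \<le> card E" using fE card_mono[OF fE, of F0]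
        by (auto simp: F0_def card_Diff_subset)
      \<comment> \<open>Both sides count the k-sets meeting \<open>T\<close>, present or missing,
        plus the edges avoiding \<open>T\<close>.\<close>
      ultimately have bal: "card E + card Mi = ?b + card F0" by linarith
      then have MF: "card Mi \<le> card F0" using True by linarith
      have "card F0 \<le> card Mi + ?J"
      proof (rule card_avoiding_le_card_missing[OF V(1) _ no T(1,2) F0_def _ Mi_def MF c be(1,2) \<epsilon>_def be(3) g(1,2) g3 g4 g5])
        show "e \<subseteq> V \<and> card e = k" if "e \<in> E" for e using E that by blast
        show "real (card F0) \<le> \<epsilon> * real (card V) ^ (k - 1)" using T(3) by (simp add: F0_def)
        fix F :: "'v set set" assume F: "\<forall>e\<in>F. e \<subseteq> V - T \<and> card e = k" "\<forall>e\<in>F. \<forall>e'\<in>F. card (e \<inter> e') \<noteq> 1"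
        have "card (V - T) = card V - t" using V T fT by (simp add: card_Diff_subset)
        moreover have "finite (V - T)" "n2 \<le> card V - t" using V g(7) by auto
        ultimately show "card F \<le> (card V - t - 2) choose (k - 2)" using n2[rule_format, of "V - T" F] F by simp
      qed
      then show ?thesis using bal by linarith
    qed
  qed
qed

end

section \<open>Combining the construction with the upper bound\<close>

theorem theorem6:
  fixes k r :: nat and l :: "nat \<Rightarrow> nat"
  assumes "k \<ge> 5" and "r \<ge> 1" and "\<And>i. i \<in> {1..r} \<Longrightarrow> l i \<ge> 3"
  defines "t \<equiv> (\<Sum>i=1..r. (l i + 1) div 2) - 1"
  defines "J \<equiv> \<lambda>n. if \<forall>i\<in>{1..r}. even (l i) then (n - t - 2) choose (k - 2) else 0"
  shows "\<forall>\<^sub>F n in sequentially.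
           \<forall>C :: nat \<Rightarrow> 'a hypergraph. (\<forall>i\<in>{1..r}. linear_cycle k (l i) (C i)) \<longrightarrow>
             ex k n (disjoint_union {1..r} C) = (n choose k) - ((n - t) choose k) + J n"
proof -
  have "(\<Sum>i=1..r. (l i + 1) div 2) \<ge> (\<Sum>i=1..r. 1)"
    by (intro sum_mono) (use assms(3) in fastforce)
  then have t: "t + 1 = (\<Sum>i=1..r. (l i + 1) div 2)" using \<open>r \<ge> 1\<close> by (simp add: t_def)
  interpret cycle_lengths k "{1..r}" l "\<lambda>i. (l i + 1) div 2" t "2 * k * sum l {1..r}"
    by unfold_locales (use assms(1-3) t in auto)
  from upper_bound obtain n0 where n0: "\<forall>(V :: nat set) E. finite V \<longrightarrow> card V \<ge> n0 \<longrightarrow> (\<forall>e\<in>E. e \<subseteq> V \<and> card e = k) \<longrightarrow>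
    \<not> cycle_system k {1..r} l E \<longrightarrow>
    card E \<le> (card V choose k) - ((card V - t) choose k) + (if \<forall>i\<in>{1..r}. even (l i) then (card V - t - 2) choose (k - 2) else 0)"
    by (elim exE)
  show ?thesis
    unfolding eventually_sequentially
  \<comment> \<open>The summand \<open>t + 2\<close> guarantees room for the pair {t, t + 1} of the
    construction.\<close>
  proof (intro exI[of _ "max n0 (t + 2)"] allI impI)
    fix n and C :: "nat \<Rightarrow> 'a hypergraph"
    assume n: "max n0 (t + 2) \<le> n" and C: "\<forall>i\<in>{1..r}. linear_cycle k (l i) (C i)"
    have C': "linear_cycle k (l i) (C i)" if "i \<in> {1..r}" for i using C that by blast
    let ?G = "disjoint_union {1..r} C"
    show "ex k n ?G = (n choose k) - ((n - t) choose k) + J n"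
      unfolding ex_def
    proof (rule Max_eqI[OF finite_free_sizes])
      fix m assume "m \<in> free_sizes k n ?G"
      then obtain V :: "nat set" and E where VE: "m = card E" "finite V" "card V = n" "k_uniform k (V, E)" "\<not> contains (V, E) ?G"
        unfolding free_sizes_def by blast
      have E: "\<forall>e\<in>E. e \<subseteq> V \<and> card e = k" using VE(4) by (simp add: k_uniform_def)
      then have EV: "\<Union> E \<subseteq> V" by blast
      have "\<not> cycle_system k {1..r} l E"
      proof
        assume sys: "cycle_system k {1..r} l E"
        have "k \<ge> 1" using \<open>k \<ge> 5\<close> by simp
        from contains_disjoint_union[OF C' assms(3) this EV sys] VE(5) show False by blast
      qed
      moreover have "n0 \<le> card V" using n VE(3) by simp
      ultimately show "m \<le> (n choose k) - ((n - t) choose k) + J n"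
        using n0[THEN spec, THEN spec, of V E] E VE(2) unfolding J_def VE(1) VE(3)[symmetric] by blast
    next
      define E where "E = {e. e \<subseteq> {..<n} \<and> card e = k \<and> (e \<inter> {..<t} \<noteq> {} \<or> (\<forall>i\<in>{1..r}. even (l i)) \<and> {t, t + 1} \<subseteq> e)}"
      have low: "\<not> cycle_system k {1..r} l E" "card E = (n choose k) - ((n - t) choose k) + J n"
        unfolding E_def J_def
        using lower_construction[OF finite_atLeastAtMost assms(3) refl t, of n k] n \<open>k \<ge> 5\<close> by simp_all
      have "\<not> contains ({..<n}, E) ?G"
      proof
        assume "contains ({..<n}, E) ?G"
        from cycle_system_if_contains[OF C' assms(3) this] low(1) show False by blast
      qed
      moreover have "k_uniform k ({..<n}, E)" by (auto simp: k_uniform_def E_def)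
      ultimately show "(n choose k) - ((n - t) choose k) + J n \<in> free_sizes k n ?G"
        unfolding free_sizes_def low(2)[symmetric] by (intro CollectI exI[of _ "{..<n}"] exI[of _ E]) simp
    qed
  qed
qed

end
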